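(* Let $\varphi, \psi \in H^{\infty}(\mathbb{D})$ be two non-constant inner functions, let $\mathcal{Q}_{\varphi} = H^2(\mathbb{D}) \ominus \varphi H^2(\mathbb{D})$ and $\mathcal{Q}_{\psi} = H^2(\mathbb{D}) \ominus \psi H^2(\mathbb{D})$, and let \[ \mathcal{S} = \left(\mathcal{Q}_{\varphi} \otimes \mathcal{Q}_{\psi}\right)^{\perp}, \] the orthogonal complement being taken in $H^2(\mathbb{D}^2)$. Then $\operatorname{rank} \mathcal{S} = 2$.
   Context: $\mathbb{D}$ is the open unit disc in $\mathbb{C}$ and $\mathbb{T}$ the unit circle. $H^2(\mathbb{D})$ and $H^2(\mathbb{D}^2)$ are the Hardy spaces over the disc and the bidisc (Hilbert spaces of holomorphic functions with square summable power series coefficients), and $H^\infty(\mathbb{D})$ is the algebra of bounded holomorphic functions on $\mathbb{D}$. $H^2(\mathbb{D}^2)$ is identified with the Hilbert space tensor product $H^2(\mathbb{D}) \otimes H^2(\mathbb{D})$, where $f\otimes g$ corresponds to the function $(z,w)\mapsto f(z)g(w)$. An inner function is a $\varphi \in H^\infty(\mathbb{D})$ whose boundary values satisfy $|\varphi| = 1$ a.e. on $\mathbb{T}$. $M_z$ and $M_w$ are the operators of multiplication by the coordinate functions $z$ and $w$ on $H^2(\mathbb{D}^2)$. A submodule of $H^2(\mathbb{D}^2)$ is a closed subspace $\mathcal{S}$ with $M_z \mathcal{S} \subseteq \mathcal{S}$ and $M_w \mathcal{S} \subseteq \mathcal{S}$; the space $\mathcal{S}$ in the claim is a submodule. Rank: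 for an $n$-tuple $T = (T_1, \ldots, T_n)$ of commuting bounded linear operators on a Hilbert space $\mathcal{H}$ and $E \subseteq \mathcal{H}$, let $[E]_T$ be the closed linear span of $\{T_1^{k_1}\cdots T_n^{k_n} f : f \in E,\ k_1,\ldots,k_n \in \mathbb{N}\}$, where $\mathbb{N}$ includes $0$. Then $\operatorname{rank}(T) = \min\{\# E : E \subseteq \mathcal{H},\ [E]_T = \mathcal{H}\}$. The rank of a submodule $\mathcal{S}$ of $H^2(\mathbb{D}^2)$ is $\operatorname{rank} \mathcal{S} = \operatorname{rank}(M_z|_{\mathcal{S}}, M_w|_{\mathcal{S}})$, an operator pair on $\mathcal{S}$. *)

theory Defs
  imports "HOL-Complex_Analysis.Complex_Analysis" "HOL-Library.Extended_Nat"
begin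

section \<open>Complex Hilbert spaces\<close>

class scaleC =
  fixes scaleC :: "complex \<Rightarrow> 'a \<Rightarrow> 'a"  (infixr "*\<^sub>C" 75)

text \<open>The inner product is linear in its first argument; the norm and the topology are those
  of the underlying real inner product space, whose inner product is the real part.\<close>

class complex_inner_space = real_inner + scaleC +
  fixes cinner :: "'a \<Rightarrow> 'a \<Rightarrow> complex"
  assumes scaleC_add_right: "c *\<^sub>C (x + y) = c *\<^sub>C x + c *\<^sub>C y"
    and scaleC_add_left: "(c + d) *\<^sub>C x = c *\<^sub>C x + d *\<^sub>C x"
    and scaleC_scaleC: "c *\<^sub>C d *\<^sub>C x = (c * d) *\<^sub>C x"
    and scaleR_scaleC: "r *\<^sub>R x = complex_of_real r *\<^sub>C x"
    and cinner_commute: "cinner x y = cnj (cinner y x)"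
    and cinner_add_left: "cinner (x + y) z = cinner x z + cinner y z"
    and cinner_scaleC_left: "cinner (c *\<^sub>C x) y = c * cinner x y"
    and inner_eq_Re_cinner: "inner x y = Re (cinner x y)"

class complex_hilbert_space = complex_inner_space + complete_space

lemma scaleC_one [simp]: "1 *\<^sub>C x = (x :: 'a::complex_inner_space)"
  using scaleR_scaleC[of 1 x] by simp

lemma vector_space_scaleC:
  "vector_space (scaleC :: complex \<Rightarrow> 'a::complex_inner_space \<Rightarrow> 'a)"
  by (unfold_locales; rule scaleC_add_right scaleC_add_left scaleC_scaleC scaleC_one)

definition cspan :: "'a::complex_inner_space set \<Rightarrow> 'a set"
  where "cspan = module.span scaleC"

definition closed_cspan :: "'a::complex_inner_space set \<Rightarrow> 'a set"
  where "closed_cspan A = closure (cspan A)"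

definition orth_compl :: "'a::complex_inner_space set \<Rightarrow> 'a set"
  where "orth_compl A = {x. \<forall>y\<in>A. cinner x y = 0}"

lemma cinner_add_right: "cinner x (y + z) = cinner x y + cinner x (z :: 'a::complex_inner_space)"
  by (metis cinner_add_left cinner_commute complex_cnj_add)

lemma cinner_scaleC_right: "cinner x (c *\<^sub>C y) = cnj c * cinner x (y :: 'a::complex_inner_space)"
  by (metis cinner_scaleC_left cinner_commute complex_cnj_mult)

lemma cinner_zero_left [simp]: "cinner 0 (x :: 'a::complex_inner_space) = 0"
  using cinner_add_left[of 0 0 x] by simp

lemma cinner_eq_0_iff:
  "cinner x (y :: 'a::complex_inner_space) = 0 \<longleftrightarrow> inner x y = 0 \<and> inner x (\<i> *\<^sub>C y) = 0"
  by (simp add: inner_eq_Re_cinner cinner_scaleC_right complex_eq_iff)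

lemma closed_orth_compl: "closed (orth_compl (A :: 'a::complex_inner_space set))"
  unfolding orth_compl_def cinner_eq_0_iff Ball_def
  by (intro closed_Collect_all closed_Collect_imp open_Collect_const closed_Collect_conj closed_Collect_eq continuous_intros)

lemma subspace_orth_compl: "module.subspace scaleC (orth_compl (A :: 'a::complex_inner_space set))"
proof -
  interpret vector_space "scaleC :: complex \<Rightarrow> 'a \<Rightarrow> 'a" by (rule vector_space_scaleC)
  show ?thesis
    by (rule subspaceI) (auto simp: orth_compl_def cinner_add_left cinner_scaleC_left)
qed

lemma orth_compl_closed_cspan:
  "orth_compl (closed_cspan A) = orth_compl (A :: 'a::complex_inner_space set)"
proof -
  interpret vector_space "scaleC :: complex \<Rightarrow> 'a \<Rightarrow> 'a" by (rule vector_space_scaleC)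
  have sub: "A \<subseteq> closed_cspan A"
    unfolding closed_cspan_def cspan_def using span_superset closure_subset by blast
  have "closed_cspan A \<subseteq> orth_compl (orth_compl A)"
    unfolding closed_cspan_def cspan_def
  proof (intro closure_minimal span_minimal subspace_orth_compl closed_orth_compl)
    show "A \<subseteq> orth_compl (orth_compl A)"
      by (auto simp: orth_compl_def) (subst cinner_commute, simp)
  qed
  then have "cinner x y = 0" if "x \<in> orth_compl A" "y \<in> closed_cspan A" for x y
    using that by (subst cinner_commute) (auto simp: orth_compl_def)
  then have "orth_compl A \<subseteq> orth_compl (closed_cspan A)"
    by (auto simp: orth_compl_def)
  with sub show ?thesis by (auto simp: orth_compl_def)
qed


section \<open>Rank of a tuple of operators\<close>

definition monomial_op :: "('a \<Rightarrow> 'a) list \<Rightarrow> nat list \<Rightarrow> 'a \<Rightarrow> 'a"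
  where "monomial_op Ts ks = foldr (\<lambda>(T, k) g. (T ^^ k) \<circ> g) (zip Ts ks) id"

definition generated_subspace ::
    "('a::complex_hilbert_space \<Rightarrow> 'a) list \<Rightarrow> 'a set \<Rightarrow> 'a set"
  where "generated_subspace Ts E =
    closed_cspan {monomial_op Ts ks f | ks f. length ks = length Ts \<and> f \<in> E}"

definition ecard :: "'a set \<Rightarrow> enat"
  where "ecard E = (if finite E then enat (card E) else \<infinity>)"

text \<open>
  \<open>operator_rank H Ts\<close> is the rank of the restrictions to \<open>H\<close> of the operators \<open>Ts\<close>, for \<open>H\<close> a
  closed subspace invariant under \<open>Ts\<close>. Only values on \<open>H\<close> enter, and the closure in the ambient
  space agrees with the closure in \<open>H\<close> since \<open>H\<close> is closed. As \<^typ>\<open>enat\<close> is well-ordered and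
  \<open>E = H\<close> is admissible, the infimum is a minimum; all infinite cardinalities become \<open>\<infinity>\<close>.
\<close>

definition operator_rank :: "'a::complex_hilbert_space set \<Rightarrow> ('a \<Rightarrow> 'a) list \<Rightarrow> enat"
  where "operator_rank H Ts = Inf {ecard E | E. E \<subseteq> H \<and> generated_subspace Ts E = H}"


section \<open>Square summable expansions\<close>

definition square_summable :: "('i \<Rightarrow> complex) \<Rightarrow> bool"
  where "square_summable a \<longleftrightarrow> (\<lambda>i. (cmod (a i))\<^sup>2) summable_on UNIV"

definition l2_inner :: "('i \<Rightarrow> complex) \<Rightarrow> ('i \<Rightarrow> complex) \<Rightarrow> complex"
  where "l2_inner a b = (\<Sum>\<^sub>\<infinity>i. a i * cnj (b i))"

lemma square_summable_prod_abs:
  assumes "square_summable a" "square_summable b"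
  shows "(\<lambda>i. norm (a i * b i)) summable_on UNIV"
  using assms unfolding square_summable_def power2_eq_square norm_mult[symmetric]
  by (rule abs_summable_product)

lemma square_summable_cnj: "square_summable a \<Longrightarrow> square_summable (\<lambda>i. cnj (a i))"
  by (simp add: square_summable_def)

lemma square_summable_prod:
  assumes "square_summable a" "square_summable b"
  shows "(\<lambda>i. a i * b i) summable_on UNIV"
  using square_summable_prod_abs[OF assms] by (rule abs_summable_summable)

lemma square_summable_inner:
  assumes "square_summable a" "square_summable b"
  shows "(\<lambda>i. a i * cnj (b i)) summable_on UNIV"
  using square_summable_prod[OF assms(1) square_summable_cnj[OF assms(2)]] .

lemma square_summable_scale: "square_summable a \<Longrightarrow> square_summable (\<lambda>i. c * a i)"
  unfolding square_summable_def by (simp add: norm_mult power_mult_distrib summable_on_cmult_right)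

lemma square_summable_add:
  assumes "square_summable a" "square_summable b"
  shows "square_summable (\<lambda>i. a i + b i)"
  unfolding square_summable_def
proof (rule summable_on_comparison_test)
  show "(\<lambda>i. 2 * (cmod (a i))\<^sup>2 + 2 * (cmod (b i))\<^sup>2) summable_on UNIV"
    using assms unfolding square_summable_def by (intro summable_on_add summable_on_cmult_right)
  fix i
  have "(cmod (a i + b i))\<^sup>2 \<le> (cmod (a i) + cmod (b i))\<^sup>2"
    by (intro power_mono norm_triangle_ineq) simp
  also have "\<dots> \<le> 2 * (cmod (a i))\<^sup>2 + 2 * (cmod (b i))\<^sup>2"
    using sum_squares_bound[of "cmod (a i)" "cmod (b i)"] by (simp add: power2_sum)
  finally show "(cmod (a i + b i))\<^sup>2 \<le> 2 * (cmod (a i))\<^sup>2 + 2 * (cmod (b i))\<^sup>2" .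
qed auto

lemma square_summable_zero: "square_summable (\<lambda>_. 0)"
  by (simp add: square_summable_def)

lemma square_summable_diff:
  assumes "square_summable a" "square_summable b"
  shows "square_summable (\<lambda>i. a i - b i)"
  using square_summable_add[OF assms(1) square_summable_scale[OF assms(2), of "-1"]] by simp

lemma l2_inner_commute: "l2_inner a b = cnj (l2_inner b a)"
  unfolding l2_inner_def infsum_cnj[symmetric] by (simp add: mult.commute)

lemma l2_inner_add_left:
  assumes "square_summable a" "square_summable b" "square_summable c"
  shows "l2_inner (\<lambda>i. a i + b i) c = l2_inner a c + l2_inner b c"
  unfolding l2_inner_def
  by (simp add: distrib_right infsum_add square_summable_inner assms)

lemma l2_inner_scale_left: "l2_inner (\<lambda>i. c * a i) b = c * l2_inner a b"
  unfolding l2_inner_def by (simp add: mult.assoc infsum_cmult_right')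

lemma l2_inner_self:
  assumes "square_summable a"
  shows "l2_inner a a = complex_of_real (\<Sum>\<^sub>\<infinity>i. (cmod (a i))\<^sup>2)"
proof -
  have "l2_inner a a = (\<Sum>\<^sub>\<infinity>i. complex_of_real ((cmod (a i))\<^sup>2))"
    unfolding l2_inner_def by (intro infsum_cong complex_norm_square[symmetric])
  also have "\<dots> = complex_of_real (\<Sum>\<^sub>\<infinity>i. (cmod (a i))\<^sup>2)"
    using assms has_sum_of_real[OF has_sum_infsum, of "\<lambda>i. (cmod (a i))\<^sup>2" UNIV]
    by (intro infsumI) (simp add: square_summable_def)
  finally show ?thesis .
qed

lemma l2_inner_self_eq_0:
  assumes "square_summable a"
  shows "Re (l2_inner a a) = 0 \<longleftrightarrow> a = (\<lambda>_. 0)"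
proof
  assume "Re (l2_inner a a) = 0"
  then have *: "(\<Sum>\<^sub>\<infinity>i. (cmod (a i))\<^sup>2) \<le> 0"
    using assms by (simp add: l2_inner_self)
  have "(cmod (a i))\<^sup>2 = 0" for i
    by (rule nonneg_infsum_le_0D[OF *]) (use assms in \<open>auto simp: square_summable_def\<close>)
  then show "a = (\<lambda>_. 0)" by auto
qed (simp add: l2_inner_def)

lemma l2_component_le:
  assumes "square_summable a"
  shows "cmod (a i) \<le> sqrt (Re (l2_inner a a))"
proof -
  have "(\<Sum>i\<in>{i}. (cmod (a i))\<^sup>2) \<le> (\<Sum>\<^sub>\<infinity>i. (cmod (a i))\<^sup>2)"
    by (rule finite_sum_le_infsum) (use assms in \<open>auto simp: square_summable_def\<close>)
  then show ?thesis
    using assms by (simp add: l2_inner_self real_le_rsqrt)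
qed

lemma l2_complete:
  fixes x :: "nat \<Rightarrow> 'i \<Rightarrow> complex"
  defines "d \<equiv> \<lambda>a b. sqrt (Re (l2_inner (\<lambda>i. a i - b i) (\<lambda>i. a i - b i :: complex)))"
  assumes ss: "\<And>n. square_summable (x n)"
    and Cau: "\<And>e. e > 0 \<Longrightarrow> \<exists>N. \<forall>m\<ge>N. \<forall>n\<ge>N. d (x m) (x n) < e"
  shows "\<exists>y. square_summable y \<and> (\<forall>e>0. \<exists>N. \<forall>n\<ge>N. d (x n) y < e)"
proof -
  have d_eq: "d a b = sqrt (\<Sum>\<^sub>\<infinity>i. (cmod (a i - b i))\<^sup>2)"
    if "square_summable (\<lambda>i. a i - b i)" for a b
    using that by (simp add: d_def l2_inner_self)
  have comp: "cmod (x m i - x n i) \<le> d (x m) (x n)" for m n i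
    unfolding d_def using l2_component_le[OF square_summable_diff[OF ss ss]] .
  have "Cauchy (\<lambda>n. x n i)" for i
    unfolding Cauchy_def dist_norm using Cau comp by (meson le_less_trans)
  then have "convergent (\<lambda>n. x n i)" for i
    by (simp add: Cauchy_convergent)
  then obtain y where y: "(\<lambda>n. x n i) \<longlonglongrightarrow> y i" for i
    unfolding convergent_def by metis
  have fin: "(\<Sum>i\<in>F. (cmod (x n i - y i))\<^sup>2) \<le> e\<^sup>2"
    if "e > 0" and N: "\<forall>m\<ge>N. \<forall>n\<ge>N. d (x m) (x n) < e" and "n \<ge> N" and "finite F" for e N n F
  proof (rule tendsto_upperbound)
    show "(\<lambda>m. \<Sum>i\<in>F. (cmod (x n i - x m i))\<^sup>2) \<longlonglongrightarrow> (\<Sum>i\<in>F. (cmod (x n i - y i))\<^sup>2)"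
      by (intro tendsto_intros y)
    have "(\<Sum>i\<in>F. (cmod (x n i - x m i))\<^sup>2) \<le> e\<^sup>2" if "m \<ge> N" for m
    proof -
      have "(\<Sum>i\<in>F. (cmod (x n i - x m i))\<^sup>2) \<le> (\<Sum>\<^sub>\<infinity>i. (cmod (x n i - x m i))\<^sup>2)"
        by (rule finite_sum_le_infsum)
          (use square_summable_diff[OF ss ss] \<open>finite F\<close> in \<open>auto simp: square_summable_def\<close>)
      also have "\<dots> = (d (x n) (x m))\<^sup>2"
        by (simp add: d_eq[OF square_summable_diff[OF ss ss]] infsum_nonneg)
      also have "\<dots> \<le> e\<^sup>2"
        using N \<open>n \<ge> N\<close> that by (intro power_mono) (auto simp: less_imp_le d_eq[OF square_summable_diff[OF ss ss]] infsum_nonneg)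
      finally show ?thesis .
    qed
    then show "\<forall>\<^sub>F m in sequentially. (\<Sum>i\<in>F. (cmod (x n i - x m i))\<^sup>2) \<le> e\<^sup>2"
      by (auto simp: eventually_sequentially)
  qed simp
  have summ: "square_summable (\<lambda>i. x n i - y i)"
    if "e > 0" "\<forall>m\<ge>N. \<forall>n\<ge>N. d (x m) (x n) < e" "n \<ge> N" for e N n
    unfolding square_summable_def
    by (rule nonneg_bdd_above_summable_on) (use fin[OF that] in \<open>auto intro!: bdd_aboveI[of _ "e\<^sup>2"]\<close>)
  obtain N1 where N1: "\<forall>m\<ge>N1. \<forall>n\<ge>N1. d (x m) (x n) < 1"
    using Cau[of 1] by auto
  have "square_summable y"
    using square_summable_diff[OF ss[of N1] summ[OF _ N1 order_refl]] by simp
  moreover have "\<exists>N. \<forall>n\<ge>N. d (x n) y < e" if "e > 0" for e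
  proof -
    obtain N where N: "\<forall>m\<ge>N. \<forall>n\<ge>N. d (x m) (x n) < e / 2"
      using Cau[of "e / 2"] \<open>e > 0\<close> by auto
    have "d (x n) y < e" if "n \<ge> N" for n
    proof -
      have "(\<Sum>\<^sub>\<infinity>i. (cmod (x n i - y i))\<^sup>2) \<le> (e / 2)\<^sup>2"
        by (rule infsum_le_finite_sums)
          (use fin[OF _ N that] summ[OF _ N that] \<open>e > 0\<close> in \<open>auto simp: square_summable_def\<close>)
      then have "d (x n) y \<le> e / 2"
        using \<open>e > 0\<close> d_eq[OF summ[OF _ N that]] real_sqrt_le_mono by fastforce
      then show ?thesis using \<open>e > 0\<close> by simp
    qed
    then show ?thesis by blast
  qed
  ultimately show ?thesis by blast
qed

text \<open>\<open>f\<close> is on \<open>D\<close> the sum of the series with square summable coefficients \<open>a\<close> in the monomials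
  \<open>e p i\<close>. Functions are normalised to vanish off \<open>D\<close>, so that equality of functions is equality
  on \<open>D\<close>.\<close>

definition l2_expansion ::
    "('p \<Rightarrow> 'i \<Rightarrow> complex) \<Rightarrow> 'p set \<Rightarrow> ('p \<Rightarrow> complex) \<Rightarrow> ('i \<Rightarrow> complex) \<Rightarrow> bool"
  where "l2_expansion e D f a \<longleftrightarrow> square_summable a
    \<and> (\<forall>p\<in>D. ((\<lambda>i. a i * e p i) has_sum f p) UNIV) \<and> (\<forall>p. p \<notin> D \<longrightarrow> f p = 0)"

lemma l2_expansion_fun_unique:
  "l2_expansion e D f a \<Longrightarrow> l2_expansion e D g a \<Longrightarrow> f = g"
  unfolding l2_expansion_def by (metis ext has_sum_unique)

lemma l2_expansion_add:
  "l2_expansion e D f a \<Longrightarrow> l2_expansion e D g b \<Longrightarrow>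
    l2_expansion e D (\<lambda>p. f p + g p) (\<lambda>i. a i + b i)"
  unfolding l2_expansion_def by (simp add: square_summable_add distrib_right has_sum_add)

lemma l2_expansion_scale:
  "l2_expansion e D f a \<Longrightarrow> l2_expansion e D (\<lambda>p. c * f p) (\<lambda>i. c * a i)"
  unfolding l2_expansion_def
  by (simp add: square_summable_scale mult.assoc has_sum_cmult_right)

lemma l2_expansion_zero: "l2_expansion e D (\<lambda>_. 0) (\<lambda>_. 0)"
  unfolding l2_expansion_def by (simp add: square_summable_zero)

lemma l2_expansion_exists:
  assumes "square_summable a" "\<And>p. p \<in> D \<Longrightarrow> square_summable (e p)"
  shows "\<exists>f. l2_expansion e D f a"
proof
  show "l2_expansion e D (\<lambda>p. if p \<in> D then \<Sum>\<^sub>\<infinity>i. a i * e p i else 0) a"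
    unfolding l2_expansion_def using assms by (auto intro!: has_sum_infsum square_summable_prod)
qed


lemma l2_expansion_shift:
  fixes j :: "'i \<Rightarrow> 'i"
  assumes F: "l2_expansion e D F a" and "inj j"
    and shift: "\<And>p i. e p (j i) = c p * e p i"
  shows "l2_expansion e D (\<lambda>p. c p * F p)
    (\<lambda>i. if i \<in> range j then a (inv j i) else 0)"
  unfolding l2_expansion_def
proof (intro conjI ballI allI impI)
  show "square_summable (\<lambda>i. if i \<in> range j then a (inv j i) else 0)"
  proof -
    have "(\<lambda>i. (cmod (a (inv j i)))\<^sup>2) summable_on range j"
      using F summable_on_reindex[OF \<open>inj j\<close>, of "\<lambda>i. (cmod (a (inv j i)))\<^sup>2"] \<open>inj j\<close>
      by (simp add: o_def l2_expansion_def square_summable_def)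
    then show ?thesis
      unfolding square_summable_def
      by (rule summable_on_cong_neutral[THEN iffD1, rotated -1]) auto
  qed
  fix p assume p: "p \<in> D"
  have "((\<lambda>i. c p * (a i * e p i)) has_sum c p * F p) UNIV"
    using F p by (intro has_sum_cmult_right) (auto simp: l2_expansion_def)
  then have "((\<lambda>i. a (inv j i) * e p i) has_sum c p * F p) (range j)"
    using has_sum_reindex[OF \<open>inj j\<close>, of "\<lambda>i. a (inv j i) * e p i"] \<open>inj j\<close>
    by (simp add: o_def shift mult_ac)
  then show "((\<lambda>i. (if i \<in> range j then a (inv j i) else 0) * e p i) has_sum c p * F p) UNIV"
    by (rule has_sum_cong_neutral[THEN iffD1, rotated -1]) auto
next
  fix p assume "p \<notin> D"
  then show "c p * F p = 0" using F unfolding l2_expansion_def by (metis mult_zero_right)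
qed

lemma l2_inner_shift:
  fixes j :: "'i \<Rightarrow> 'i"
  assumes "inj j"
  shows "l2_inner (\<lambda>i. if i \<in> range j then a (inv j i) else 0) b = l2_inner a (\<lambda>i. b (j i))"
proof -
  have "l2_inner (\<lambda>i. if i \<in> range j then a (inv j i) else 0) b
      = (\<Sum>\<^sub>\<infinity>i\<in>range j. a (inv j i) * cnj (b i))"
    unfolding l2_inner_def by (rule infsum_cong_neutral) auto
  also have "\<dots> = l2_inner a (\<lambda>i. b (j i))"
    unfolding l2_inner_def using infsum_reindex[OF assms, of "\<lambda>i. a (inv j i) * cnj (b i)"] assms
    by (simp add: o_def)
  finally show ?thesis .
qed


section \<open>Hardy spaces of the disc and the bidisc\<close>

definition disc_monom :: "complex \<Rightarrow> nat \<Rightarrow> complex"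
  where "disc_monom z n = z ^ n"

definition bidisc_monom :: "complex \<times> complex \<Rightarrow> nat \<times> nat \<Rightarrow> complex"
  where "bidisc_monom = (\<lambda>(z, w) (m, n). z ^ m * w ^ n)"

abbreviation unit_disc :: "complex set"  ("\<D>")
  where "\<D> \<equiv> ball 0 1"

typedef hardy_disc = "{f. \<exists>a. l2_expansion disc_monom \<D> f a}"
  morphisms disc_fun Abs_hardy_disc
  using l2_expansion_zero by blast

typedef hardy_bidisc = "{F. \<exists>a. l2_expansion bidisc_monom (\<D> \<times> \<D>) F a}"
  morphisms bidisc_fun Abs_hardy_bidisc
  using l2_expansion_zero by blast

setup_lifting type_definition_hardy_disc
setup_lifting type_definition_hardy_bidisc

lemma square_summable_disc_monom: "z \<in> \<D> \<Longrightarrow> square_summable (disc_monom z)"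
proof -
  assume "z \<in> \<D>"
  then have "summable (\<lambda>n. ((cmod z)\<^sup>2) ^ n)"
    by (intro summable_geometric) (simp add: power_less_one_iff abs_square_less_1)
  then show ?thesis
    unfolding square_summable_def disc_monom_def
    by (subst summable_on_UNIV_nonneg_real_iff) (auto simp: norm_power simp flip: power_mult power_mult_distrib, simp add: mult.commute)
qed

lemma square_summable_tensor:
  assumes "square_summable a" "square_summable b"
  shows "square_summable (\<lambda>(m, n). a m * b n)"
proof -
  have "(\<lambda>(m, n). (cmod (a m))\<^sup>2 * (cmod (b n))\<^sup>2) summable_on (UNIV \<times> UNIV)"
    by (rule summable_on_SigmaI[where g = "\<lambda>m. (cmod (a m))\<^sup>2 * (\<Sum>\<^sub>\<infinity>n. (cmod (b n))\<^sup>2)"])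
      (use assms in \<open>auto simp: square_summable_def intro!: has_sum_cmult_right summable_on_cmult_left\<close>)
  then show ?thesis
    by (simp add: square_summable_def norm_mult power_mult_distrib case_prod_unfold)
qed

lemma bidisc_monom_eq: "bidisc_monom (z, w) = (\<lambda>(m, n). disc_monom z m * disc_monom w n)"
  by (simp add: bidisc_monom_def disc_monom_def)

lemma square_summable_bidisc_monom: "p \<in> \<D> \<times> \<D> \<Longrightarrow> square_summable (bidisc_monom p)"
  by (cases p) (auto simp: bidisc_monom_eq intro!: square_summable_tensor square_summable_disc_monom)

lemma power_series_zero:
  assumes "\<And>z. z \<in> \<D> \<Longrightarrow> ((\<lambda>n. a n * z ^ n) has_sum 0) UNIV"
  shows "a = (\<lambda>_. 0 :: complex)"
proof (rule ccontr)
  assume "a \<noteq> (\<lambda>_. 0)"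
  then obtain m where m: "a m \<noteq> 0" by auto
  have s: "(\<lambda>n. a n * (z - 0) ^ n) sums 0" if "norm (z - 0) < 1" for z
    using has_sum_imp_sums[OF assms] that by simp
  have "a 0 = 0"
    using s[of 0] by simp
  with m have "m > 0" by (cases m) auto
  obtain t where t: "0 < t" "\<And>z. z \<in> cball 0 t - {0 :: complex} \<Longrightarrow> (0 :: complex) \<noteq> 0"
    by (rule powser_0_nonzero[where r = 1 and \<xi> = 0 and f = "\<lambda>_. 0" and a = a and m = m])
      (use s m \<open>m > 0\<close> in auto)
  have "complex_of_real t \<in> cball 0 t - {0}" using t(1) by auto
  then show False using t(2) by blast
qed

lemma disc_expansion_coeff_unique:
  assumes "l2_expansion disc_monom \<D> f a" "l2_expansion disc_monom \<D> f b"
  shows "a = b"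
proof -
  have "l2_expansion disc_monom \<D> (\<lambda>_. 0) (\<lambda>n. a n - b n)"
    using l2_expansion_add[OF assms(1) l2_expansion_scale[OF assms(2), of "-1"]] by simp
  then have "((\<lambda>n. (a n - b n) * z ^ n) has_sum 0) UNIV" if "z \<in> \<D>" for z
    using that by (simp add: l2_expansion_def disc_monom_def)
  then have "(\<lambda>n. a n - b n) = (\<lambda>_. 0)" by (rule power_series_zero)
  then show ?thesis by (simp add: fun_eq_iff)
qed

lemma bidisc_expansion_zero:
  assumes "l2_expansion bidisc_monom (\<D> \<times> \<D>) (\<lambda>_. 0) a"
  shows "a = (\<lambda>_. 0)"
proof -
  have ss: "square_summable a" using assms by (simp add: l2_expansion_def)
  have row: "square_summable (\<lambda>n. a (m, n))" for m
    using summable_on_SigmaD1[of "\<lambda>m n. (cmod (a (m, n)))\<^sup>2" UNIV "\<lambda>_. UNIV" m] ss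
    by (simp add: square_summable_def case_prod_unfold)
  have rs: "(\<lambda>n. a (m, n) * w ^ n) summable_on UNIV" if "w \<in> \<D>" for m w
    using square_summable_prod[OF row square_summable_disc_monom[OF that]] by (simp add: disc_monom_def)
  have "(\<lambda>m. \<Sum>\<^sub>\<infinity>n. a (m, n) * w ^ n) = (\<lambda>_. 0)" if w: "w \<in> \<D>" for w
  proof (rule power_series_zero)
    fix z assume z: "z \<in> \<D>"
    have 1: "((\<lambda>(m, n). a (m, n) * (z ^ m * w ^ n)) has_sum 0) (UNIV \<times> UNIV)"
      using assms z w by (auto simp: l2_expansion_def bidisc_monom_def case_prod_unfold)
    show "((\<lambda>m. (\<Sum>\<^sub>\<infinity>n. a (m, n) * w ^ n) * z ^ m) has_sum 0) UNIV"
    proof (rule has_sum_SigmaD[OF 1])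
      fix m
      have "((\<lambda>n. (a (m, n) * w ^ n) * z ^ m) has_sum ((\<Sum>\<^sub>\<infinity>n. a (m, n) * w ^ n) * z ^ m)) UNIV"
        using rs[OF w] by (intro has_sum_cmult_left) simp
      then show "((\<lambda>y. case (m, y) of (m, n) \<Rightarrow> a (m, n) * (z ^ m * w ^ n)) has_sum
        (\<Sum>\<^sub>\<infinity>n. a (m, n) * w ^ n) * z ^ m) UNIV"
        by (simp add: mult_ac)
    qed
  qed
  then have inner: "(\<Sum>\<^sub>\<infinity>n. a (m, n) * w ^ n) = 0" if "w \<in> \<D>" for w m
    using that by (metis (no_types))
  have "(\<lambda>n. a (m, n)) = (\<lambda>_. 0)" for m
  proof (rule power_series_zero)
    fix w assume "w \<in> \<D>"
    then show "((\<lambda>n. a (m, n) * w ^ n) has_sum 0) UNIV"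
      using has_sum_infsum[OF rs[of w m]] by (simp add: inner)
  qed
  then have "a (m, n) = 0" for m n
    by (rule fun_cong)
  then show ?thesis by auto
qed

lemma bidisc_expansion_coeff_unique:
  assumes "l2_expansion bidisc_monom (\<D> \<times> \<D>) f a" "l2_expansion bidisc_monom (\<D> \<times> \<D>) f b"
  shows "a = b"
proof -
  have "l2_expansion bidisc_monom (\<D> \<times> \<D>) (\<lambda>_. 0) (\<lambda>i. a i - b i)"
    using l2_expansion_add[OF assms(1) l2_expansion_scale[OF assms(2), of "-1"]] by simp
  from bidisc_expansion_zero[OF this] show ?thesis by (simp add: fun_eq_iff)
qed

definition disc_coeff :: "hardy_disc \<Rightarrow> nat \<Rightarrow> complex"
  where "disc_coeff f = (THE a. l2_expansion disc_monom \<D> (disc_fun f) a)"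

definition bidisc_coeff :: "hardy_bidisc \<Rightarrow> nat \<times> nat \<Rightarrow> complex"
  where "bidisc_coeff F = (THE a. l2_expansion bidisc_monom (\<D> \<times> \<D>) (bidisc_fun F) a)"

lemma disc_coeffI: "l2_expansion disc_monom \<D> (disc_fun f) a \<Longrightarrow> disc_coeff f = a"
  unfolding disc_coeff_def by (blast intro: disc_expansion_coeff_unique)

lemma bidisc_coeffI:
  "l2_expansion bidisc_monom (\<D> \<times> \<D>) (bidisc_fun F) a \<Longrightarrow> bidisc_coeff F = a"
  unfolding bidisc_coeff_def by (blast intro: bidisc_expansion_coeff_unique)

lemma disc_expansion: "l2_expansion disc_monom \<D> (disc_fun f) (disc_coeff f)"
  using disc_fun[of f] disc_coeffI by fastforce

lemma bidisc_expansion: "l2_expansion bidisc_monom (\<D> \<times> \<D>) (bidisc_fun F) (bidisc_coeff F)"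
  using bidisc_fun[of F] bidisc_coeffI by fastforce

lemma square_summable_disc_coeff [simp]: "square_summable (disc_coeff f)"
  using disc_expansion l2_expansion_def by blast

lemma square_summable_bidisc_coeff [simp]: "square_summable (bidisc_coeff F)"
  using bidisc_expansion l2_expansion_def by blast

lemma disc_coeff_inject: "disc_coeff f = disc_coeff g \<longleftrightarrow> f = g"
  by (metis disc_expansion l2_expansion_fun_unique disc_fun_inject)

lemma bidisc_coeff_inject: "bidisc_coeff F = bidisc_coeff G \<longleftrightarrow> F = G"
  by (metis bidisc_expansion l2_expansion_fun_unique bidisc_fun_inject)

lemma disc_coeff_surj: "square_summable a \<Longrightarrow> \<exists>f. disc_coeff f = a"
  using l2_expansion_exists[of a \<D> disc_monom] square_summable_disc_monom
  by (metis Abs_hardy_disc_inverse disc_coeffI mem_Collect_eq)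

lemma bidisc_coeff_surj: "square_summable a \<Longrightarrow> \<exists>F. bidisc_coeff F = a"
  using l2_expansion_exists[of a "\<D> \<times> \<D>" bidisc_monom] square_summable_bidisc_monom
  by (metis Abs_hardy_bidisc_inverse bidisc_coeffI mem_Collect_eq)

text \<open>The vector space operations are pointwise; the inner product is that of the coefficients.\<close>

instantiation hardy_disc :: complex_inner_space
begin

lift_definition zero_hardy_disc :: hardy_disc is "\<lambda>_. 0"
  using l2_expansion_zero by blast

lift_definition plus_hardy_disc :: "hardy_disc \<Rightarrow> hardy_disc \<Rightarrow> hardy_disc"
  is "\<lambda>f g z. f z + g z"
  using l2_expansion_add by blast

lift_definition scaleC_hardy_disc :: "complex \<Rightarrow> hardy_disc \<Rightarrow> hardy_disc"
  is "\<lambda>c f z. c * f z"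
  using l2_expansion_scale by blast

definition uminus_hardy_disc :: "hardy_disc \<Rightarrow> hardy_disc"
  where "uminus_hardy_disc f = (-1) *\<^sub>C f"

definition minus_hardy_disc :: "hardy_disc \<Rightarrow> hardy_disc \<Rightarrow> hardy_disc"
  where "minus_hardy_disc f g = f + - g"

definition scaleR_hardy_disc :: "real \<Rightarrow> hardy_disc \<Rightarrow> hardy_disc"
  where "scaleR_hardy_disc r f = complex_of_real r *\<^sub>C f"

definition cinner_hardy_disc :: "hardy_disc \<Rightarrow> hardy_disc \<Rightarrow> complex"
  where "cinner_hardy_disc f g = l2_inner (disc_coeff f) (disc_coeff g)"

definition inner_hardy_disc :: "hardy_disc \<Rightarrow> hardy_disc \<Rightarrow> real"
  where "inner_hardy_disc f g = Re (cinner f g)"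

definition norm_hardy_disc :: "hardy_disc \<Rightarrow> real"
  where "norm_hardy_disc f = sqrt (inner f f)"

definition dist_hardy_disc :: "hardy_disc \<Rightarrow> hardy_disc \<Rightarrow> real"
  where "dist_hardy_disc f g = norm (f - g)"

definition sgn_hardy_disc :: "hardy_disc \<Rightarrow> hardy_disc"
  where "sgn_hardy_disc f = inverse (norm f) *\<^sub>R f"

definition uniformity_hardy_disc :: "(hardy_disc \<times> hardy_disc) filter"
  where "uniformity_hardy_disc = (INF e\<in>{0<..}. principal {(x, y). dist x y < e})"

definition open_hardy_disc :: "hardy_disc set \<Rightarrow> bool"
  where "open_hardy_disc U \<longleftrightarrow> (\<forall>x\<in>U. \<forall>\<^sub>F (x', y) in uniformity. x' = x \<longrightarrow> y \<in> U)"

lemma disc_coeff_add: "disc_coeff (f + g) = (\<lambda>n. disc_coeff f n + disc_coeff g n)"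
  by (rule disc_coeffI) (simp add: plus_hardy_disc.rep_eq l2_expansion_add disc_expansion)

lemma disc_coeff_scaleC: "disc_coeff (c *\<^sub>C f) = (\<lambda>n. c * disc_coeff f n)"
  by (rule disc_coeffI) (simp add: scaleC_hardy_disc.rep_eq l2_expansion_scale disc_expansion)

lemma disc_coeff_zero: "disc_coeff 0 = (\<lambda>_. 0)"
  by (rule disc_coeffI) (simp add: zero_hardy_disc.rep_eq l2_expansion_zero)

lemma disc_coeff_diff: "disc_coeff (f - g) = (\<lambda>n. disc_coeff f n - disc_coeff g n)"
  by (simp add: minus_hardy_disc_def uminus_hardy_disc_def disc_coeff_add disc_coeff_scaleC)

instance
proof
  fix f g h :: hardy_disc and c d :: complex and r s :: real
  show "f + g + h = f + (g + h)" "f + g = g + f" "0 + f = f" "- f + f = 0" "f - g = f + - g"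
    "r *\<^sub>R (f + g) = r *\<^sub>R f + r *\<^sub>R g" "(r + s) *\<^sub>R f = r *\<^sub>R f + s *\<^sub>R f"
    "r *\<^sub>R s *\<^sub>R f = (r * s) *\<^sub>R f" "1 *\<^sub>R f = f"
    "c *\<^sub>C (f + g) = c *\<^sub>C f + c *\<^sub>C g" "(c + d) *\<^sub>C f = c *\<^sub>C f + d *\<^sub>C f"
    "c *\<^sub>C d *\<^sub>C f = (c * d) *\<^sub>C f" "r *\<^sub>R f = complex_of_real r *\<^sub>C f"
    by (simp_all add: disc_coeff_inject[symmetric] minus_hardy_disc_def uminus_hardy_disc_def
      scaleR_hardy_disc_def disc_coeff_add disc_coeff_scaleC disc_coeff_zero algebra_simps)
  show "dist f g = norm (f - g)" "sgn f = inverse (norm f) *\<^sub>R f" "norm f = sqrt (inner f f)"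
    "inner f g = Re (cinner f g)"
    by (simp_all add: dist_hardy_disc_def sgn_hardy_disc_def norm_hardy_disc_def inner_hardy_disc_def)
  show "uniformity = (INF e\<in>{0<..}. principal {(x :: hardy_disc, y). dist x y < e})"
    by (rule uniformity_hardy_disc_def)
  show "open U \<longleftrightarrow> (\<forall>x\<in>U. \<forall>\<^sub>F (x', y) in uniformity. x' = x \<longrightarrow> y \<in> U)" for U :: "hardy_disc set"
    by (rule open_hardy_disc_def)
  show comm: "cinner f g = cnj (cinner g f)" for f g :: hardy_disc
    unfolding cinner_hardy_disc_def by (rule l2_inner_commute)
  show add: "cinner (f + g) h = cinner f h + cinner g h"
    by (simp add: cinner_hardy_disc_def disc_coeff_add l2_inner_add_left)
  show scale: "cinner (c *\<^sub>C f) g = c * cinner f g" for c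
    by (simp add: cinner_hardy_disc_def disc_coeff_scaleC l2_inner_scale_left)
  show "inner f g = inner g f"
    unfolding inner_hardy_disc_def by (subst comm) simp
  show "inner (f + g) h = inner f h + inner g h" "inner (r *\<^sub>R f) g = r * inner f g"
    by (simp_all add: inner_hardy_disc_def add scaleR_hardy_disc_def scale)
  show "0 \<le> inner f f"
    by (simp add: inner_hardy_disc_def cinner_hardy_disc_def l2_inner_self infsum_nonneg)
  show "inner f f = 0 \<longleftrightarrow> f = 0"
    by (simp add: inner_hardy_disc_def cinner_hardy_disc_def l2_inner_self_eq_0
      disc_coeff_inject[symmetric] disc_coeff_zero)
qed

end

instance hardy_disc :: complex_hilbert_space
proof
  fix X :: "nat \<Rightarrow> hardy_disc"
  let ?d = "\<lambda>a b. sqrt (Re (l2_inner (\<lambda>i. a i - b i) (\<lambda>i. a i - b i :: complex)))"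
  have dist: "dist f g = ?d (disc_coeff f) (disc_coeff g)" for f g
    by (simp add: dist_hardy_disc_def norm_hardy_disc_def inner_hardy_disc_def
      cinner_hardy_disc_def disc_coeff_diff)
  assume "Cauchy X"
  then have "\<exists>y. square_summable y \<and> (\<forall>e>0. \<exists>N. \<forall>n\<ge>N. ?d (disc_coeff (X n)) y < e)"
    by (intro l2_complete) (simp_all add: Cauchy_def dist)
  then show "convergent X"
    unfolding convergent_def lim_sequentially dist by (metis disc_coeff_surj)
qed

instantiation hardy_bidisc :: complex_inner_space
begin

lift_definition zero_hardy_bidisc :: hardy_bidisc is "\<lambda>_. 0"
  using l2_expansion_zero by blast

lift_definition plus_hardy_bidisc :: "hardy_bidisc \<Rightarrow> hardy_bidisc \<Rightarrow> hardy_bidisc"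
  is "\<lambda>f g z. f z + g z"
  using l2_expansion_add by blast

lift_definition scaleC_hardy_bidisc :: "complex \<Rightarrow> hardy_bidisc \<Rightarrow> hardy_bidisc"
  is "\<lambda>c f z. c * f z"
  using l2_expansion_scale by blast

definition uminus_hardy_bidisc :: "hardy_bidisc \<Rightarrow> hardy_bidisc"
  where "uminus_hardy_bidisc f = (-1) *\<^sub>C f"

definition minus_hardy_bidisc :: "hardy_bidisc \<Rightarrow> hardy_bidisc \<Rightarrow> hardy_bidisc"
  where "minus_hardy_bidisc f g = f + - g"

definition scaleR_hardy_bidisc :: "real \<Rightarrow> hardy_bidisc \<Rightarrow> hardy_bidisc"
  where "scaleR_hardy_bidisc r f = complex_of_real r *\<^sub>C f"

definition cinner_hardy_bidisc :: "hardy_bidisc \<Rightarrow> hardy_bidisc \<Rightarrow> complex"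
  where "cinner_hardy_bidisc f g = l2_inner (bidisc_coeff f) (bidisc_coeff g)"

definition inner_hardy_bidisc :: "hardy_bidisc \<Rightarrow> hardy_bidisc \<Rightarrow> real"
  where "inner_hardy_bidisc f g = Re (cinner f g)"

definition norm_hardy_bidisc :: "hardy_bidisc \<Rightarrow> real"
  where "norm_hardy_bidisc f = sqrt (inner f f)"

definition dist_hardy_bidisc :: "hardy_bidisc \<Rightarrow> hardy_bidisc \<Rightarrow> real"
  where "dist_hardy_bidisc f g = norm (f - g)"

definition sgn_hardy_bidisc :: "hardy_bidisc \<Rightarrow> hardy_bidisc"
  where "sgn_hardy_bidisc f = inverse (norm f) *\<^sub>R f"

definition uniformity_hardy_bidisc :: "(hardy_bidisc \<times> hardy_bidisc) filter"
  where "uniformity_hardy_bidisc = (INF e\<in>{0<..}. principal {(x, y). dist x y < e})"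

definition open_hardy_bidisc :: "hardy_bidisc set \<Rightarrow> bool"
  where "open_hardy_bidisc U \<longleftrightarrow> (\<forall>x\<in>U. \<forall>\<^sub>F (x', y) in uniformity. x' = x \<longrightarrow> y \<in> U)"

lemma bidisc_coeff_add: "bidisc_coeff (f + g) = (\<lambda>n. bidisc_coeff f n + bidisc_coeff g n)"
  by (rule bidisc_coeffI) (simp add: plus_hardy_bidisc.rep_eq l2_expansion_add bidisc_expansion)

lemma bidisc_coeff_scaleC: "bidisc_coeff (c *\<^sub>C f) = (\<lambda>n. c * bidisc_coeff f n)"
  by (rule bidisc_coeffI) (simp add: scaleC_hardy_bidisc.rep_eq l2_expansion_scale bidisc_expansion)

lemma bidisc_coeff_zero: "bidisc_coeff 0 = (\<lambda>_. 0)"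
  by (rule bidisc_coeffI) (simp add: zero_hardy_bidisc.rep_eq l2_expansion_zero)

lemma bidisc_coeff_diff: "bidisc_coeff (f - g) = (\<lambda>n. bidisc_coeff f n - bidisc_coeff g n)"
  by (simp add: minus_hardy_bidisc_def uminus_hardy_bidisc_def bidisc_coeff_add bidisc_coeff_scaleC)

instance
proof
  fix f g h :: hardy_bidisc and c d :: complex and r s :: real
  show "f + g + h = f + (g + h)" "f + g = g + f" "0 + f = f" "- f + f = 0" "f - g = f + - g"
    "r *\<^sub>R (f + g) = r *\<^sub>R f + r *\<^sub>R g" "(r + s) *\<^sub>R f = r *\<^sub>R f + s *\<^sub>R f"
    "r *\<^sub>R s *\<^sub>R f = (r * s) *\<^sub>R f" "1 *\<^sub>R f = f"
    "c *\<^sub>C (f + g) = c *\<^sub>C f + c *\<^sub>C g" "(c + d) *\<^sub>C f = c *\<^sub>C f + d *\<^sub>C f"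
    "c *\<^sub>C d *\<^sub>C f = (c * d) *\<^sub>C f" "r *\<^sub>R f = complex_of_real r *\<^sub>C f"
    by (simp_all add: bidisc_coeff_inject[symmetric] minus_hardy_bidisc_def uminus_hardy_bidisc_def
      scaleR_hardy_bidisc_def bidisc_coeff_add bidisc_coeff_scaleC bidisc_coeff_zero algebra_simps)
  show "dist f g = norm (f - g)" "sgn f = inverse (norm f) *\<^sub>R f" "norm f = sqrt (inner f f)"
    "inner f g = Re (cinner f g)"
    by (simp_all add: dist_hardy_bidisc_def sgn_hardy_bidisc_def norm_hardy_bidisc_def inner_hardy_bidisc_def)
  show "uniformity = (INF e\<in>{0<..}. principal {(x :: hardy_bidisc, y). dist x y < e})"
    by (rule uniformity_hardy_bidisc_def)
  show "open U \<longleftrightarrow> (\<forall>x\<in>U. \<forall>\<^sub>F (x', y) in uniformity. x' = x \<longrightarrow> y \<in> U)" for U :: "hardy_bidisc set"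
    by (rule open_hardy_bidisc_def)
  show comm: "cinner f g = cnj (cinner g f)" for f g :: hardy_bidisc
    unfolding cinner_hardy_bidisc_def by (rule l2_inner_commute)
  show add: "cinner (f + g) h = cinner f h + cinner g h"
    by (simp add: cinner_hardy_bidisc_def bidisc_coeff_add l2_inner_add_left)
  show scale: "cinner (c *\<^sub>C f) g = c * cinner f g" for c
    by (simp add: cinner_hardy_bidisc_def bidisc_coeff_scaleC l2_inner_scale_left)
  show "inner f g = inner g f"
    unfolding inner_hardy_bidisc_def by (subst comm) simp
  show "inner (f + g) h = inner f h + inner g h" "inner (r *\<^sub>R f) g = r * inner f g"
    by (simp_all add: inner_hardy_bidisc_def add scaleR_hardy_bidisc_def scale)
  show "0 \<le> inner f f"
    by (simp add: inner_hardy_bidisc_def cinner_hardy_bidisc_def l2_inner_self infsum_nonneg)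
  show "inner f f = 0 \<longleftrightarrow> f = 0"
    by (simp add: inner_hardy_bidisc_def cinner_hardy_bidisc_def l2_inner_self_eq_0
      bidisc_coeff_inject[symmetric] bidisc_coeff_zero)
qed

end

instance hardy_bidisc :: complex_hilbert_space
proof
  fix X :: "nat \<Rightarrow> hardy_bidisc"
  let ?d = "\<lambda>a b. sqrt (Re (l2_inner (\<lambda>i. a i - b i) (\<lambda>i. a i - b i :: complex)))"
  have dist: "dist f g = ?d (bidisc_coeff f) (bidisc_coeff g)" for f g
    by (simp add: dist_hardy_bidisc_def norm_hardy_bidisc_def inner_hardy_bidisc_def
      cinner_hardy_bidisc_def bidisc_coeff_diff)
  assume "Cauchy X"
  then have "\<exists>y. square_summable y \<and> (\<forall>e>0. \<exists>N. \<forall>n\<ge>N. ?d (bidisc_coeff (X n)) y < e)"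
    by (intro l2_complete) (simp_all add: Cauchy_def dist)
  then show "convergent X"
    unfolding convergent_def lim_sequentially dist by (metis bidisc_coeff_surj)
qed

lemma bidisc_coeff_of_fun:
  assumes "square_summable a"
    and "\<And>z w. z \<in> \<D> \<Longrightarrow> w \<in> \<D> \<Longrightarrow> ((\<lambda>(m, n). a (m, n) * (z ^ m * w ^ n)) has_sum f (z, w)) UNIV"
    and "\<And>z w. (z, w) \<notin> \<D> \<times> \<D> \<Longrightarrow> f (z, w) = 0"
  shows "l2_expansion bidisc_monom (\<D> \<times> \<D>) f a"
  using assms by (auto simp: l2_expansion_def bidisc_monom_def case_prod_unfold)

lift_definition M_z :: "hardy_bidisc \<Rightarrow> hardy_bidisc" is "\<lambda>F (z, w). z * F (z, w)"
proof -
  fix F assume "\<exists>a. l2_expansion bidisc_monom (\<D> \<times> \<D>) F a"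
  then obtain a where a: "l2_expansion bidisc_monom (\<D> \<times> \<D>) F a" by blast
  show "\<exists>a. l2_expansion bidisc_monom (\<D> \<times> \<D>) (\<lambda>(z, w). z * F (z, w)) a"
    using l2_expansion_shift[OF a, of "\<lambda>(m, n). (Suc m, n)" fst]
    by (auto simp: inj_def bidisc_monom_def case_prod_unfold mult_ac)
qed

lift_definition M_w :: "hardy_bidisc \<Rightarrow> hardy_bidisc" is "\<lambda>F (z, w). w * F (z, w)"
proof -
  fix F assume "\<exists>a. l2_expansion bidisc_monom (\<D> \<times> \<D>) F a"
  then obtain a where a: "l2_expansion bidisc_monom (\<D> \<times> \<D>) F a" by blast
  show "\<exists>a. l2_expansion bidisc_monom (\<D> \<times> \<D>) (\<lambda>(z, w). w * F (z, w)) a"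
    using l2_expansion_shift[OF a, of "\<lambda>(m, n). (m, Suc n)" snd]
    by (auto simp: inj_def bidisc_monom_def case_prod_unfold mult_ac)
qed

lemma tensor_expansion:
  assumes a: "l2_expansion disc_monom \<D> f a" and b: "l2_expansion disc_monom \<D> g b"
  shows "l2_expansion bidisc_monom (\<D> \<times> \<D>) (\<lambda>(z, w). f z * g w) (\<lambda>(m, n). a m * b n)"
proof -
  have ss: "square_summable a" "square_summable b" "square_summable (\<lambda>(m, n). a m * b n)"
    using a b by (auto simp: l2_expansion_def intro: square_summable_tensor)
  show ?thesis
  proof (rule bidisc_coeff_of_fun)
    show "square_summable (\<lambda>(m, n). a m * b n)" by fact
  next
    fix z w :: complex assume zw: "z \<in> \<D>" "w \<in> \<D>"
    have f: "((\<lambda>n. a n * z ^ n) has_sum f z) UNIV" and g: "((\<lambda>n. b n * w ^ n) has_sum g w) UNIV"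
      using a b zw by (auto simp: l2_expansion_def disc_monom_def)
    let ?t = "\<lambda>(m, n). (case (m, n) of (m, n) \<Rightarrow> a m * b n) * (z ^ m * w ^ n)"
    have "?t summable_on UNIV \<times> UNIV"
      using square_summable_prod[OF ss(3) square_summable_bidisc_monom[of "(z, w)"]] zw
      by (simp add: bidisc_monom_def case_prod_unfold)
    moreover have "((\<lambda>n. ?t (m, n)) has_sum (a m * z ^ m) * g w) UNIV" for m
      using has_sum_cmult_right[OF g, of "a m * z ^ m"] by (simp add: mult_ac)
    ultimately have "(?t has_sum f z * g w) (UNIV \<times> UNIV)"
      by (intro has_sum_SigmaI[where g = "\<lambda>m. (a m * z ^ m) * g w"] has_sum_cmult_left f) auto
    then show "(?t has_sum (case (z, w) of (z, w) \<Rightarrow> f z * g w)) UNIV"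
      by simp
  next
    fix z w :: complex assume "(z, w) \<notin> \<D> \<times> \<D>"
    then show "(case (z, w) of (z, w) \<Rightarrow> f z * g w) = 0"
      using a b by (auto simp: l2_expansion_def)
  qed
qed

lift_definition simple_tensor :: "hardy_disc \<Rightarrow> hardy_disc \<Rightarrow> hardy_bidisc"  (infixr "\<otimes>\<^sub>h" 70)
  is "\<lambda>f g (z, w). f z * g w"
  using tensor_expansion by blast

lemma bidisc_coeff_simple_tensor:
  "bidisc_coeff (f \<otimes>\<^sub>h g) = (\<lambda>(m, n). disc_coeff f m * disc_coeff g n)"
  by (rule bidisc_coeffI) (simp add: simple_tensor.rep_eq tensor_expansion disc_expansion)

lemma cinner_M_z:
  "cinner (M_z F) G = l2_inner (bidisc_coeff F) (\<lambda>(m, n). bidisc_coeff G (Suc m, n))"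
proof -
  define j where "j = (\<lambda>(m, n). (Suc m, n :: nat))"
  have j: "inj j" by (auto simp: inj_def j_def)
  have "bidisc_coeff (M_z F) = (\<lambda>i. if i \<in> range j then bidisc_coeff F (inv j i) else 0)"
    using l2_expansion_shift[OF bidisc_expansion[of F] j, of fst]
    by (intro bidisc_coeffI) (simp add: M_z.rep_eq bidisc_monom_def j_def case_prod_unfold mult_ac)
  then have "cinner (M_z F) G = l2_inner (bidisc_coeff F) (\<lambda>i. bidisc_coeff G (j i))"
    by (simp only: cinner_hardy_bidisc_def l2_inner_shift[OF j])
  then show ?thesis
    by (simp add: j_def case_prod_unfold)
qed

lemma cinner_M_w:
  "cinner (M_w F) G = l2_inner (bidisc_coeff F) (\<lambda>(m, n). bidisc_coeff G (m, Suc n))"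
proof -
  define j where "j = (\<lambda>(m :: nat, n). (m, Suc n))"
  have j: "inj j" by (auto simp: inj_def j_def)
  have "bidisc_coeff (M_w F) = (\<lambda>i. if i \<in> range j then bidisc_coeff F (inv j i) else 0)"
    using l2_expansion_shift[OF bidisc_expansion[of F] j, of snd]
    by (intro bidisc_coeffI) (simp add: M_w.rep_eq bidisc_monom_def j_def case_prod_unfold mult_ac)
  then have "cinner (M_w F) G = l2_inner (bidisc_coeff F) (\<lambda>i. bidisc_coeff G (j i))"
    by (simp only: cinner_hardy_bidisc_def l2_inner_shift[OF j])
  then show ?thesis
    by (simp add: j_def case_prod_unfold)
qed

definition hilbert_tensor :: "hardy_disc set \<Rightarrow> hardy_disc set \<Rightarrow> hardy_bidisc set"
  (infixr "\<otimes>\<^sub>H" 70)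
  where "A \<otimes>\<^sub>H B = closed_cspan {f \<otimes>\<^sub>h g | f g. f \<in> A \<and> g \<in> B}"


section \<open>Inner functions, model spaces and submodules\<close>

definition H_infinity :: "(complex \<Rightarrow> complex) set"
  where "H_infinity = {\<phi>. \<phi> holomorphic_on \<D> \<and> bounded (\<phi> ` \<D>)}"

text \<open>The boundary value at \<open>cis t\<close> is the radial limit, which exists for almost every \<open>t\<close> by
  Fatou's theorem.\<close>

definition inner_function :: "(complex \<Rightarrow> complex) \<Rightarrow> bool"
  where "inner_function \<phi> \<longleftrightarrow> \<phi> \<in> H_infinity \<and>
    (AE t in lebesgue_on {0..2 * pi}.
      \<exists>l. ((\<lambda>r. \<phi> (complex_of_real r * cis t)) \<longlongrightarrow> l) (at_left 1) \<and> cmod l = 1)"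

text \<open>The subspace \<open>\<phi> H\<^sup>2(\<D>)\<close>. For \<open>\<phi>\<close> in \<^const>\<open>H_infinity\<close>, multiplication by
  \<open>\<phi>\<close> maps the Hardy space to itself, so this is the set of all products.\<close>

definition mult_range :: "(complex \<Rightarrow> complex) \<Rightarrow> hardy_disc set"
  where "mult_range \<phi> = {h. \<exists>f. \<forall>z\<in>\<D>. disc_fun h z = \<phi> z * disc_fun f z}"

definition model_space :: "(complex \<Rightarrow> complex) \<Rightarrow> hardy_disc set"
  where "model_space \<phi> = orth_compl (mult_range \<phi>)"

definition submodule :: "hardy_bidisc set \<Rightarrow> bool"
  where "submodule S \<longleftrightarrow> closed S \<and> module.subspace scaleC S \<and> M_z ` S \<subseteq> S \<and> M_w ` S \<subseteq> S"

lemma disc_shift: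
  "\<exists>h'. (\<forall>z. disc_fun h' z = z * disc_fun h z)
    \<and> (\<forall>b. l2_inner (disc_coeff h') b = l2_inner (disc_coeff h) (\<lambda>n. b (Suc n)))"
proof -
  have e: "l2_expansion disc_monom \<D> (\<lambda>z. z * disc_fun h z)
      (\<lambda>n. if n \<in> range Suc then disc_coeff h (inv Suc n) else 0)"
    by (rule l2_expansion_shift[OF disc_expansion]) (auto simp: disc_monom_def)
  obtain h' where h': "disc_fun h' = (\<lambda>z. z * disc_fun h z)"
    using Abs_hardy_disc_inverse[of "\<lambda>z. z * disc_fun h z"] e by blast
  have "disc_coeff h' = (\<lambda>n. if n \<in> range Suc then disc_coeff h (inv Suc n) else 0)"
    by (rule disc_coeffI) (use e in \<open>simp add: h'\<close>)
  then have "l2_inner (disc_coeff h') b = l2_inner (disc_coeff h) (\<lambda>n. b (Suc n))" for b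
    by (simp only: l2_inner_shift[OF inj_Suc])
  with h' show ?thesis by (intro exI[of _ h']) auto
qed

lemma model_space_backward_shift:
  assumes "f \<in> model_space \<phi>"
  obtains f' where "f' \<in> model_space \<phi>" "disc_coeff f' = (\<lambda>n. disc_coeff f (Suc n))"
proof -
  have "(\<lambda>n. (cmod (disc_coeff f n))\<^sup>2) summable_on range Suc"
    using square_summable_disc_coeff[of f] unfolding square_summable_def
    by (rule summable_on_subset_banach) simp
  then have "square_summable (\<lambda>n. disc_coeff f (Suc n))"
    unfolding square_summable_def by (subst (asm) summable_on_reindex) (auto simp: o_def)
  then obtain f' where f': "disc_coeff f' = (\<lambda>n. disc_coeff f (Suc n))"
    using disc_coeff_surj by blast
  have "cinner f' h = 0" if h: "h \<in> mult_range \<phi>" for h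
  proof -
    obtain k where k: "\<forall>z\<in>\<D>. disc_fun h z = \<phi> z * disc_fun k z"
      using h unfolding mult_range_def by blast
    obtain h' where h': "\<forall>z. disc_fun h' z = z * disc_fun h z"
      "\<forall>b. l2_inner (disc_coeff h') b = l2_inner (disc_coeff h) (\<lambda>n. b (Suc n))"
      using disc_shift[of h] by blast
    obtain k' where k': "\<forall>z. disc_fun k' z = z * disc_fun k z"
      using disc_shift[of k] by blast
    have "h' \<in> mult_range \<phi>"
      unfolding mult_range_def using k by (auto simp: h'(1) k' intro!: exI[of _ k'])
    then have "cinner f h' = 0"
      using assms by (auto simp: model_space_def orth_compl_def)
    moreover have "cinner h f' = cinner h' f"
      by (simp add: cinner_hardy_disc_def f' h'(2))
    ultimately show ?thesis
      by (metis cinner_commute complex_cnj_zero)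
  qed
  then show ?thesis
    using f' by (intro that[of f']) (auto simp: model_space_def orth_compl_def)
qed

lemma submodule_orth_compl_model_tensor:
  "submodule (orth_compl (model_space \<phi> \<otimes>\<^sub>H model_space \<psi>))"
proof -
  let ?A = "{f \<otimes>\<^sub>h g | f g. f \<in> model_space \<phi> \<and> g \<in> model_space \<psi>}"
  have "cinner (M_z F) (f \<otimes>\<^sub>h g) = 0" "cinner (M_w F) (f \<otimes>\<^sub>h g) = 0"
    if F: "F \<in> orth_compl ?A" and fg: "f \<in> model_space \<phi>" "g \<in> model_space \<psi>" for F f g
  proof -
    obtain f' where f': "f' \<in> model_space \<phi>" "disc_coeff f' = (\<lambda>n. disc_coeff f (Suc n))"
      using model_space_backward_shift[OF fg(1)] by blast
    obtain g' where g': "g' \<in> model_space \<psi>" "disc_coeff g' = (\<lambda>n. disc_coeff g (Suc n))"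
      using model_space_backward_shift[OF fg(2)] by blast
    have "cinner F (f' \<otimes>\<^sub>h g) = 0" "cinner F (f \<otimes>\<^sub>h g') = 0"
      using F fg f'(1) g'(1) by (auto simp: orth_compl_def)
    then show "cinner (M_z F) (f \<otimes>\<^sub>h g) = 0" "cinner (M_w F) (f \<otimes>\<^sub>h g) = 0"
      unfolding cinner_M_z cinner_M_w
      by (simp_all add: cinner_hardy_bidisc_def bidisc_coeff_simple_tensor f'(2) g'(2))
  qed
  then have "M_z ` orth_compl ?A \<subseteq> orth_compl ?A" "M_w ` orth_compl ?A \<subseteq> orth_compl ?A"
    by (auto simp: orth_compl_def)
  then show ?thesis
    unfolding submodule_def hilbert_tensor_def orth_compl_closed_cspan
    by (auto intro: closed_orth_compl subspace_orth_compl)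
qed

definition submodule_rank :: "hardy_bidisc set \<Rightarrow> enat"
  where "submodule_rank S = operator_rank S [M_z, M_w]"

end

theory Submission
  imports Defs
begin

text \<open>
  Write \<open>A\<close> and \<open>B\<close> for multiplication by \<open>\<phi>(z)\<close> and \<open>\<psi>(w)\<close> on \<open>H\<^sup>2(\<D>\<^sup>2)\<close>. That \<open>\<phi>\<close> is inner enters
  through one fact about its Taylor coefficients, \<open>\<Sum>\<^sub>n c\<^sub>n cnj c\<^sub>n\<^sub>+\<^sub>k = \<delta>\<^sub>k\<^sub>0\<close> (lemma
  \<open>inner_function_coefficients\<close>), and likewise for \<open>\<psi>\<close>; it makes \<open>A\<close> and \<open>B\<close> isometries. They
  commute with each other and with the shifts, and each commutes with the adjoint of the other because
  the two act on different tensor factors. It follows that \<open>S = A H\<^sup>2 + B H\<^sup>2\<close> (lemma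
  \<open>model_complement_decomposition\<close>). As the polynomials are dense, \<open>S\<close> is generated by \<open>A 1 = \<phi>(z)\<close> and
  \<open>B 1 = \<psi>(w)\<close>, so the rank is at most \<open>2\<close>.

  For the lower bound, let \<open>(x, y)\<close> stand for \<open>A x + B y\<close>. This pair is determined up to multiples of
  \<open>(\<psi>, -\<phi>)\<close>, so modulo \<open>S\<close> the determinant of two pairs depends only on the two elements of \<open>S\<close>. If
  \<open>F = A f + B g\<close> generated \<open>S\<close>, the determinant \<open>x g - y f\<close> would vanish for all multiples
  \<open>(p f, p g)\<close> of the generator, hence modulo \<open>S\<close> for all \<open>(x, y)\<close> by continuity, and then, letting
  \<open>F\<close> vary in the same way, for any two pairs. But \<open>(1, 0)\<close> and \<open>(0, 1)\<close> have determinant \<open>1\<close>, which is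
  not in \<open>S\<close>.

  The products in this determinant need not lie in \<open>H\<^sup>2\<close>. It is therefore paired with a fixed
  function, which gives the bilinear form \<open>\<Gamma>(x, y) = \<integral> z w x y cnj (\<phi>(z) \<psi>(w))\<close> over the torus, the Hankel form with symbol
  \<open>\<phi>(z) \<psi>(w)\<close>. It is bounded since the symbol is unimodular; it is symmetric, and shifts move freely
  from one argument to the other; it vanishes as soon as one argument lies in the range of \<open>A\<close> or \<open>B\<close>;
  and it is not zero because \<open>\<phi>\<close> and \<open>\<psi>\<close> are not constant. A single generator would make it zero
  (lemma \<open>model_complement_not_singly_generated\<close>).
\<close>

section \<open>Orthonormal and contractive families in Hilbert spaces\<close>

lemma cinner_self: "cinner x x = complex_of_real ((norm (x :: 'a::complex_inner_space))\<^sup>2)"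
proof (rule complex_eqI)
  have "Im (cinner x x) = Im (cnj (cinner x x))"
    by (subst cinner_commute) simp
  then show "Im (cinner x x) = Im (complex_of_real ((norm x)\<^sup>2))" by simp
qed (simp add: inner_eq_Re_cinner[symmetric] power2_norm_eq_inner)

lemma cinner_eq_zero_self: "cinner x x = 0 \<longleftrightarrow> x = (0 :: 'a::complex_inner_space)"
  by (simp add: cinner_self)

lemma cinner_zero_right [simp]: "cinner x (0 :: 'a::complex_inner_space) = 0"
  by (metis cinner_commute cinner_zero_left complex_cnj_zero)

lemma scaleC_zero: "0 *\<^sub>C x = (0 :: 'a::complex_inner_space)"
  using scaleR_scaleC[of 0 x] by (simp only: scaleR_zero_left of_real_0)

lemma cinner_eq_zero_commute: "cinner x y = 0 \<Longrightarrow> cinner y (x :: 'a::complex_inner_space) = 0"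
  by (metis cinner_commute complex_cnj_zero)

lemma cinner_minus_left: "cinner (- x) y = - cinner x (y :: 'a::complex_inner_space)"
  using cinner_add_left[of x "- x" y] by (simp add: eq_neg_iff_add_eq_0 add.commute)

lemma cinner_diff_left: "cinner (x - y) z = cinner x z - cinner y (z :: 'a::complex_inner_space)"
  using cinner_add_left[of x "- y" z] by (simp add: cinner_minus_left)

lemma cinner_diff_right: "cinner x (y - z) = cinner x y - cinner x (z :: 'a::complex_inner_space)"
  by (metis cinner_commute cinner_diff_left complex_cnj_diff)

lemma cinner_sum_left: "cinner (\<Sum>i\<in>F. f i) y = (\<Sum>i\<in>F. cinner (f i) (y :: 'a::complex_inner_space))"
  by (induction F rule: infinite_finite_induct) (auto simp: cinner_add_left)

lemma cinner_sum_right: "cinner y (\<Sum>i\<in>F. f i) = (\<Sum>i\<in>F. cinner y (f i :: 'a::complex_inner_space))"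
  by (induction F rule: infinite_finite_induct) (auto simp: cinner_add_right)

lemma norm_scaleC: "norm (c *\<^sub>C x) = cmod c * norm (x :: 'a::complex_inner_space)"
proof -
  have "complex_of_real ((norm (c *\<^sub>C x))\<^sup>2) = complex_of_real ((cmod c * norm x)\<^sup>2)"
    unfolding cinner_self[symmetric] cinner_scaleC_left cinner_scaleC_right
    by (simp only: cinner_self power_mult_distrib of_real_mult complex_norm_square[of c] mult_ac)
  then have "(norm (c *\<^sub>C x))\<^sup>2 = (cmod c * norm x)\<^sup>2"
    using of_real_eq_iff by blast
  then show ?thesis by simp
qed

lemma cinner_bound: "cmod (cinner x y) \<le> norm x * norm (y :: 'a::complex_inner_space)"
proof (cases "cinner x y = 0")
  case False
  \<comment> \<open>rotate \<open>x\<close> by a unimodular constant that makes the inner product real, then use the real inequality\<close>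
  define c where "c = cnj (cinner x y) / complex_of_real (cmod (cinner x y))"
  have c: "cmod c = 1" using False by (simp add: c_def norm_divide)
  have "c * cinner x y = complex_of_real (cmod (cinner x y))"
    using False complex_norm_square[of "cinner x y"]
    by (simp add: c_def field_simps power2_eq_square)
  then have "cmod (cinner x y) = Re (cinner (c *\<^sub>C x) y)" by (simp add: cinner_scaleC_left)
  also have "\<dots> \<le> norm (c *\<^sub>C x) * norm y"
    unfolding inner_eq_Re_cinner[symmetric] by (rule norm_cauchy_schwarz)
  finally show ?thesis by (simp add: norm_scaleC c)
qed simp

lemma bounded_linear_cinner_left: "bounded_linear (\<lambda>x. cinner x (y :: 'a::complex_inner_space))"
  by (rule bounded_linear_intro[where K = "norm y"])
    (simp_all add: cinner_add_left scaleR_scaleC cinner_scaleC_left scaleR_conv_of_real cinner_bound)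

lemma bounded_linear_cinner_right: "bounded_linear (\<lambda>y. cinner (x :: 'a::complex_inner_space) y)"
proof (rule bounded_linear_intro[where K = "norm x"])
  show "norm (cinner x y) \<le> norm y * norm x" for y
    using cinner_bound[of x y] by (simp only: mult.commute)
qed (simp_all add: cinner_add_right scaleR_scaleC cinner_scaleC_right scaleR_conv_of_real)

lemma has_sum_cinner_left:
  "(f has_sum s) A \<Longrightarrow> ((\<lambda>i. cinner (f i) y) has_sum cinner s (y :: 'a::complex_inner_space)) A"
  by (rule has_sum_bounded_linear[OF bounded_linear_cinner_left])

lemma has_sum_cinner_right:
  "(f has_sum s) A \<Longrightarrow> ((\<lambda>i. cinner y (f i)) has_sum cinner (y :: 'a::complex_inner_space) s) A"
  by (rule has_sum_bounded_linear[OF bounded_linear_cinner_right])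

definition bounded_clinear :: "('a::complex_inner_space \<Rightarrow> 'b::complex_inner_space) \<Rightarrow> bool"
  where "bounded_clinear T \<longleftrightarrow> bounded_linear T \<and> (\<forall>c x. T (c *\<^sub>C x) = c *\<^sub>C T x)"

lemma bounded_clinear_add: "bounded_clinear T \<Longrightarrow> T (x + y) = T x + T y"
  by (simp add: bounded_clinear_def bounded_linear.linear linear_add)

lemma bounded_clinear_scaleC: "bounded_clinear T \<Longrightarrow> T (c *\<^sub>C x) = c *\<^sub>C T x"
  by (simp add: bounded_clinear_def)

lemma bounded_clinear_compose:
  "bounded_clinear T \<Longrightarrow> bounded_clinear U \<Longrightarrow> bounded_clinear (\<lambda>x. T (U x))"
  unfolding bounded_clinear_def by (auto intro: bounded_linear_compose)

lemma bounded_clinear_id: "bounded_clinear (\<lambda>x. x)"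
  unfolding bounded_clinear_def by simp

definition orthonormal_family :: "('i \<Rightarrow> 'a::complex_inner_space) \<Rightarrow> bool"
  where "orthonormal_family u \<longleftrightarrow> (\<forall>i j. cinner (u i) (u j) = (if i = j then 1 else 0))"

text \<open>Contractivity suffices for the convergence of square summable combinations of the \<open>u i\<close>.
  It covers orthonormal families and the rows of a contractive Hankel matrix alike.\<close>

definition contractive_family :: "('i \<Rightarrow> 'a::complex_inner_space) \<Rightarrow> bool"
  where "contractive_family u \<longleftrightarrow>
    (\<forall>F a. finite F \<longrightarrow> (norm (\<Sum>i\<in>F. a i *\<^sub>C u i))\<^sup>2 \<le> (\<Sum>i\<in>F. (cmod (a i))\<^sup>2))"

lemma norm_orthonormal_sum:
  assumes "orthonormal_family u" "finite F"
  shows "(norm (\<Sum>i\<in>F. a i *\<^sub>C u i))\<^sup>2 = (\<Sum>i\<in>F. (cmod (a i))\<^sup>2)"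
proof -
  have "complex_of_real ((norm (\<Sum>i\<in>F. a i *\<^sub>C u i))\<^sup>2)
      = (\<Sum>i\<in>F. \<Sum>j\<in>F. if i = j then a i * cnj (a j) else 0)"
    unfolding cinner_self[symmetric] cinner_sum_left
    unfolding cinner_sum_right cinner_scaleC_left cinner_scaleC_right
    using assms(1) by (intro sum.cong refl) (simp add: orthonormal_family_def)
  also have "\<dots> = complex_of_real (\<Sum>i\<in>F. (cmod (a i))\<^sup>2)"
    using assms(2) by (simp add: complex_norm_square del: of_real_power)
  finally show ?thesis using of_real_eq_iff by blast
qed

lemma orthonormal_imp_contractive: "orthonormal_family u \<Longrightarrow> contractive_family u"
  by (simp add: contractive_family_def norm_orthonormal_sum)

text \<open>The tails of \<open>\<Sum> |a i|\<^sup>2\<close> dominate those of the vector series, so its partial sums form a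
  Cauchy net. The series need not converge absolutely.\<close>

lemma contractive_summable:
  fixes u :: "'i \<Rightarrow> 'a::complex_hilbert_space"
  assumes u: "contractive_family u" and a: "square_summable a"
  shows "(\<lambda>i. a i *\<^sub>C u i) summable_on UNIV"
proof -
  let ?s = "\<lambda>F. \<Sum>i\<in>F. a i *\<^sub>C u i" and ?n = "\<lambda>F. \<Sum>i\<in>F. (cmod (a i))\<^sup>2"
  obtain L where L: "((\<lambda>i. (cmod (a i))\<^sup>2) has_sum L) UNIV"
    using a unfolding square_summable_def summable_on_def by blast
  have "\<exists>P. eventually P (finite_subsets_at_top UNIV) \<and>
          (\<forall>F F'. P F \<and> P F' \<longrightarrow> dist (?s F) (?s F') < e)" if e: "e > 0" for e
  proof -
    have "\<forall>\<^sub>F F in finite_subsets_at_top UNIV. dist (?n F) L < (e / 4)\<^sup>2"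
      using L e unfolding has_sum_def by (intro tendstoD) auto
    then obtain F0 where F0: "finite F0"
      "\<And>F. finite F \<Longrightarrow> F0 \<subseteq> F \<Longrightarrow> dist (?n F) L < (e / 4)\<^sup>2"
      unfolding eventually_finite_subsets_at_top by auto
    have near: "dist (?s F) (?s F0) < e / 2" if F: "finite F" "F0 \<subseteq> F" for F
    proof -
      have "(norm (?s (F - F0)))\<^sup>2 \<le> ?n (F - F0)"
        using u F by (auto simp: contractive_family_def)
      also have "\<dots> = ?n F - ?n F0" using F F0 by (simp add: sum_diff)
      also have "\<dots> < 2 * (e / 4)\<^sup>2"
        using F0(2)[OF F] F0(2)[OF F0(1) order_refl] unfolding dist_real_def by linarith
      also have "\<dots> \<le> (e / 2)\<^sup>2" by (simp add: power2_eq_square)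
      finally have "norm (?s (F - F0)) < e / 2"
        by (rule power_less_imp_less_base) (use e in simp)
      then show ?thesis using F F0(1) by (simp add: sum_diff dist_norm)
    qed
    show ?thesis
    proof (intro exI[of _ "\<lambda>F. finite F \<and> F0 \<subseteq> F"] conjI allI impI)
      show "\<forall>\<^sub>F F in finite_subsets_at_top UNIV. finite F \<and> F0 \<subseteq> F"
        unfolding eventually_finite_subsets_at_top using F0(1) by auto
      fix F F' assume "(finite F \<and> F0 \<subseteq> F) \<and> (finite F' \<and> F0 \<subseteq> F')"
      then have "dist (?s F) (?s F0) < e / 2" "dist (?s F') (?s F0) < e / 2" using near by auto
      then show "dist (?s F) (?s F') < e" by (rule dist_triangle_half_l)
    qed
  qed
  then have "cauchy_filter (filtermap ?s (finite_subsets_at_top UNIV))"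
    by (simp add: cauchy_filter_metric_filtermap)
  moreover have "complete (UNIV :: 'a set)"
    by (meson Cauchy_convergent UNIV_I complete_def convergent_def)
  ultimately obtain l where "(?s \<longlongrightarrow> l) (finite_subsets_at_top UNIV)"
    using complete_uniform[where S = UNIV] by (force simp: filterlim_def)
  then show ?thesis using summable_on_def has_sum_def by blast
qed

definition lin_comb :: "('i \<Rightarrow> 'a::complex_inner_space) \<Rightarrow> ('i \<Rightarrow> complex) \<Rightarrow> 'a"
  where "lin_comb u a = (\<Sum>\<^sub>\<infinity>i. a i *\<^sub>C u i)"

lemma lin_comb_has_sum:
  fixes u :: "'i \<Rightarrow> 'a::complex_hilbert_space"
  assumes "contractive_family u" "square_summable a"
  shows "((\<lambda>i. a i *\<^sub>C u i) has_sum lin_comb u a) UNIV"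
  unfolding lin_comb_def using contractive_summable[OF assms] by (rule has_sum_infsum)

lemma norm_lin_comb_le:
  fixes u :: "'i \<Rightarrow> 'a::complex_hilbert_space"
  assumes u: "contractive_family u" and a: "square_summable a"
  shows "(norm (lin_comb u a))\<^sup>2 \<le> (\<Sum>\<^sub>\<infinity>i. (cmod (a i))\<^sup>2)"
proof (rule tendsto_upperbound)
  show "((\<lambda>F. (norm (\<Sum>i\<in>F. a i *\<^sub>C u i))\<^sup>2) \<longlongrightarrow> (norm (lin_comb u a))\<^sup>2)
      (finite_subsets_at_top UNIV)"
    using lin_comb_has_sum[OF assms] unfolding has_sum_def by (intro tendsto_intros)
  have "(norm (\<Sum>i\<in>F. a i *\<^sub>C u i))\<^sup>2 \<le> (\<Sum>\<^sub>\<infinity>i. (cmod (a i))\<^sup>2)" if "finite F" for F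
  proof -
    have "(norm (\<Sum>i\<in>F. a i *\<^sub>C u i))\<^sup>2 \<le> (\<Sum>i\<in>F. (cmod (a i))\<^sup>2)"
      using u that by (simp add: contractive_family_def)
    also have "\<dots> \<le> (\<Sum>\<^sub>\<infinity>i. (cmod (a i))\<^sup>2)"
      using a that by (intro finite_sum_le_infsum) (auto simp: square_summable_def)
    finally show ?thesis .
  qed
  then show "\<forall>\<^sub>F F in finite_subsets_at_top UNIV. (norm (\<Sum>i\<in>F. a i *\<^sub>C u i))\<^sup>2 \<le> (\<Sum>\<^sub>\<infinity>i. (cmod (a i))\<^sup>2)"
    unfolding eventually_finite_subsets_at_top by auto
qed simp

lemma lin_comb_coeff:
  fixes u :: "'i \<Rightarrow> 'a::complex_hilbert_space"
  assumes u: "orthonormal_family u" and a: "square_summable a"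
  shows "cinner (lin_comb u a) (u k) = a k"
proof (rule has_sum_unique)
  show "((\<lambda>i. a i * cinner (u i) (u k)) has_sum cinner (lin_comb u a) (u k)) UNIV"
    using has_sum_cinner_left[OF lin_comb_has_sum[OF orthonormal_imp_contractive[OF u] a]]
    by (simp add: cinner_scaleC_left)
  have "((\<lambda>i. a i * cinner (u i) (u k)) has_sum a k) {k}"
    using has_sum_finite[of "{k}" "\<lambda>i. a i * cinner (u i) (u k)"] u
    by (simp add: orthonormal_family_def)
  then show "((\<lambda>i. a i * cinner (u i) (u k)) has_sum a k) UNIV"
    by (rule has_sum_cong_neutral[THEN iffD1, rotated -1]) (use u in \<open>auto simp: orthonormal_family_def\<close>)
qed

text \<open>Bessel's inequality, from \<open>0 \<le> \<parallel>x - \<Sum>\<^sub>F \<langle>x, u i\<rangle> u i\<parallel>\<^sup>2\<close>.\<close>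

lemma bessel_finite:
  assumes u: "orthonormal_family u" and F: "finite F"
  shows "(\<Sum>i\<in>F. (cmod (cinner x (u i)))\<^sup>2) \<le> (norm x)\<^sup>2"
proof -
  let ?p = "\<Sum>i\<in>F. cinner x (u i) *\<^sub>C u i" and ?n = "\<Sum>i\<in>F. (cmod (cinner x (u i)))\<^sup>2"
  have xp: "cinner x ?p = complex_of_real ?n"
    unfolding cinner_sum_right cinner_scaleC_right of_real_sum
    by (intro sum.cong refl) (simp only: complex_norm_square mult.commute)
  have px: "cinner ?p x = complex_of_real ?n"
    by (subst cinner_commute) (simp only: xp complex_cnj_complex_of_real)
  have pp: "cinner ?p ?p = complex_of_real ?n"
    by (simp only: cinner_self norm_orthonormal_sum[OF u F])
  have "complex_of_real ((norm (x - ?p))\<^sup>2) = complex_of_real ((norm x)\<^sup>2 - ?n)"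
    unfolding cinner_self[symmetric] cinner_diff_left cinner_diff_right xp px pp
    by (simp add: cinner_self)
  then have "(norm (x - ?p))\<^sup>2 = (norm x)\<^sup>2 - ?n" using of_real_eq_iff by blast
  then show ?thesis using zero_le_power2[of "norm (x - ?p)"] by linarith
qed

lemma bessel:
  assumes "orthonormal_family u"
  shows "square_summable (\<lambda>i. cinner x (u i))"
    and "(\<Sum>\<^sub>\<infinity>i. (cmod (cinner x (u i)))\<^sup>2) \<le> (norm x)\<^sup>2"
proof -
  show *: "square_summable (\<lambda>i. cinner x (u i))"
    unfolding square_summable_def
    by (rule nonneg_bdd_above_summable_on)
      (use bessel_finite[OF assms] in \<open>auto intro!: bdd_aboveI[of _ "(norm x)\<^sup>2"]\<close>)
  show "(\<Sum>\<^sub>\<infinity>i. (cmod (cinner x (u i)))\<^sup>2) \<le> (norm x)\<^sup>2"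
    by (rule infsum_le_finite_sums)
      (use * bessel_finite[OF assms] in \<open>auto simp: square_summable_def\<close>)
qed

text \<open>Completeness is expressed by the convergence of the Fourier expansion, the form in which it is
  used to extend identities from the basis by continuity.\<close>

definition orthonormal_basis :: "('i \<Rightarrow> 'a::complex_inner_space) \<Rightarrow> bool"
  where "orthonormal_basis e \<longleftrightarrow>
    orthonormal_family e \<and> (\<forall>x. ((\<lambda>i. cinner x (e i) *\<^sub>C e i) has_sum x) UNIV)"

lemma orthonormal_basisI:
  fixes e :: "'i \<Rightarrow> 'a::complex_hilbert_space"
  assumes e: "orthonormal_family e"
    and complete: "\<And>x y. (\<And>i. cinner x (e i) = cinner y (e i)) \<Longrightarrow> x = y"
  shows "orthonormal_basis e"
  unfolding orthonormal_basis_def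
proof (intro conjI allI e)
  fix x
  have "lin_comb e (\<lambda>i. cinner x (e i)) = x"
    by (rule complete) (simp add: lin_comb_coeff e bessel(1))
  then show "((\<lambda>i. cinner x (e i) *\<^sub>C e i) has_sum x) UNIV"
    using lin_comb_has_sum[OF orthonormal_imp_contractive[OF e] bessel(1)[OF e, of x]] by simp
qed

lemma basis_expansion:
  "orthonormal_basis e \<Longrightarrow> ((\<lambda>i. cinner x (e i) *\<^sub>C e i) has_sum x) UNIV"
  by (simp add: orthonormal_basis_def)

lemma basis_coeff_square_summable:
  "orthonormal_basis e \<Longrightarrow> square_summable (\<lambda>i. cinner x (e i))"
  by (rule bessel) (simp add: orthonormal_basis_def)

lemma basis_cinner_has_sum:
  "orthonormal_basis e \<Longrightarrow> ((\<lambda>i. cinner x (e i) * cinner (e i) y) has_sum cinner x y) UNIV"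
  using has_sum_cinner_left[OF basis_expansion, of e x y] by (simp add: cinner_scaleC_left)

lemma basis_ext:
  assumes "orthonormal_basis e" "\<And>i. cinner x (e i) = cinner y (e i)"
  shows "x = y"
  using basis_expansion[OF assms(1), of x] basis_expansion[OF assms(1), of y]
  unfolding assms(2) by (rule has_sum_unique)

text \<open>Both sides are linear and continuous in \<open>x\<close>, so an adjoint relation need only be checked on a
  basis. With \<open>b = 0\<close> this extends orthogonality relations.\<close>

lemma basis_adjointI:
  assumes e: "orthonormal_basis e" and T: "bounded_clinear T"
    and basis: "\<And>i. cinner (T (e i)) a = cinner (e i) b"
  shows "cinner (T x) a = cinner x b"
proof (rule has_sum_unique)
  have "((\<lambda>i. T (cinner x (e i) *\<^sub>C e i)) has_sum T x) UNIV"
    using T by (intro has_sum_bounded_linear[OF _ basis_expansion[OF e]]) (simp add: bounded_clinear_def)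
  then show "((\<lambda>i. cinner x (e i) * cinner (e i) b) has_sum cinner (T x) a) UNIV"
    using T by (auto dest: has_sum_cinner_left[where y = a]
        simp: bounded_clinear_scaleC cinner_scaleC_left basis)
  show "((\<lambda>i. cinner x (e i) * cinner (e i) b) has_sum cinner x b) UNIV"
    by (rule basis_cinner_has_sum[OF e])
qed

lemma basis_operator_eqI:
  assumes e: "orthonormal_basis e" and T: "bounded_clinear T" and U: "bounded_clinear U"
    and basis: "\<And>i. T (e i) = U (e i)"
  shows "T x = U x"
proof (rule has_sum_unique)
  have *: "((\<lambda>i. cinner x (e i) *\<^sub>C R (e i)) has_sum R x) UNIV" if "bounded_clinear R"
    for R :: "'b \<Rightarrow> 'c"
    using has_sum_bounded_linear[OF _ basis_expansion[OF e], of R x] that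
    by (simp add: bounded_clinear_def)
  show "((\<lambda>i. cinner x (e i) *\<^sub>C T (e i)) has_sum T x) UNIV" by (rule *[OF T])
  show "((\<lambda>i. cinner x (e i) *\<^sub>C T (e i)) has_sum U x) UNIV" using *[OF U] by (simp add: basis)
qed

text \<open>If \<open>u\<close> is contractive, this is the contraction that sends the basis \<open>e\<close> to \<open>u\<close>.\<close>

definition basis_map ::
    "('i \<Rightarrow> 'a::complex_inner_space) \<Rightarrow> ('i \<Rightarrow> 'b::complex_hilbert_space) \<Rightarrow> 'a \<Rightarrow> 'b"
  where "basis_map e u x = lin_comb u (\<lambda>i. cinner x (e i))"

lemma basis_map_has_sum:
  assumes "orthonormal_basis e" "contractive_family u"
  shows "((\<lambda>i. cinner x (e i) *\<^sub>C u i) has_sum basis_map e u x) UNIV"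
  unfolding basis_map_def using assms
  by (intro lin_comb_has_sum basis_coeff_square_summable)

lemma bounded_clinear_basis_map:
  assumes e: "orthonormal_basis e" and u: "contractive_family u"
  shows "bounded_clinear (basis_map e u)"
proof -
  note hs = basis_map_has_sum[OF assms]
  have add: "basis_map e u (x + y) = basis_map e u x + basis_map e u y" for x y
  proof (rule has_sum_unique[OF hs])
    show "((\<lambda>i. cinner (x + y) (e i) *\<^sub>C u i) has_sum basis_map e u x + basis_map e u y) UNIV"
      using has_sum_add[OF hs[of x] hs[of y]] by (simp add: cinner_add_left scaleC_add_left)
  qed
  have bl: "bounded_linear (\<lambda>x. c *\<^sub>C (x :: 'c))" for c
    by (rule bounded_linear_intro[where K = "cmod c"])
      (simp_all add: scaleC_add_right scaleR_scaleC scaleC_scaleC mult.commute norm_scaleC)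
  have scale: "basis_map e u (c *\<^sub>C x) = c *\<^sub>C basis_map e u x" for c x
  proof (rule has_sum_unique[OF hs])
    show "((\<lambda>i. cinner (c *\<^sub>C x) (e i) *\<^sub>C u i) has_sum c *\<^sub>C basis_map e u x) UNIV"
      using has_sum_bounded_linear[OF bl hs[of x]] by (simp add: cinner_scaleC_left scaleC_scaleC)
  qed
  have "norm (basis_map e u x) \<le> norm x" for x
  proof -
    have "(norm (basis_map e u x))\<^sup>2 \<le> (\<Sum>\<^sub>\<infinity>i. (cmod (cinner x (e i)))\<^sup>2)"
      unfolding basis_map_def by (rule norm_lin_comb_le[OF u basis_coeff_square_summable[OF e]])
    also have "\<dots> \<le> (norm x)\<^sup>2"
      using e by (intro bessel) (simp add: orthonormal_basis_def)
    finally show ?thesis by (rule power2_le_imp_le) simp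
  qed
  then have "bounded_linear (basis_map e u)"
    by (intro bounded_linear_intro[where K = 1]) (simp_all add: add scaleR_scaleC scale)
  then show ?thesis by (simp add: bounded_clinear_def scale)
qed

lemma basis_map_basis:
  assumes "orthonormal_basis e" "contractive_family u"
  shows "basis_map e u (e k) = u k"
proof (rule has_sum_unique[OF basis_map_has_sum[OF assms]])
  have *: "cinner (e k) (e i) *\<^sub>C u i = (if i = k then u k else 0)" for i
    using assms(1) by (cases "i = k") (simp_all add: orthonormal_basis_def orthonormal_family_def scaleC_zero)
  have "((\<lambda>i. if i = k then u k else 0) has_sum u k) {k}"
    using has_sum_finite[of "{k}" "\<lambda>i. if i = k then u k else 0"] by simp
  then have "((\<lambda>i. if i = k then u k else 0) has_sum u k) UNIV"
    by (rule has_sum_cong_neutral[THEN iffD1, rotated -1]) auto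
  then show "((\<lambda>i. cinner (e k) (e i) *\<^sub>C u i) has_sum u k) UNIV" by (simp only: *)
qed

lemma basis_map_cinner_family:
  assumes "orthonormal_basis e" "orthonormal_family u"
  shows "cinner (basis_map e u x) (u k) = cinner x (e k)"
proof (rule basis_adjointI[OF assms(1)])
  show "bounded_clinear (basis_map e u)"
    using assms by (intro bounded_clinear_basis_map orthonormal_imp_contractive)
  have "orthonormal_family e" using assms(1) by (simp add: orthonormal_basis_def)
  then show "cinner (basis_map e u (e i)) (u k) = cinner (e i) (e k)" for i
    unfolding basis_map_basis[OF assms(1) orthonormal_imp_contractive[OF assms(2)]]
    using assms(2) by (simp add: orthonormal_family_def)
qed

lemma basis_map_isometry:
  assumes "orthonormal_basis e" "orthonormal_family u"
  shows "cinner (basis_map e u x) (basis_map e u y) = cinner x y"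
proof (rule basis_adjointI[OF assms(1)])
  show "bounded_clinear (basis_map e u)"
    using assms by (intro bounded_clinear_basis_map orthonormal_imp_contractive)
  show "cinner (basis_map e u (e i)) (basis_map e u y) = cinner (e i) y" for i
    using assms by (subst (1 2) cinner_commute)
      (simp add: basis_map_basis orthonormal_imp_contractive basis_map_cinner_family)
qed

text \<open>The value at \<open>y\<close> of the adjoint of \<open>T\<close> must have the coefficients \<open>\<langle>y, T (e i)\<rangle>\<close>. They are square
  summable: applying \<open>T\<close> to a finite combination of the \<open>e i\<close> with these coefficients bounds their partial
  sums by \<open>(K \<parallel>y\<parallel>)\<^sup>2\<close>.\<close>

lemma adjoint_exists:
  fixes e :: "'i \<Rightarrow> 'a::complex_hilbert_space" and T :: "'a \<Rightarrow> 'b::complex_inner_space"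
  assumes e: "orthonormal_basis e" and T: "bounded_clinear T"
  obtains x where "\<And>f. cinner (T f) y = cinner f x"
proof -
  let ?c = "\<lambda>i. cinner y (T (e i))"
  have e': "orthonormal_family e" using e by (simp add: orthonormal_basis_def)
  obtain K where K: "\<And>f. norm (T f) \<le> norm f * K" "K \<ge> 0"
    using T bounded_linear.nonneg_bounded unfolding bounded_clinear_def by blast
  have bound: "(\<Sum>i\<in>F. (cmod (?c i))\<^sup>2) \<le> (K * norm y)\<^sup>2" if F: "finite F" for F
  proof -
    let ?x = "\<Sum>i\<in>F. ?c i *\<^sub>C e i" and ?s = "\<Sum>i\<in>F. (cmod (?c i))\<^sup>2"
    have "T ?x = (\<Sum>i\<in>F. ?c i *\<^sub>C T (e i))"
      using T by (simp add: bounded_clinear_def linear_sum bounded_linear.linear)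
    then have "cinner y (T ?x) = complex_of_real ?s"
      by (simp only: cinner_sum_right cinner_scaleC_right of_real_sum complex_norm_square mult.commute)
    moreover have "0 \<le> ?s" by (intro sum_nonneg) simp
    ultimately have "?s \<le> norm y * norm (T ?x)"
      using cinner_bound[of y "T ?x"] by (simp del: of_real_sum)
    also have "\<dots> \<le> norm y * (norm ?x * K)" by (intro mult_left_mono K) simp
    also have "norm ?x = sqrt ?s"
      by (rule real_sqrt_unique[symmetric]) (simp_all add: norm_orthonormal_sum[OF e' F])
    finally have "sqrt ?s * sqrt ?s \<le> (K * norm y) * sqrt ?s"
      using \<open>0 \<le> ?s\<close> by (simp add: mult_ac)
    then have "sqrt ?s \<le> K * norm y"
    proof (cases "?s = 0")
      case False
      then have "sqrt ?s > 0" using \<open>0 \<le> ?s\<close> by simp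
      with \<open>sqrt ?s * sqrt ?s \<le> (K * norm y) * sqrt ?s\<close> show ?thesis
        by (rule mult_right_le_imp_le)
    next
      case True
      then show ?thesis using K(2) by (simp only: real_sqrt_zero) simp
    qed
    then show ?thesis
      using power_mono[of "sqrt ?s" "K * norm y" 2] \<open>0 \<le> ?s\<close> by (simp del: of_real_sum)
  qed
  have c: "square_summable ?c"
    unfolding square_summable_def
    by (rule nonneg_bdd_above_summable_on) (use bound in \<open>auto intro!: bdd_aboveI[of _ "(K * norm y)\<^sup>2"]\<close>)
  have "cinner (T (e i)) y = cinner (e i) (lin_comb e ?c)" for i
    by (subst (1 2) cinner_commute) (simp add: lin_comb_coeff[OF e' c])
  then have "cinner (T f) y = cinner f (lin_comb e ?c)" for f
    by (rule basis_adjointI[OF e T])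
  then show thesis by (rule that)
qed

text \<open>The operator is conjugate linear, so that \<open>\<langle>x, hankel_map e w y\<rangle>\<close> is the bilinear form with the
  matrix \<open>\<langle>e i, w j\<rangle>\<close>.\<close>

definition hankel_map ::
    "('i \<Rightarrow> 'a::complex_hilbert_space) \<Rightarrow> ('i \<Rightarrow> 'a) \<Rightarrow> 'a \<Rightarrow> 'a"
  where "hankel_map e w y = lin_comb w (\<lambda>i. cnj (cinner y (e i)))"

lemma cinner_hankel_map_has_sum:
  assumes "orthonormal_basis e" "contractive_family w"
  shows "((\<lambda>i. cinner y (e i) * cinner x (w i)) has_sum cinner x (hankel_map e w y)) UNIV"
  using has_sum_cinner_right[OF lin_comb_has_sum[OF assms(2)
      square_summable_cnj[OF basis_coeff_square_summable[OF assms(1), of y]]], of x]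
  by (simp add: cinner_scaleC_right hankel_map_def)

lemma hankel_map_orthogonal:
  assumes "orthonormal_basis e" "contractive_family w" "\<And>i. cinner x (w i) = 0"
  shows "cinner x (hankel_map e w y) = 0"
  using cinner_hankel_map_has_sum[OF assms(1,2), of y x] has_sum_0[of UNIV "\<lambda>_. 0 :: complex"]
  by (auto simp: assms(3) intro: has_sum_unique)

lemma cinner_basis_hankel_map:
  assumes e: "orthonormal_basis e" and w: "contractive_family w"
    and sym: "\<And>i j. cinner (e i) (w j) = cinner (e j) (w i)"
  shows "cinner (e i) (hankel_map e w y) = cinner y (w i)"
  using cinner_hankel_map_has_sum[OF e w, of y "e i"] basis_cinner_has_sum[OF e, of y "w i"]
  unfolding sym[of i] by (rule has_sum_unique)

lemma hankel_map_symmetric: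
  assumes e: "orthonormal_basis e" and w: "contractive_family w"
    and sym: "\<And>i j. cinner (e i) (w j) = cinner (e j) (w i)"
  shows "cinner x (hankel_map e w y) = cinner y (hankel_map e w x)"
  using basis_cinner_has_sum[OF e, of x "hankel_map e w y"] cinner_hankel_map_has_sum[OF e w, of x y]
  unfolding cinner_basis_hankel_map[OF assms] by (rule has_sum_unique)

text \<open>A Hankel matrix depends only on the sum of its indices, so a shift of one index can be traded
  for a shift of the other.\<close>

lemma hankel_map_intertwines_shift:
  assumes e: "orthonormal_basis e" and w: "contractive_family w"
    and sym: "\<And>i j. cinner (e i) (w j) = cinner (e j) (w i)"
    and M: "bounded_clinear M" "\<And>i. M (e i) = e (\<sigma> i)"
    and shift: "\<And>i j. cinner (e (\<sigma> i)) (w j) = cinner (e i) (w (\<sigma> j))"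
  shows "cinner (M x) (hankel_map e w y) = cinner x (hankel_map e w (M y))"
proof (rule basis_adjointI[OF e M(1)])
  fix i
  have "cinner (M y) (w i) = cinner y (w (\<sigma> i))"
    by (rule basis_adjointI[OF e M(1)]) (simp add: M(2) shift)
  then show "cinner (M (e i)) (hankel_map e w y) = cinner (e i) (hankel_map e w (M y))"
    by (simp add: M(2) cinner_basis_hankel_map[OF e w sym])
qed

section \<open>Taylor coefficients of inner functions\<close>

lemma square_summable_shift:
  fixes a :: "nat \<Rightarrow> complex"
  assumes "square_summable a"
  shows "square_summable (\<lambda>n. a (n + k))"
proof -
  have "summable (\<lambda>n. (cmod (a n))\<^sup>2)"
    using assms unfolding square_summable_def by (rule summable_on_imp_summable)
  then have "summable (\<lambda>n. (cmod (a (n + k)))\<^sup>2)" by (rule summable_ignore_initial_segment)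
  then show ?thesis
    unfolding square_summable_def by (subst summable_on_UNIV_nonneg_real_iff) (simp, assumption)
qed

lemma integral_cis:
  "(LINT t|lebesgue_on {0..2 * pi}. cis (of_int k * t)) = (if k = 0 then complex_of_real (2 * pi) else 0)"
proof (cases "k = 0")
  case True
  then show ?thesis
    by (simp add: scaleR_conv_of_real measure_restrict_space)
next
  case False
  let ?F = "\<lambda>z. exp (\<i> * of_int k * z) / (\<i> * of_int k)"
  have F: "?F (complex_of_real t) = cis (of_int k * t) / (\<i> * of_int k)" for t
    by (simp add: cis_conv_exp mult.assoc)
  have "((\<lambda>t. cis (of_int k * t)) has_integral ?F (of_real (2 * pi)) - ?F (of_real 0)) {0..2 * pi}"
  proof (rule fundamental_theorem_of_calculus)
    fix t :: real
    have "(?F has_field_derivative exp (\<i> * of_int k * of_real t)) (at (of_real t))"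
      by (rule derivative_eq_intros refl | use False in simp)+
    then show "((\<lambda>t. ?F (of_real t)) has_vector_derivative cis (of_int k * t)) (at t within {0..2 * pi})"
      by (rule has_vector_derivative_real_field[THEN has_vector_derivative_at_within, THEN back_subst[of "\<lambda>x. ((\<lambda>t. ?F (of_real t)) has_vector_derivative x) (at t within {0..2 * pi})"]])
        (simp add: cis_conv_exp mult.assoc)
  qed simp
  moreover have "cis (of_int k * (2 * pi)) = 1"
    using cis_multiple_2pi[of "of_int k"] by (simp add: mult_ac)
  ultimately have "integral {0..2 * pi} (\<lambda>t. cis (of_int k * t)) = 0"
    unfolding F by (simp add: integral_unique)
  moreover have "integrable (lebesgue_on {0..2 * pi}) (\<lambda>t. cis (of_int k * t))"
    by (intro continuous_imp_integrable_real continuous_intros)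
  ultimately show ?thesis using False
    by (simp add: lebesgue_integral_eq_integral)
qed

text \<open>Dominated convergence with the summable majorant \<open>|a n| B\<close>. It is used twice below: to expand \<open>\<phi>\<close>
  against an exponential, and to expand one factor of \<open>|\<phi>|\<^sup>2\<close> against the other.\<close>

lemma sums_integral_weighted:
  fixes a :: "nat \<Rightarrow> complex" and g :: "nat \<Rightarrow> real \<Rightarrow> complex"
  assumes a: "summable (\<lambda>n. norm (a n))"
    and g: "\<And>n. continuous_on {l..u} (g n)" "\<And>n t. t \<in> {l..u} \<Longrightarrow> norm (g n t) \<le> B"
    and f: "\<And>t. t \<in> {l..u} \<Longrightarrow> (\<lambda>n. a n * g n t) sums f t"
  shows "(\<lambda>n. a n * (LINT t|lebesgue_on {l..u}. g n t)) sums (LINT t|lebesgue_on {l..u}. f t)"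
proof -
  let ?M = "lebesgue_on {l..u}"
  have fin: "finite_measure ?M" by (rule finite_measure_lebesgue_on) simp
  have intg: "integrable ?M (\<lambda>t. a n * g n t)" for n
    by (intro continuous_imp_integrable_real continuous_intros g)
  have le: "norm (a n * g n t) \<le> norm (a n) * B" if "t \<in> {l..u}" for n t
    using g(2)[OF that, of n] by (simp add: norm_mult mult_left_mono)
  have aB: "summable (\<lambda>n. norm (a n) * B)" using a by (rule summable_mult2)
  have "(\<lambda>n. LINT t|?M. a n * g n t) sums (LINT t|?M. (\<Sum>n. a n * g n t))"
  proof (rule sums_integral[OF intg])
    show "AE t in ?M. summable (\<lambda>n. norm (a n * g n t))"
    proof (rule AE_I2)
      fix t assume "t \<in> space ?M"
      then have "t \<in> {l..u}" by (simp add: space_restrict_space)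
      then show "summable (\<lambda>n. norm (a n * g n t))"
        by (intro summable_comparison_test'[OF aB, of 0]) (use le in auto)
    qed
    show "summable (\<lambda>n. LINT t|?M. norm (a n * g n t))"
    proof (rule summable_comparison_test'[OF summable_mult2[OF aB, of "measure ?M {l..u}"], of 0])
      fix n :: nat
      have "(LINT t|?M. norm (a n * g n t)) \<le> (LINT t|?M. norm (a n) * B)"
        using fin le by (intro integral_mono integrable_norm intg)
          (auto simp: space_restrict_space finite_measure.integrable_const)
      then show "norm (LINT t|?M. norm (a n * g n t)) \<le> norm (a n) * B * measure ?M {l..u}"
        by (simp add: space_restrict_space mult_ac)
    qed
  qed
  moreover have "(LINT t|?M. (\<Sum>n. a n * g n t)) = (LINT t|?M. f t)"
    by (rule Bochner_Integration.integral_cong) (use f in \<open>auto simp: space_restrict_space sums_iff\<close>)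
  moreover have "(LINT t|?M. a n * g n t) = a n * (LINT t|?M. g n t)" for n
    by simp
  ultimately show ?thesis by (simp only:)
qed

lemma circle_coefficient:
  fixes c :: "nat \<Rightarrow> complex"
  assumes ps: "\<And>z. z \<in> \<D> \<Longrightarrow> (\<lambda>n. c n * z ^ n) sums \<phi> z" and r: "0 \<le> r" "r < 1"
  shows "(LINT t|lebesgue_on {0..2 * pi}. \<phi> (of_real r * cis t) * cis (- (real j * t)))
    = of_real (2 * pi) * (c j * of_real r ^ j)"
proof (rule sums_unique2)
  have abs: "summable (\<lambda>n. norm (c n * of_real r ^ n))"
    using r powser_insidea[of c "of_real ((1 + r) / 2)" "of_real r"]
      ps[of "of_real ((1 + r) / 2)", THEN sums_summable]
    by (simp del: of_real_add of_real_divide)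
  show "(\<lambda>n. (c n * of_real r ^ n) * (LINT t|lebesgue_on {0..2 * pi}. cis (of_int (int n - int j) * t)))
      sums (LINT t|lebesgue_on {0..2 * pi}. \<phi> (of_real r * cis t) * cis (- (real j * t)))"
  proof (rule sums_integral_weighted[OF abs])
    fix t :: real
    have "(\<lambda>n. (c n * (of_real r * cis t) ^ n) * cis (- (real j * t)))
        sums (\<phi> (of_real r * cis t) * cis (- (real j * t)))"
      using r by (intro sums_mult2 ps) (simp add: norm_mult)
    moreover have "c n * (of_real r * cis t) ^ n * cis (- (real j * t))
        = c n * of_real r ^ n * cis (of_int (int n - int j) * t)" for n
      by (simp add: power_mult_distrib Complex.DeMoivre cis_mult left_diff_distrib)
    ultimately show "(\<lambda>n. c n * of_real r ^ n * cis (of_int (int n - int j) * t))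
        sums (\<phi> (of_real r * cis t) * cis (- (real j * t)))" by simp
  qed (auto intro!: continuous_intros)
  have "(\<lambda>n. (c n * of_real r ^ n) * (LINT t|lebesgue_on {0..2 * pi}. cis (of_int (int n - int j) * t)))
    = (\<lambda>n. if n = j then of_real (2 * pi) * (c n * of_real r ^ n) else 0)"
    unfolding integral_cis by auto
  then show "(\<lambda>n. (c n * of_real r ^ n) * (LINT t|lebesgue_on {0..2 * pi}. cis (of_int (int n - int j) * t)))
      sums (of_real (2 * pi) * (c j * of_real r ^ j))"
    using sums_single[of j "\<lambda>n. of_real (2 * pi) * (c n * of_real r ^ n)"] by simp
qed

text \<open>Parseval's identity on the circle of radius \<open>r\<close>, for \<open>z\<^sup>k \<phi>\<close> and \<open>\<phi>\<close> (up to the factor \<open>r\<^sup>k\<close>).\<close>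

lemma circle_correlation:
  fixes c :: "nat \<Rightarrow> complex"
  assumes ps: "\<And>z. z \<in> \<D> \<Longrightarrow> (\<lambda>n. c n * z ^ n) sums \<phi> z"
    and cont: "continuous_on \<D> \<phi>" and bound: "\<And>z. z \<in> \<D> \<Longrightarrow> cmod (\<phi> z) \<le> M"
    and r: "0 \<le> r" "r < 1"
  shows "(\<lambda>n. c n * cnj (c (n + k)) * of_real r ^ (2 * n + k)) sums
    ((LINT t|lebesgue_on {0..2 * pi}. \<phi> (of_real r * cis t) * cis (real k * t) * cnj (\<phi> (of_real r * cis t)))
      / of_real (2 * pi))"
proof -
  let ?L = "lebesgue_on {0..2 * pi}"
  have abs: "summable (\<lambda>n. norm (c n * of_real r ^ n))"
    using r powser_insidea[of c "of_real ((1 + r) / 2)" "of_real r"]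
      ps[of "of_real ((1 + r) / 2)", THEN sums_summable]
    by (simp del: of_real_add of_real_divide)
  have in_D: "of_real r * cis t \<in> \<D>" for t using r by (simp add: norm_mult)
  have cont': "continuous_on {0..2 * pi} (\<lambda>t. \<phi> (of_real r * cis t))"
    by (rule continuous_on_compose2[OF cont]) (use in_D in \<open>auto intro!: continuous_intros\<close>)
  have "(\<lambda>n. (c n * of_real r ^ n) * (LINT t|?L. cis (real (n + k) * t) * cnj (\<phi> (of_real r * cis t))))
    sums (LINT t|?L. \<phi> (of_real r * cis t) * cis (real k * t) * cnj (\<phi> (of_real r * cis t)))"
  proof (rule sums_integral_weighted[OF abs])
    show "continuous_on {0..2 * pi} (\<lambda>t. cis (real (n + k) * t) * cnj (\<phi> (of_real r * cis t)))" for n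
      by (intro continuous_intros cont')
    show "norm (cis (real (n + k) * t) * cnj (\<phi> (of_real r * cis t))) \<le> M" for n t
      using bound[OF in_D] by (simp add: norm_mult)
    fix t :: real
    have "(\<lambda>n. (c n * (of_real r * cis t) ^ n) * (cis (real k * t) * cnj (\<phi> (of_real r * cis t))))
        sums (\<phi> (of_real r * cis t) * (cis (real k * t) * cnj (\<phi> (of_real r * cis t))))"
      using in_D by (intro sums_mult2 ps)
    moreover have "(c n * (of_real r * cis t) ^ n) * (cis (real k * t) * cnj (\<phi> (of_real r * cis t)))
      = c n * of_real r ^ n * (cis (real (n + k) * t) * cnj (\<phi> (of_real r * cis t)))" for n
      by (simp add: power_mult_distrib Complex.DeMoivre distrib_right flip: cis_mult)
    ultimately show "(\<lambda>n. c n * of_real r ^ n * (cis (real (n + k) * t) * cnj (\<phi> (of_real r * cis t))))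
      sums (\<phi> (of_real r * cis t) * cis (real k * t) * cnj (\<phi> (of_real r * cis t)))"
      by (simp only: mult.assoc)
  qed
  moreover have "(LINT t|?L. cis (real (n + k) * t) * cnj (\<phi> (of_real r * cis t)))
      = of_real (2 * pi) * (cnj (c (n + k)) * of_real r ^ (n + k))" for n
  proof -
    have "(LINT t|?L. cis (real (n + k) * t) * cnj (\<phi> (of_real r * cis t)))
        = (LINT t|?L. cnj (\<phi> (of_real r * cis t) * cis (- (real (n + k) * t))))"
      by (simp add: cis_cnj mult.commute)
    also have "\<dots> = cnj (LINT t|?L. \<phi> (of_real r * cis t) * cis (- (real (n + k) * t)))"
      by (rule Bochner_Integration.integral_cnj)
    also have "\<dots> = cnj (of_real (2 * pi) * (c (n + k) * of_real r ^ (n + k)))"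
      by (simp only: circle_coefficient[OF ps r])
    finally show ?thesis by simp
  qed
  ultimately have "(\<lambda>n. (c n * of_real r ^ n) * (of_real (2 * pi) * (cnj (c (n + k)) * of_real r ^ (n + k))))
    sums (LINT t|?L. \<phi> (of_real r * cis t) * cis (real k * t) * cnj (\<phi> (of_real r * cis t)))" by simp
  then have "(\<lambda>n. (c n * of_real r ^ n) * (of_real (2 * pi) * (cnj (c (n + k)) * of_real r ^ (n + k))) / of_real (2 * pi))
    sums ((LINT t|?L. \<phi> (of_real r * cis t) * cis (real k * t) * cnj (\<phi> (of_real r * cis t))) / of_real (2 * pi))"
    by (rule sums_divide)
  moreover have "(c n * of_real r ^ n) * (of_real (2 * pi) * (cnj (c (n + k)) * of_real r ^ (n + k))) / of_real (2 * pi)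
      = c n * cnj (c (n + k)) * of_real r ^ (2 * n + k)" for n
  proof -
    have p: "of_real r ^ (2 * n + k) = of_real r ^ n * (of_real r ^ (n + k) :: complex)"
      by (simp only: power_add mult_2 mult.assoc)
    show ?thesis unfolding p by simp
  qed
  ultimately show ?thesis by (simp only:)
qed

text \<open>On the circle \<open>|z| = r\<close> the correlations of the coefficients, weighted by powers of \<open>r\<close>, are the Fourier
  coefficients of \<open>|\<phi>|\<^sup>2\<close>. As \<open>r\<close> tends to \<open>1\<close>, \<open>|\<phi>|\<^sup>2\<close> tends boundedly to \<open>1\<close> almost everywhere, and
  the constant \<open>1\<close> has a single nonzero Fourier coefficient. The limit on the side of the series is
  Tannery's theorem; its majorant comes from the square summability, which the case \<open>k = 0\<close> yields first.\<close>

lemma inner_function_coefficients: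
  assumes "inner_function \<phi>"
  obtains c where "square_summable c"
    and "\<And>z. z \<in> \<D> \<Longrightarrow> ((\<lambda>n. c n * z ^ n) has_sum \<phi> z) UNIV"
    and "\<And>k. l2_inner c (\<lambda>n. c (n + k)) = (if k = 0 then 1 else 0)"
proof -
  define c where "c n = (deriv ^^ n) \<phi> 0 / fact n" for n
  have hol: "\<phi> holomorphic_on \<D>" and "bounded (\<phi> ` \<D>)"
    using assms by (auto simp: inner_function_def H_infinity_def)
  then obtain M where M: "\<And>z. z \<in> \<D> \<Longrightarrow> cmod (\<phi> z) \<le> M"
    unfolding bounded_iff by blast
  have ps: "(\<lambda>n. c n * z ^ n) sums \<phi> z" if "z \<in> \<D>" for z
    using holomorphic_power_series[OF hol that] by (simp add: c_def)
  have cont: "continuous_on \<D> \<phi>" using hol by (rule holomorphic_on_imp_continuous_on)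
  let ?L = "lebesgue_on {0..2 * pi}"
  \<comment> \<open>dominated convergence needs a sequence of radii, here increasing to \<open>1\<close>\<close>
  define r where "r i = 1 - 1 / (real i + 2)" for i
  have r: "0 \<le> r i" "r i < 1" for i by (auto simp: r_def field_simps)
  have r_lim: "r \<longlonglongrightarrow> 1" unfolding r_def by real_asymp
  define I where "I k i = (LINT t|?L. \<phi> (of_real (r i) * cis t) * cis (real k * t)
      * cnj (\<phi> (of_real (r i) * cis t))) / of_real (2 * pi)" for k i
  have corr: "(\<lambda>n. c n * cnj (c (n + k)) * of_real (r i) ^ (2 * n + k)) sums I k i" for k i
    unfolding I_def by (rule circle_correlation[OF ps cont M r])
  have in_D: "of_real (r i) * cis t \<in> \<D>" for i t using r by (simp add: norm_mult)
  have I_lim: "I k \<longlonglongrightarrow> (if k = 0 then 1 else 0)" for k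
  proof -
    have "(\<lambda>i. LINT t|?L. \<phi> (of_real (r i) * cis t) * cis (real k * t) * cnj (\<phi> (of_real (r i) * cis t)))
        \<longlonglongrightarrow> (LINT t|?L. cis (of_int (int k) * t))"
    proof (rule integral_dominated_convergence[where w = "\<lambda>_. M\<^sup>2"])
      show "(\<lambda>t. cis (of_int (int k) * t)) \<in> borel_measurable ?L"
        by (intro borel_measurable_integrable continuous_imp_integrable_real continuous_intros)
      have c': "continuous_on {0..2 * pi} (\<lambda>t. \<phi> (of_real (r i) * cis t))" for i
        by (rule continuous_on_compose2[OF cont]) (use in_D in \<open>auto intro!: continuous_intros\<close>)
      show "(\<lambda>t. \<phi> (of_real (r i) * cis t) * cis (real k * t) * cnj (\<phi> (of_real (r i) * cis t)))
          \<in> borel_measurable ?L" for i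
        by (intro borel_measurable_integrable continuous_imp_integrable_real continuous_intros c')
      show "integrable ?L (\<lambda>_. M\<^sup>2)"
        by (intro finite_measure.integrable_const finite_measure_lebesgue_on) simp
      show "AE t in ?L. norm (\<phi> (of_real (r i) * cis t) * cis (real k * t)
          * cnj (\<phi> (of_real (r i) * cis t))) \<le> M\<^sup>2" for i
      proof (rule AE_I2)
        fix t
        show "norm (\<phi> (of_real (r i) * cis t) * cis (real k * t)
            * cnj (\<phi> (of_real (r i) * cis t))) \<le> M\<^sup>2"
          using mult_mono[OF M M, OF in_D in_D, of i t i t] order_trans[OF norm_ge_zero M[OF in_D[of i t]]]
          by (simp add: norm_mult power2_eq_square)
      qed
      have "AE t in ?L. \<exists>l. ((\<lambda>r. \<phi> (of_real r * cis t)) \<longlongrightarrow> l) (at_left 1) \<and> cmod l = 1"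
        using assms by (simp add: inner_function_def)
      then show "AE t in ?L. (\<lambda>i. \<phi> (of_real (r i) * cis t) * cis (real k * t)
          * cnj (\<phi> (of_real (r i) * cis t))) \<longlonglongrightarrow> cis (of_int (int k) * t)"
      proof eventually_elim
        case (elim t)
        then obtain l where l: "((\<lambda>r. \<phi> (of_real r * cis t)) \<longlongrightarrow> l) (at_left 1)" "cmod l = 1" by blast
        have "filterlim r (at_left 1) sequentially"
          using r_lim r(2) by (auto simp: filterlim_at less_imp_neq)
        then have "(\<lambda>i. \<phi> (of_real (r i) * cis t)) \<longlonglongrightarrow> l"
          using l(1) filterlim_compose by blast
        then have "(\<lambda>i. \<phi> (of_real (r i) * cis t) * cis (real k * t) * cnj (\<phi> (of_real (r i) * cis t)))
          \<longlonglongrightarrow> l * cis (real k * t) * cnj l" by (intro tendsto_intros)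
        moreover have "l * cis (real k * t) * cnj l = cis (real k * t) * (l * cnj l)"
          by (simp add: mult_ac)
        moreover have "l * cnj l = 1" using l(2) by (simp add: complex_norm_square[symmetric])
        ultimately show ?case by simp
      qed
    qed
    then have "(\<lambda>i. I k i) \<longlonglongrightarrow> (LINT t|?L. cis (of_int (int k) * t)) / of_real (2 * pi)"
      unfolding I_def by (intro tendsto_intros) auto
    then show ?thesis unfolding integral_cis by (simp split: if_splits)
  qed
  have partial: "(\<Sum>n<N. (cmod (c n))\<^sup>2) \<le> 1" for N
  proof (rule LIMSEQ_le)
    show "(\<lambda>i. \<Sum>n<N. (cmod (c n))\<^sup>2 * r i ^ (2 * n)) \<longlonglongrightarrow> (\<Sum>n<N. (cmod (c n))\<^sup>2)"
      by (rule tendsto_eq_intros r_lim refl)+ simp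
    show "(\<lambda>i. Re (I 0 i)) \<longlonglongrightarrow> 1" using tendsto_Re[OF I_lim[of 0]] by simp
    have "(\<Sum>n<N. (cmod (c n))\<^sup>2 * r i ^ (2 * n)) \<le> Re (I 0 i)" for i
    proof -
      have "c n * cnj (c n) * of_real (r i) ^ (2 * n) = of_real ((cmod (c n))\<^sup>2 * r i ^ (2 * n))" for n
        by (simp only: complex_norm_square[symmetric] of_real_mult of_real_power)
      then have "(\<lambda>n. (cmod (c n))\<^sup>2 * r i ^ (2 * n)) sums Re (I 0 i)"
        using sums_Re[OF corr[of 0 i]] by (simp only: add_0_right Re_complex_of_real)
      then show ?thesis
        using r(1) sum_le_suminf[of "\<lambda>n. (cmod (c n))\<^sup>2 * r i ^ (2 * n)" "{..<N}"]
        by (simp add: sums_iff)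
    qed
    then show "\<exists>N'. \<forall>i\<ge>N'. (\<Sum>n<N. (cmod (c n))\<^sup>2 * r i ^ (2 * n)) \<le> Re (I 0 i)" by blast
  qed
  have sm2: "summable (\<lambda>n. (cmod (c n))\<^sup>2)"
  proof (rule bounded_imp_summable)
    show "(\<Sum>n\<le>N. (cmod (c n))\<^sup>2) \<le> 1" for N
      using partial[of "Suc N"] by (simp only: lessThan_Suc_atMost)
  qed simp
  then have ss: "square_summable c"
    unfolding square_summable_def by (subst summable_on_UNIV_nonneg_real_iff) simp_all
  have ss_shift: "square_summable (\<lambda>n. c (n + k))" for k
    by (rule square_summable_shift[OF ss])
  have corr_lim: "l2_inner c (\<lambda>n. c (n + k)) = (if k = 0 then 1 else 0)" for k
  proof -
    have abs: "(\<lambda>n. norm (c n * cnj (c (n + k)))) summable_on UNIV"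
      by (rule square_summable_prod_abs[OF ss square_summable_cnj[OF ss_shift]])
    then have sm: "summable (\<lambda>n. norm (c n * cnj (c (n + k))))"
      by (rule summable_on_imp_summable)
    have "(\<lambda>i. \<Sum>n. c n * cnj (c (n + k)) * of_real (r i) ^ (2 * n + k))
        \<longlonglongrightarrow> (\<Sum>n. c n * cnj (c (n + k)))"
    proof (rule tannerys_theorem[THEN conjunct2, THEN conjunct2])
      show "(\<lambda>i. c n * cnj (c (n + k)) * of_real (r i) ^ (2 * n + k)) \<longlonglongrightarrow> c n * cnj (c (n + k))" for n
        by (rule tendsto_eq_intros r_lim refl)+ simp
      show "\<forall>\<^sub>F (n, i) in at_top \<times>\<^sub>F sequentially.
          norm (c n * cnj (c (n + k)) * of_real (r i) ^ (2 * n + k)) \<le> norm (c n * cnj (c (n + k)))"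
      proof (intro always_eventually allI, clarify)
        fix n i
        have "r i ^ (2 * n + k) \<le> 1" using r[of i] by (intro power_le_one) auto
        then show "norm (c n * cnj (c (n + k)) * of_real (r i) ^ (2 * n + k)) \<le> norm (c n * cnj (c (n + k)))"
          using r(1)[of i] by (simp add: norm_mult norm_power mult_left_le)
      qed
    qed (use sm in simp_all)
    then have "I k \<longlonglongrightarrow> (\<Sum>n. c n * cnj (c (n + k)))"
      using corr by (simp add: sums_iff)
    then have "(\<Sum>n. c n * cnj (c (n + k))) = (if k = 0 then 1 else 0)"
      by (rule LIMSEQ_unique[OF _ I_lim])
    moreover have "(\<lambda>n. c n * cnj (c (n + k))) sums l2_inner c (\<lambda>n. c (n + k))"
      unfolding l2_inner_def
      by (intro has_sum_imp_sums has_sum_infsum square_summable_inner ss ss_shift)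
    from sums_unique[OF this]
    have "l2_inner c (\<lambda>n. c (n + k)) = (\<Sum>n. c n * cnj (c (n + k)))" .
    ultimately show ?thesis by simp
  qed
  show thesis
  proof (rule that[OF ss _ corr_lim])
    fix z assume z: "z \<in> \<D>"
    have "(\<lambda>n. c n * z ^ n) summable_on UNIV"
      using square_summable_prod[OF ss square_summable_disc_monom[OF z]] by (simp add: disc_monom_def)
    then have "((\<lambda>n. c n * z ^ n) has_sum infsum (\<lambda>n. c n * z ^ n) UNIV) UNIV" by (rule has_sum_infsum)
    moreover from has_sum_imp_sums[OF this] have "infsum (\<lambda>n. c n * z ^ n) UNIV = \<phi> z"
      using ps[OF z] by (rule sums_unique2)
    ultimately show "((\<lambda>n. c n * z ^ n) has_sum \<phi> z) UNIV" by simp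
  qed
qed

section \<open>Monomial bases, shifts and simple tensors\<close>

lemma disc_fun_outside: "z \<notin> \<D> \<Longrightarrow> disc_fun f z = 0"
  using disc_expansion[of f] by (simp add: l2_expansion_def)

lemma bidisc_fun_eqI: "(\<And>p. bidisc_fun F p = bidisc_fun G p) \<Longrightarrow> F = G"
  by (simp add: bidisc_fun_inject[symmetric] fun_eq_iff)

lemma disc_fun_eqI: "(\<And>z. z \<in> \<D> \<Longrightarrow> disc_fun f z = disc_fun g z) \<Longrightarrow> f = g"
  unfolding disc_fun_inject[symmetric] fun_eq_iff by (metis disc_fun_outside)

lemma l2_inner_delta: "l2_inner a (\<lambda>i. if i = k then 1 else 0) = a k"
proof -
  have "l2_inner a (\<lambda>i. if i = k then 1 else 0) = (\<Sum>\<^sub>\<infinity>i\<in>{k}. a i)"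
    unfolding l2_inner_def by (rule infsum_cong_neutral) auto
  then show ?thesis by simp
qed

lemma square_summable_delta: "square_summable (\<lambda>i. if i = k then 1 else 0)"
proof -
  have "(\<lambda>i. (cmod (if i = k then 1 else 0))\<^sup>2) summable_on {k}" by simp
  then show ?thesis
    unfolding square_summable_def by (rule summable_on_cong_neutral[THEN iffD1, rotated -1]) auto
qed

definition disc_basis :: "nat \<Rightarrow> hardy_disc"
  where "disc_basis k = (SOME f. disc_coeff f = (\<lambda>i. if i = k then 1 else 0))"

lemma disc_coeff_basis: "disc_coeff (disc_basis k) = (\<lambda>i. if i = k then 1 else 0)"
  unfolding disc_basis_def by (rule someI_ex) (rule disc_coeff_surj[OF square_summable_delta])

lemma cinner_disc_basis: "cinner f (disc_basis k) = disc_coeff f k"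
  by (simp add: cinner_hardy_disc_def disc_coeff_basis l2_inner_delta)

lemma orthonormal_basis_disc: "orthonormal_basis disc_basis"
proof (rule orthonormal_basisI)
  show "orthonormal_family disc_basis"
    by (auto simp: orthonormal_family_def cinner_disc_basis disc_coeff_basis)
  show "f = g" if "\<And>i. cinner f (disc_basis i) = cinner g (disc_basis i)" for f g
    using that by (simp add: cinner_disc_basis disc_coeff_inject[symmetric] fun_eq_iff)
qed

lemmas orthonormal_disc_basis = orthonormal_basis_disc[unfolded orthonormal_basis_def, THEN conjunct1]

definition bidisc_basis :: "nat \<times> nat \<Rightarrow> hardy_bidisc"
  where "bidisc_basis = (\<lambda>(m, n). disc_basis m \<otimes>\<^sub>h disc_basis n)"

lemma cinner_simple_tensor:
  "cinner (f \<otimes>\<^sub>h g) (f' \<otimes>\<^sub>h g') = cinner f f' * cinner g g'"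
proof -
  let ?a = "disc_coeff f" and ?b = "disc_coeff g" and ?c = "disc_coeff f'" and ?d = "disc_coeff g'"
  let ?t = "\<lambda>i. (case i of (m, n) \<Rightarrow> ?a m * ?b n) * cnj (case i of (m, n) \<Rightarrow> ?c m * ?d n)"
  have f: "((\<lambda>m. ?a m * cnj (?c m)) has_sum cinner f f') UNIV"
    and g: "((\<lambda>n. ?b n * cnj (?d n)) has_sum cinner g g') UNIV"
    unfolding cinner_hardy_disc_def l2_inner_def
    by (intro has_sum_infsum square_summable_inner square_summable_disc_coeff)+
  have "?t summable_on UNIV \<times> UNIV"
    unfolding UNIV_Times_UNIV
    by (intro square_summable_inner square_summable_tensor square_summable_disc_coeff)
  moreover have "((\<lambda>n. ?t (m, n)) has_sum (?a m * cnj (?c m)) * cinner g g') UNIV" for m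
    using has_sum_cmult_right[OF g, of "?a m * cnj (?c m)"] by (simp add: mult_ac)
  ultimately have "(?t has_sum cinner f f' * cinner g g') (UNIV \<times> UNIV)"
    by (intro has_sum_SigmaI[where g = "\<lambda>m. (?a m * cnj (?c m)) * cinner g g'"]
        has_sum_cmult_left f) auto
  then show ?thesis
    unfolding cinner_hardy_bidisc_def bidisc_coeff_simple_tensor l2_inner_def
    by (intro infsumI) simp
qed

lemma norm_simple_tensor: "norm (f \<otimes>\<^sub>h g) = norm f * norm g"
proof -
  have "complex_of_real ((norm (f \<otimes>\<^sub>h g))\<^sup>2) = complex_of_real ((norm f * norm g)\<^sup>2)"
    unfolding cinner_self[symmetric] cinner_simple_tensor
    by (simp only: cinner_self power_mult_distrib of_real_mult)
  then have "(norm (f \<otimes>\<^sub>h g))\<^sup>2 = (norm f * norm g)\<^sup>2"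
    using of_real_eq_iff by blast
  then show ?thesis by simp
qed

lemma bounded_clinear_tensor_left: "bounded_clinear (\<lambda>f. f \<otimes>\<^sub>h g)"
proof -
  have add: "(f + f') \<otimes>\<^sub>h g = f \<otimes>\<^sub>h g + f' \<otimes>\<^sub>h g" for f f'
    by (simp add: bidisc_coeff_inject[symmetric] bidisc_coeff_simple_tensor bidisc_coeff_add
        disc_coeff_add fun_eq_iff distrib_right)
  have scale: "(c *\<^sub>C f) \<otimes>\<^sub>h g = c *\<^sub>C (f \<otimes>\<^sub>h g)" for c f
    by (simp add: bidisc_coeff_inject[symmetric] bidisc_coeff_simple_tensor bidisc_coeff_scaleC
        disc_coeff_scaleC fun_eq_iff)
  have "bounded_linear (\<lambda>f. f \<otimes>\<^sub>h g)"
    by (rule bounded_linear_intro[where K = "norm g"])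
      (simp_all add: add scale scaleR_scaleC norm_simple_tensor)
  then show ?thesis by (simp add: bounded_clinear_def scale)
qed

lemma bounded_clinear_tensor_right: "bounded_clinear (\<lambda>g. f \<otimes>\<^sub>h g)"
proof -
  have add: "f \<otimes>\<^sub>h (g + g') = f \<otimes>\<^sub>h g + f \<otimes>\<^sub>h g'" for g g'
    by (simp add: bidisc_coeff_inject[symmetric] bidisc_coeff_simple_tensor bidisc_coeff_add
        disc_coeff_add fun_eq_iff distrib_left)
  have scale: "f \<otimes>\<^sub>h (c *\<^sub>C g) = c *\<^sub>C (f \<otimes>\<^sub>h g)" for c g
    by (simp add: bidisc_coeff_inject[symmetric] bidisc_coeff_simple_tensor bidisc_coeff_scaleC
        disc_coeff_scaleC fun_eq_iff)
  have "bounded_linear (\<lambda>g. f \<otimes>\<^sub>h g)"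
  proof (rule bounded_linear_intro[where K = "norm f"])
    show "norm (f \<otimes>\<^sub>h g) \<le> norm g * norm f" for g
      by (simp only: norm_simple_tensor mult.commute)
  qed (simp_all add: add scale scaleR_scaleC)
  then show ?thesis by (simp add: bounded_clinear_def scale)
qed

lemma orthonormal_tensor:
  assumes "orthonormal_family u" "orthonormal_family v"
  shows "orthonormal_family (\<lambda>(m, n). u m \<otimes>\<^sub>h v n)"
  using assms by (auto simp: orthonormal_family_def cinner_simple_tensor)

lemma orthonormal_basis_bidisc: "orthonormal_basis bidisc_basis"
proof (rule orthonormal_basisI)
  show "orthonormal_family bidisc_basis"
    unfolding bidisc_basis_def
    by (intro orthonormal_tensor orthonormal_disc_basis)
  have "bidisc_coeff (bidisc_basis k) = (\<lambda>i. if i = k then 1 else 0)" for k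
    by (auto simp: bidisc_basis_def bidisc_coeff_simple_tensor disc_coeff_basis split: prod.splits)
  then have "cinner F (bidisc_basis k) = bidisc_coeff F k" for F k
    by (simp add: cinner_hardy_bidisc_def l2_inner_delta)
  then show "F = G" if "\<And>i. cinner F (bidisc_basis i) = cinner G (bidisc_basis i)" for F G
    using that by (simp add: bidisc_coeff_inject[symmetric] fun_eq_iff)
qed

lift_definition D_z :: "hardy_disc \<Rightarrow> hardy_disc" is "\<lambda>f z. z * f z"
proof -
  fix f assume "\<exists>a. l2_expansion disc_monom \<D> f a"
  then obtain a where a: "l2_expansion disc_monom \<D> f a" by blast
  show "\<exists>a. l2_expansion disc_monom \<D> (\<lambda>z. z * f z) a"
    using l2_expansion_shift[OF a, of Suc "\<lambda>z. z"] by (auto simp: disc_monom_def)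
qed

lemma D_z_adjoint: "l2_inner (disc_coeff (D_z f)) b = l2_inner (disc_coeff f) (\<lambda>n. b (Suc n))"
proof -
  obtain h where h: "\<forall>z. disc_fun h z = z * disc_fun f z"
    "\<forall>b. l2_inner (disc_coeff h) b = l2_inner (disc_coeff f) (\<lambda>n. b (Suc n))"
    using disc_shift[of f] by blast
  have "h = D_z f" by (rule disc_fun_eqI) (simp add: h(1) D_z.rep_eq)
  then show ?thesis using h(2) by simp
qed

lemma D_z_coeff: "disc_coeff (D_z f) (Suc n) = disc_coeff f n"
proof -
  have "disc_coeff (D_z f) (Suc n) = l2_inner (disc_coeff f) (\<lambda>i. if Suc i = Suc n then 1 else 0)"
    using D_z_adjoint[of f "\<lambda>i. if i = Suc n then 1 else 0"] by (simp only: l2_inner_delta)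
  then show ?thesis by (simp add: l2_inner_delta)
qed

lemma D_z_isometry: "cinner (D_z f) (D_z g) = cinner f g"
  by (simp add: cinner_hardy_disc_def D_z_adjoint D_z_coeff)

lemma D_z_pow_isometry: "cinner ((D_z ^^ k) f) ((D_z ^^ k) g) = cinner f g"
  by (induction k) (simp_all add: D_z_isometry)

lemma D_z_pow_fun: "disc_fun ((D_z ^^ k) f) z = z ^ k * disc_fun f z"
  by (induction k) (simp_all add: D_z.rep_eq)

lemma D_z_pow_adjoint:
  "l2_inner (disc_coeff ((D_z ^^ k) f)) b = l2_inner (disc_coeff f) (\<lambda>n. b (n + k))"
  by (induction k arbitrary: b) (simp_all add: D_z_adjoint)

lemma disc_fun_basis: "z \<in> \<D> \<Longrightarrow> disc_fun (disc_basis k) z = z ^ k"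
proof -
  assume "z \<in> \<D>"
  then have "((\<lambda>n. disc_coeff (disc_basis k) n * z ^ n) has_sum disc_fun (disc_basis k) z) UNIV"
    using disc_expansion[of "disc_basis k"] by (auto simp: l2_expansion_def disc_monom_def)
  moreover have "((\<lambda>n. disc_coeff (disc_basis k) n * z ^ n) has_sum z ^ k) UNIV"
  proof -
    have "((\<lambda>n. disc_coeff (disc_basis k) n * z ^ n) has_sum z ^ k) {k}"
      using has_sum_finite[of "{k}" "\<lambda>n. disc_coeff (disc_basis k) n * z ^ n"]
      by (simp add: disc_coeff_basis)
    then show ?thesis
      by (rule has_sum_cong_neutral[THEN iffD1, rotated -1]) (auto simp: disc_coeff_basis)
  qed
  ultimately show ?thesis by (rule has_sum_unique)
qed

lemma D_z_pow_basis: "(D_z ^^ k) (disc_basis m) = disc_basis (m + k)"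
  by (rule disc_fun_eqI) (simp add: D_z_pow_fun disc_fun_basis power_add)

lemma M_z_tensor: "M_z (f \<otimes>\<^sub>h g) = D_z f \<otimes>\<^sub>h g"
  by (rule bidisc_fun_eqI) (auto simp: M_z.rep_eq simple_tensor.rep_eq D_z.rep_eq)

lemma M_w_tensor: "M_w (f \<otimes>\<^sub>h g) = f \<otimes>\<^sub>h D_z g"
  by (rule bidisc_fun_eqI) (auto simp: M_w.rep_eq simple_tensor.rep_eq D_z.rep_eq)

lemma M_pow_tensor:
  "(M_z ^^ k) (f \<otimes>\<^sub>h g) = (D_z ^^ k) f \<otimes>\<^sub>h g" "(M_w ^^ k) (f \<otimes>\<^sub>h g) = f \<otimes>\<^sub>h (D_z ^^ k) g"
  by (induction k) (simp_all add: M_z_tensor M_w_tensor)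

lemma M_z_norm: "norm (M_z F) = norm F"
proof -
  define j where "j = (\<lambda>(m, n). (Suc m, n :: nat))"
  have j: "inj j" by (auto simp: inj_def j_def)
  have "bidisc_coeff (M_z F) = (\<lambda>i. if i \<in> range j then bidisc_coeff F (inv j i) else 0)"
    using l2_expansion_shift[OF bidisc_expansion[of F] j, of fst]
    by (intro bidisc_coeffI) (simp add: M_z.rep_eq bidisc_monom_def j_def case_prod_unfold mult_ac)
  then have "bidisc_coeff (M_z F) (j i) = bidisc_coeff F i" for i
    using j by simp
  then have "bidisc_coeff (M_z F) (Suc m, n) = bidisc_coeff F (m, n)" for m n
    by (metis j_def case_prod_conv)
  then have "cinner (M_z F) (M_z F) = cinner F F"
    unfolding cinner_M_z by (simp add: cinner_hardy_bidisc_def)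
  then show ?thesis
    by (simp add: norm_hardy_bidisc_def inner_hardy_bidisc_def)
qed

lemma M_w_norm: "norm (M_w F) = norm F"
proof -
  define j where "j = (\<lambda>(m :: nat, n). (m, Suc n))"
  have j: "inj j" by (auto simp: inj_def j_def)
  have "bidisc_coeff (M_w F) = (\<lambda>i. if i \<in> range j then bidisc_coeff F (inv j i) else 0)"
    using l2_expansion_shift[OF bidisc_expansion[of F] j, of snd]
    by (intro bidisc_coeffI) (simp add: M_w.rep_eq bidisc_monom_def j_def case_prod_unfold mult_ac)
  then have "bidisc_coeff (M_w F) (j i) = bidisc_coeff F i" for i
    using j by simp
  then have "bidisc_coeff (M_w F) (m, Suc n) = bidisc_coeff F (m, n)" for m n
    by (metis j_def case_prod_conv)
  then have "cinner (M_w F) (M_w F) = cinner F F"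
    unfolding cinner_M_w by (simp add: cinner_hardy_bidisc_def)
  then show ?thesis
    by (simp add: norm_hardy_bidisc_def inner_hardy_bidisc_def)
qed

lemma bounded_clinear_M_z: "bounded_clinear M_z"
proof -
  have add: "M_z (F + G) = M_z F + M_z G" for F G
    by (rule bidisc_fun_eqI) (auto simp: M_z.rep_eq plus_hardy_bidisc.rep_eq distrib_left)
  have scale: "M_z (c *\<^sub>C F) = c *\<^sub>C M_z F" for c F
    by (rule bidisc_fun_eqI) (auto simp: M_z.rep_eq scaleC_hardy_bidisc.rep_eq)
  have "bounded_linear M_z"
    by (rule bounded_linear_intro[where K = 1]) (simp_all add: add scale scaleR_scaleC M_z_norm)
  then show ?thesis by (simp add: bounded_clinear_def scale)
qed

lemma bounded_clinear_M_w: "bounded_clinear M_w"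
proof -
  have add: "M_w (F + G) = M_w F + M_w G" for F G
    by (rule bidisc_fun_eqI) (auto simp: M_w.rep_eq plus_hardy_bidisc.rep_eq distrib_left)
  have scale: "M_w (c *\<^sub>C F) = c *\<^sub>C M_w F" for c F
    by (rule bidisc_fun_eqI) (auto simp: M_w.rep_eq scaleC_hardy_bidisc.rep_eq)
  have "bounded_linear M_w"
    by (rule bounded_linear_intro[where K = 1]) (simp_all add: add scale scaleR_scaleC M_w_norm)
  then show ?thesis by (simp add: bounded_clinear_def scale)
qed

section \<open>The rows of the Toeplitz and Hankel matrices of an inner function\<close>

text \<open>The function \<open>\<phi>(z) z\<^sup>n\<close> as an element of the Hardy space. It exists for inner \<open>\<phi>\<close>, and is
  unique because elements vanish outside the disc.\<close>

definition toeplitz_row :: "(complex \<Rightarrow> complex) \<Rightarrow> nat \<Rightarrow> hardy_disc"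
  where "toeplitz_row \<phi> n = (SOME h. \<forall>z\<in>\<D>. disc_fun h z = \<phi> z * z ^ n)"

text \<open>The backward shift of \<open>\<phi>\<close>, iterated \<open>n + 1\<close> times. The first coefficient of \<open>\<phi>\<close> is always lost,
  and this makes the rows orthogonal to \<open>\<phi> H\<^sup>2\<close>.\<close>

definition hankel_row :: "(complex \<Rightarrow> complex) \<Rightarrow> nat \<Rightarrow> hardy_disc"
  where "hankel_row \<phi> n =
    (SOME h. disc_coeff h = (\<lambda>i. disc_coeff (toeplitz_row \<phi> 0) (i + Suc n)))"

context
  fixes \<phi> assumes inner: "inner_function \<phi>"
begin

lemma toeplitz_row_props:
  "toeplitz_row \<phi> n = (D_z ^^ n) (toeplitz_row \<phi> 0)"
  "l2_inner (disc_coeff (toeplitz_row \<phi> 0)) (\<lambda>i. disc_coeff (toeplitz_row \<phi> 0) (i + k)) = (if k = 0 then 1 else 0)"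
  "z \<in> \<D> \<Longrightarrow> disc_fun (toeplitz_row \<phi> 0) z = \<phi> z"
proof -
  obtain c where c: "square_summable c"
    "\<And>z. z \<in> \<D> \<Longrightarrow> ((\<lambda>n. c n * z ^ n) has_sum \<phi> z) UNIV"
    "\<And>k. l2_inner c (\<lambda>n. c (n + k)) = (if k = 0 then 1 else 0)"
    using inner_function_coefficients[OF inner] by blast
  obtain h where h: "disc_coeff h = c" using disc_coeff_surj[OF c(1)] by blast
  have hz: "disc_fun h z = \<phi> z" if "z \<in> \<D>" for z
  proof (rule has_sum_unique[OF _ c(2)[OF that]])
    show "((\<lambda>n. c n * z ^ n) has_sum disc_fun h z) UNIV"
      using disc_expansion[of h] that by (auto simp: l2_expansion_def disc_monom_def h)
  qed
  have row: "toeplitz_row \<phi> n = (D_z ^^ n) h" for n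
    unfolding toeplitz_row_def
  proof (rule some_equality)
    show "\<forall>z\<in>\<D>. disc_fun ((D_z ^^ n) h) z = \<phi> z * z ^ n" by (simp add: D_z_pow_fun hz)
    then show "h' = (D_z ^^ n) h" if "\<forall>z\<in>\<D>. disc_fun h' z = \<phi> z * z ^ n" for h'
      using that by (intro disc_fun_eqI) simp
  qed
  have row0: "toeplitz_row \<phi> 0 = h" using row[of 0] by simp
  show "toeplitz_row \<phi> n = (D_z ^^ n) (toeplitz_row \<phi> 0)" by (simp add: row row0)
  show "l2_inner (disc_coeff (toeplitz_row \<phi> 0)) (\<lambda>i. disc_coeff (toeplitz_row \<phi> 0) (i + k)) = (if k = 0 then 1 else 0)"
    by (simp add: row0 h c(3))
  show "z \<in> \<D> \<Longrightarrow> disc_fun (toeplitz_row \<phi> 0) z = \<phi> z" by (simp add: row0 hz)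
qed

lemma toeplitz_row_fun: "z \<in> \<D> \<Longrightarrow> disc_fun (toeplitz_row \<phi> n) z = \<phi> z * z ^ n"
  by (subst toeplitz_row_props(1)) (simp add: D_z_pow_fun toeplitz_row_props(3))

lemma D_z_pow_toeplitz_row: "(D_z ^^ k) (toeplitz_row \<phi> n) = toeplitz_row \<phi> (n + k)"
  by (rule disc_fun_eqI) (simp add: D_z_pow_fun toeplitz_row_fun power_add)

lemma cinner_toeplitz_row_0: "cinner (toeplitz_row \<phi> k) (toeplitz_row \<phi> 0) = (if k = 0 then 1 else 0)"
  by (subst toeplitz_row_props(1)) (simp add: cinner_hardy_disc_def D_z_pow_adjoint toeplitz_row_props(2))

text \<open>The shift is isometric, so \<open>\<langle>z\<^sup>j\<^sup>+\<^sup>k \<phi>, z\<^sup>j \<phi>\<rangle> = \<langle>z\<^sup>k \<phi>, \<phi>\<rangle>\<close>, a correlation of the coefficients.\<close>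

lemma orthonormal_toeplitz_row: "orthonormal_family (toeplitz_row \<phi>)"
proof -
  have *: "cinner (toeplitz_row \<phi> (j + k)) (toeplitz_row \<phi> j) = (if k = 0 then 1 else 0)" for j k
  proof -
    have "cinner (toeplitz_row \<phi> (k + j)) (toeplitz_row \<phi> (0 + j))
        = cinner (toeplitz_row \<phi> k) (toeplitz_row \<phi> 0)"
      unfolding D_z_pow_toeplitz_row[symmetric] by (rule D_z_pow_isometry)
    then show ?thesis by (simp add: cinner_toeplitz_row_0 add.commute)
  qed
  have "cinner (toeplitz_row \<phi> i) (toeplitz_row \<phi> j) = (if i = j then 1 else 0)" if "j \<le> i" for i j
    using *[of j "i - j"] that by auto
  moreover from this have "cinner (toeplitz_row \<phi> i) (toeplitz_row \<phi> j) = (if i = j then 1 else 0)" if "i \<le> j" for i j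
    using that by (subst cinner_commute) auto
  ultimately show ?thesis
    unfolding orthonormal_family_def using nat_le_linear by blast
qed

lemma cinner_hankel_row: "cinner h (hankel_row \<phi> n) = cinner ((D_z ^^ Suc n) h) (toeplitz_row \<phi> 0)"
proof -
  let ?c = "disc_coeff (toeplitz_row \<phi> 0)"
  have "square_summable (\<lambda>i. ?c (i + Suc n))"
    by (rule square_summable_shift) simp
  then have "disc_coeff (hankel_row \<phi> n) = (\<lambda>i. ?c (i + Suc n))"
    unfolding hankel_row_def by (intro someI_ex[where P = "\<lambda>h. disc_coeff h = _"] disc_coeff_surj)
  then show ?thesis
    by (simp only: cinner_hardy_disc_def D_z_pow_adjoint)
qed

lemma toeplitz_row_orthogonal_hankel_row: "cinner (toeplitz_row \<phi> m) (hankel_row \<phi> n) = 0"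
  unfolding cinner_hankel_row D_z_pow_toeplitz_row by (simp add: cinner_toeplitz_row_0)

text \<open>The constant coefficients of the rows are the coefficients of \<open>\<phi>\<close> of positive
  index; they all vanish only if \<open>\<phi>\<close> is constant.\<close>

lemma hankel_row_nonzero:
  assumes "\<not> \<phi> constant_on \<D>"
  shows "\<exists>n. cinner (disc_basis 0) (hankel_row \<phi> n) \<noteq> 0"
proof (rule ccontr)
  assume "\<not> ?thesis"
  then have "cinner (disc_basis 0) (hankel_row \<phi> n) = 0" for n by blast
  then have "cinner (disc_basis (Suc n)) (toeplitz_row \<phi> 0) = 0" for n
    unfolding cinner_hankel_row D_z_pow_basis by simp
  then have "cinner (toeplitz_row \<phi> 0) (disc_basis (Suc n)) = 0" for n
    by (rule cinner_eq_zero_commute)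
  then have c: "disc_coeff (toeplitz_row \<phi> 0) n = 0" if "n \<noteq> 0" for n
    using that by (cases n) (simp_all add: cinner_disc_basis)
  have "\<phi> z = disc_coeff (toeplitz_row \<phi> 0) 0" if z: "z \<in> \<D>" for z
  proof -
    let ?t = "\<lambda>n. disc_coeff (toeplitz_row \<phi> 0) n * z ^ n"
    have "(?t has_sum \<phi> z) UNIV"
      using disc_expansion[of "toeplitz_row \<phi> 0"] z
      by (auto simp: l2_expansion_def disc_monom_def toeplitz_row_props(3)[symmetric])
    moreover have "(?t has_sum disc_coeff (toeplitz_row \<phi> 0) 0) UNIV"
    proof -
      have "(?t has_sum disc_coeff (toeplitz_row \<phi> 0) 0) {0}"
        using has_sum_finite[of "{0}" ?t] by simp
      then show ?thesis
        by (rule has_sum_cong_neutral[THEN iffD1, rotated -1]) (auto simp: c)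
    qed
    ultimately show ?thesis by (rule has_sum_unique)
  qed
  then show False using assms unfolding constant_on_def by blast
qed

text \<open>For \<open>h = \<phi> f\<close> the series \<open>\<Sum> f\<^sub>n \<phi> z\<^sup>n\<close> converges because its terms are orthogonal, and its sum is \<open>h\<close>
  because point evaluations are continuous. Hence what is orthogonal to all \<open>\<phi> z\<^sup>n\<close> is orthogonal to \<open>\<phi> H\<^sup>2\<close>.\<close>

lemma mult_range_expansion:
  assumes "h \<in> mult_range \<phi>"
  obtains a where "((\<lambda>n. a n *\<^sub>C toeplitz_row \<phi> n) has_sum h) UNIV"
proof -
  obtain f where f: "\<And>z. z \<in> \<D> \<Longrightarrow> disc_fun h z = \<phi> z * disc_fun f z"
    using assms unfolding mult_range_def by blast
  let ?x = "basis_map disc_basis (toeplitz_row \<phi>) f"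
  have hs: "((\<lambda>n. disc_coeff f n *\<^sub>C toeplitz_row \<phi> n) has_sum ?x) UNIV"
    using basis_map_has_sum[OF orthonormal_basis_disc
        orthonormal_imp_contractive[OF orthonormal_toeplitz_row], of f]
    by (simp add: cinner_disc_basis)
  have "?x = h"
  proof (rule disc_fun_eqI)
    fix z assume z: "z \<in> \<D>"
    \<comment> \<open>evaluation at \<open>z\<close> is continuous, being the inner product with the reproducing kernel\<close>
    have "square_summable (\<lambda>n. cnj (z ^ n))"
      using square_summable_cnj[OF square_summable_disc_monom[OF z]] by (simp add: disc_monom_def)
    then obtain k where k: "disc_coeff k = (\<lambda>n. cnj (z ^ n))" using disc_coeff_surj by blast
    have eval: "disc_fun g z = cinner g k" for g
      using disc_expansion[of g] z
      by (auto simp: l2_expansion_def disc_monom_def cinner_hardy_disc_def l2_inner_def k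
          intro!: infsumI[symmetric])
    have "((\<lambda>n. disc_coeff f n * (\<phi> z * z ^ n)) has_sum disc_fun ?x z) UNIV"
      using has_sum_cinner_left[OF hs, of k]
      unfolding cinner_scaleC_left unfolding eval[symmetric] toeplitz_row_fun[OF z] .
    moreover have "((\<lambda>n. \<phi> z * (disc_coeff f n * z ^ n)) has_sum \<phi> z * disc_fun f z) UNIV"
      using disc_expansion[of f] z
      by (intro has_sum_cmult_right) (auto simp: l2_expansion_def disc_monom_def)
    ultimately have "disc_fun ?x z = \<phi> z * disc_fun f z"
      by (intro has_sum_unique) (auto simp: mult_ac)
    then show "disc_fun ?x z = disc_fun h z" by (simp only: f[OF z])
  qed
  with hs show thesis by (intro that) simp
qed

lemma toeplitz_row_mult_range: "toeplitz_row \<phi> n \<in> mult_range \<phi>"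
  unfolding mult_range_def by (auto intro!: exI[of _ "disc_basis n"] simp: toeplitz_row_fun disc_fun_basis)

end

section \<open>Multiplication by an inner function of one variable\<close>

text \<open>Multiplication by \<open>\<phi>(z)\<close> and by \<open>\<psi>(w)\<close> is defined through the images of the monomials. These are
  orthonormal, so the operators are isometries by construction, and operator identities reduce to
  identities between simple tensors.\<close>

definition left_row :: "(complex \<Rightarrow> complex) \<Rightarrow> nat \<times> nat \<Rightarrow> hardy_bidisc"
  where "left_row \<phi> = (\<lambda>(m, n). toeplitz_row \<phi> m \<otimes>\<^sub>h disc_basis n)"

definition right_row :: "(complex \<Rightarrow> complex) \<Rightarrow> nat \<times> nat \<Rightarrow> hardy_bidisc"
  where "right_row \<psi> = (\<lambda>(m, n). disc_basis m \<otimes>\<^sub>h toeplitz_row \<psi> n)"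

definition mult_left :: "(complex \<Rightarrow> complex) \<Rightarrow> hardy_bidisc \<Rightarrow> hardy_bidisc"
  where "mult_left \<phi> = basis_map bidisc_basis (left_row \<phi>)"

definition mult_right :: "(complex \<Rightarrow> complex) \<Rightarrow> hardy_bidisc \<Rightarrow> hardy_bidisc"
  where "mult_right \<psi> = basis_map bidisc_basis (right_row \<psi>)"

definition monomial_mult :: "nat \<Rightarrow> nat \<Rightarrow> hardy_bidisc \<Rightarrow> hardy_bidisc"
  where "monomial_mult i j F = (M_z ^^ i) ((M_w ^^ j) F)"

lemma bounded_clinear_pow:
  fixes T :: "'a::complex_inner_space \<Rightarrow> 'a"
  shows "bounded_clinear T \<Longrightarrow> bounded_clinear (T ^^ k)"
proof (induction k)
  case 0
  then show ?case using bounded_clinear_id by (simp add: id_def)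
next
  case (Suc k)
  then have "bounded_clinear (\<lambda>x. T ((T ^^ k) x))" using bounded_clinear_compose by blast
  then show ?case by (simp add: o_def)
qed

lemma bounded_clinear_monomial_mult: "bounded_clinear (monomial_mult i j)"
  unfolding monomial_mult_def
  by (rule bounded_clinear_compose[OF bounded_clinear_pow[OF bounded_clinear_M_z]
      bounded_clinear_pow[OF bounded_clinear_M_w]])

lemma monomial_mult_tensor:
  "monomial_mult i j (f \<otimes>\<^sub>h g) = (D_z ^^ i) f \<otimes>\<^sub>h (D_z ^^ j) g"
  by (simp add: monomial_mult_def M_pow_tensor)

lemma norm_monomial_mult: "norm (monomial_mult i j F) = norm F"
proof -
  have "norm ((M_z ^^ i) G) = norm G" "norm ((M_w ^^ i) G) = norm G" for i G
    by (induction i) (simp_all add: M_z_norm M_w_norm)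
  then show ?thesis by (simp add: monomial_mult_def)
qed

lemma monomial_mult_basis: "monomial_mult i j (bidisc_basis (m, n)) = bidisc_basis (m + i, n + j)"
  by (simp add: bidisc_basis_def monomial_mult_tensor D_z_pow_basis)

lemma monomial_mult_commute:
  "monomial_mult i j (monomial_mult k l F) = monomial_mult k l (monomial_mult i j F)"
proof (rule basis_operator_eqI[OF orthonormal_basis_bidisc, where x = F])
  show "bounded_clinear (\<lambda>F. monomial_mult i j (monomial_mult k l F))"
    "bounded_clinear (\<lambda>F. monomial_mult k l (monomial_mult i j F))"
    by (rule bounded_clinear_compose[OF bounded_clinear_monomial_mult bounded_clinear_monomial_mult])+
  show "monomial_mult i j (monomial_mult k l (bidisc_basis p))
      = monomial_mult k l (monomial_mult i j (bidisc_basis p))" for p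
    by (cases p) (simp add: monomial_mult_basis add_ac)
qed

context
  fixes \<phi> assumes inner: "inner_function \<phi>"
begin

lemma orthonormal_left_row: "orthonormal_family (left_row \<phi>)"
  unfolding left_row_def
  by (intro orthonormal_tensor orthonormal_disc_basis orthonormal_toeplitz_row inner)

lemma orthonormal_right_row: "orthonormal_family (right_row \<phi>)"
  unfolding right_row_def
  by (intro orthonormal_tensor orthonormal_disc_basis orthonormal_toeplitz_row inner)

lemma bounded_clinear_mult_left: "bounded_clinear (mult_left \<phi>)"
  unfolding mult_left_def
  by (intro bounded_clinear_basis_map orthonormal_basis_bidisc orthonormal_imp_contractive
      orthonormal_left_row)

lemma bounded_clinear_mult_right: "bounded_clinear (mult_right \<phi>)"
  unfolding mult_right_def
  by (intro bounded_clinear_basis_map orthonormal_basis_bidisc orthonormal_imp_contractive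
      orthonormal_right_row)

lemma mult_left_basis: "mult_left \<phi> (bidisc_basis k) = left_row \<phi> k"
  unfolding mult_left_def
  by (intro basis_map_basis orthonormal_basis_bidisc orthonormal_imp_contractive
      orthonormal_left_row)

lemma mult_right_basis: "mult_right \<phi> (bidisc_basis k) = right_row \<phi> k"
  unfolding mult_right_def
  by (intro basis_map_basis orthonormal_basis_bidisc orthonormal_imp_contractive
      orthonormal_right_row)

lemma cinner_mult_left: "cinner (mult_left \<phi> F) (mult_left \<phi> G) = cinner F G"
  unfolding mult_left_def
  by (intro basis_map_isometry orthonormal_basis_bidisc orthonormal_left_row)

lemma cinner_mult_right: "cinner (mult_right \<phi> F) (mult_right \<phi> G) = cinner F G"
  unfolding mult_right_def
  by (intro basis_map_isometry orthonormal_basis_bidisc orthonormal_right_row)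

lemma mult_left_tensor: "mult_left \<phi> (disc_basis m \<otimes>\<^sub>h g) = toeplitz_row \<phi> m \<otimes>\<^sub>h g"
proof (rule basis_operator_eqI[OF orthonormal_basis_disc, where x = g])
  show "bounded_clinear (\<lambda>g. mult_left \<phi> (disc_basis m \<otimes>\<^sub>h g))"
    by (rule bounded_clinear_compose[OF bounded_clinear_mult_left bounded_clinear_tensor_right])
  show "bounded_clinear (\<lambda>g. toeplitz_row \<phi> m \<otimes>\<^sub>h g)" by (rule bounded_clinear_tensor_right)
  show "mult_left \<phi> (disc_basis m \<otimes>\<^sub>h disc_basis n) = toeplitz_row \<phi> m \<otimes>\<^sub>h disc_basis n" for n
    using mult_left_basis[of "(m, n)"] by (simp add: bidisc_basis_def left_row_def)
qed

lemma mult_right_tensor: "mult_right \<phi> (f \<otimes>\<^sub>h disc_basis n) = f \<otimes>\<^sub>h toeplitz_row \<phi> n"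
proof (rule basis_operator_eqI[OF orthonormal_basis_disc, where x = f])
  show "bounded_clinear (\<lambda>f. mult_right \<phi> (f \<otimes>\<^sub>h disc_basis n))"
    by (rule bounded_clinear_compose[OF bounded_clinear_mult_right bounded_clinear_tensor_left])
  show "bounded_clinear (\<lambda>f. f \<otimes>\<^sub>h toeplitz_row \<phi> n)" by (rule bounded_clinear_tensor_left)
  show "mult_right \<phi> (disc_basis m \<otimes>\<^sub>h disc_basis n) = disc_basis m \<otimes>\<^sub>h toeplitz_row \<phi> n" for m
    using mult_right_basis[of "(m, n)"] by (simp add: bidisc_basis_def right_row_def)
qed

lemma monomial_mult_mult_left:
  "monomial_mult i j (mult_left \<phi> F) = mult_left \<phi> (monomial_mult i j F)"
proof (rule basis_operator_eqI[OF orthonormal_basis_bidisc, where x = F])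
  show "bounded_clinear (\<lambda>F. monomial_mult i j (mult_left \<phi> F))"
    "bounded_clinear (\<lambda>F. mult_left \<phi> (monomial_mult i j F))"
    by (rule bounded_clinear_compose[OF bounded_clinear_monomial_mult bounded_clinear_mult_left]
        bounded_clinear_compose[OF bounded_clinear_mult_left bounded_clinear_monomial_mult])+
  show "monomial_mult i j (mult_left \<phi> (bidisc_basis p)) = mult_left \<phi> (monomial_mult i j (bidisc_basis p))" for p
    by (cases p) (simp add: mult_left_basis monomial_mult_basis left_row_def monomial_mult_tensor
        D_z_pow_basis D_z_pow_toeplitz_row[OF inner])
qed

lemma monomial_mult_mult_right:
  "monomial_mult i j (mult_right \<phi> F) = mult_right \<phi> (monomial_mult i j F)"
proof (rule basis_operator_eqI[OF orthonormal_basis_bidisc, where x = F])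
  show "bounded_clinear (\<lambda>F. monomial_mult i j (mult_right \<phi> F))"
    "bounded_clinear (\<lambda>F. mult_right \<phi> (monomial_mult i j F))"
    by (rule bounded_clinear_compose[OF bounded_clinear_monomial_mult bounded_clinear_mult_right]
        bounded_clinear_compose[OF bounded_clinear_mult_right bounded_clinear_monomial_mult])+
  show "monomial_mult i j (mult_right \<phi> (bidisc_basis p)) = mult_right \<phi> (monomial_mult i j (bidisc_basis p))" for p
    by (cases p) (simp add: mult_right_basis monomial_mult_basis right_row_def monomial_mult_tensor
        D_z_pow_basis D_z_pow_toeplitz_row[OF inner])
qed

lemma orthogonal_mult_left:
  assumes "\<And>k. cinner (left_row \<phi> k) F = 0"
  shows "cinner (mult_left \<phi> G) F = 0"
  using basis_adjointI[OF orthonormal_basis_bidisc bounded_clinear_mult_left, of F 0 G] assms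
  by (simp add: mult_left_basis)

lemma orthogonal_mult_right:
  assumes "\<And>k. cinner (right_row \<phi> k) F = 0"
  shows "cinner (mult_right \<phi> G) F = 0"
  using basis_adjointI[OF orthonormal_basis_bidisc bounded_clinear_mult_right, of F 0 G] assms
  by (simp add: mult_right_basis)

end

context
  fixes \<phi> \<psi> assumes inner: "inner_function \<phi>" "inner_function \<psi>"
begin

lemma mult_left_mult_right_commute:
  "mult_left \<phi> (mult_right \<psi> F) = mult_right \<psi> (mult_left \<phi> F)"
proof (rule basis_operator_eqI[OF orthonormal_basis_bidisc, where x = F])
  show "bounded_clinear (\<lambda>F. mult_left \<phi> (mult_right \<psi> F))"
    "bounded_clinear (\<lambda>F. mult_right \<psi> (mult_left \<phi> F))"
    by (rule bounded_clinear_compose[OF bounded_clinear_mult_left bounded_clinear_mult_right, OF inner]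
        bounded_clinear_compose[OF bounded_clinear_mult_right bounded_clinear_mult_left, OF inner(2,1)])+
  show "mult_left \<phi> (mult_right \<psi> (bidisc_basis p)) = mult_right \<psi> (mult_left \<phi> (bidisc_basis p))" for p
    by (cases p) (simp add: bidisc_basis_def mult_left_tensor mult_right_tensor inner)
qed

text \<open>Multiplication by \<open>\<psi>(w)\<close> is \<open>1 \<otimes> V\<close>, and its adjoint maps \<open>\<phi>(z) z\<^sup>m \<otimes> w\<^sup>n\<close> to \<open>\<phi>(z) z\<^sup>m \<otimes> V\<^sup>* w\<^sup>n\<close>,
  which again lies in the range of multiplication by \<open>\<phi>(z)\<close>.\<close>

lemma mult_right_preserves_left_orthogonality:
  assumes F: "\<And>k. cinner (left_row \<phi> k) F = 0"
  shows "cinner (left_row \<phi> k) (mult_right \<psi> F) = 0"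
proof (cases k)
  case (Pair m n)
  let ?V = "basis_map disc_basis (toeplitz_row \<psi>)"
  have V: "bounded_clinear ?V"
    by (intro bounded_clinear_basis_map orthonormal_basis_disc orthonormal_imp_contractive
        orthonormal_toeplitz_row inner)
  obtain y where y: "\<And>f. cinner (?V f) (disc_basis n) = cinner f y"
    using adjoint_exists[OF orthonormal_basis_disc V] by blast
  have "cinner (mult_right \<psi> F) (toeplitz_row \<phi> m \<otimes>\<^sub>h disc_basis n) = cinner F (toeplitz_row \<phi> m \<otimes>\<^sub>h y)"
  proof (rule basis_adjointI[OF orthonormal_basis_bidisc bounded_clinear_mult_right[OF inner(2)]])
    fix p
    have "cinner (toeplitz_row \<psi> b) (disc_basis n) = cinner (disc_basis b) y" for b
      using y[of "disc_basis b"]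
      by (simp add: basis_map_basis orthonormal_basis_disc orthonormal_imp_contractive
          orthonormal_toeplitz_row inner)
    then show "cinner (mult_right \<psi> (bidisc_basis p)) (toeplitz_row \<phi> m \<otimes>\<^sub>h disc_basis n)
        = cinner (bidisc_basis p) (toeplitz_row \<phi> m \<otimes>\<^sub>h y)"
      by (cases p) (simp add: bidisc_basis_def mult_right_tensor inner cinner_simple_tensor)
  qed
  moreover have "cinner (toeplitz_row \<phi> m \<otimes>\<^sub>h y) F = cinner y 0"
  proof (rule basis_adjointI[OF orthonormal_basis_disc bounded_clinear_tensor_right])
    show "cinner (toeplitz_row \<phi> m \<otimes>\<^sub>h disc_basis i) F = cinner (disc_basis i) 0" for i
      using F[of "(m, i)"] by (simp add: left_row_def)
  qed
  ultimately have "cinner (mult_right \<psi> F) (left_row \<phi> k) = 0"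
    by (simp add: Pair left_row_def cinner_eq_zero_commute)
  then show ?thesis by (rule cinner_eq_zero_commute)
qed

lemma mult_left_preserves_right_orthogonality:
  assumes F: "\<And>k. cinner (right_row \<psi> k) F = 0"
  shows "cinner (right_row \<psi> k) (mult_left \<phi> F) = 0"
proof (cases k)
  case (Pair m n)
  let ?V = "basis_map disc_basis (toeplitz_row \<phi>)"
  have V: "bounded_clinear ?V"
    by (intro bounded_clinear_basis_map orthonormal_basis_disc orthonormal_imp_contractive
        orthonormal_toeplitz_row inner)
  obtain y where y: "\<And>f. cinner (?V f) (disc_basis m) = cinner f y"
    using adjoint_exists[OF orthonormal_basis_disc V] by blast
  have "cinner (mult_left \<phi> F) (disc_basis m \<otimes>\<^sub>h toeplitz_row \<psi> n) = cinner F (y \<otimes>\<^sub>h toeplitz_row \<psi> n)"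
  proof (rule basis_adjointI[OF orthonormal_basis_bidisc bounded_clinear_mult_left[OF inner(1)]])
    fix p
    have "cinner (toeplitz_row \<phi> b) (disc_basis m) = cinner (disc_basis b) y" for b
      using y[of "disc_basis b"]
      by (simp add: basis_map_basis orthonormal_basis_disc orthonormal_imp_contractive
          orthonormal_toeplitz_row inner)
    then show "cinner (mult_left \<phi> (bidisc_basis p)) (disc_basis m \<otimes>\<^sub>h toeplitz_row \<psi> n)
        = cinner (bidisc_basis p) (y \<otimes>\<^sub>h toeplitz_row \<psi> n)"
      by (cases p) (simp add: bidisc_basis_def mult_left_tensor inner cinner_simple_tensor)
  qed
  moreover have "cinner (y \<otimes>\<^sub>h toeplitz_row \<psi> n) F = cinner y 0"
  proof (rule basis_adjointI[OF orthonormal_basis_disc bounded_clinear_tensor_left])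
    show "cinner (disc_basis i \<otimes>\<^sub>h toeplitz_row \<psi> n) F = cinner (disc_basis i) 0" for i
      using F[of "(i, n)"] by (simp add: right_row_def)
  qed
  ultimately have "cinner (mult_left \<phi> F) (right_row \<psi> k) = 0"
    by (simp add: Pair right_row_def cinner_eq_zero_commute)
  then show ?thesis by (rule cinner_eq_zero_commute)
qed

end

section \<open>The submodule as a sum of two ranges\<close>

definition model_complement :: "(complex \<Rightarrow> complex) \<Rightarrow> (complex \<Rightarrow> complex) \<Rightarrow> hardy_bidisc set"
  where "model_complement \<phi> \<psi> = orth_compl (model_space \<phi> \<otimes>\<^sub>H model_space \<psi>)"

lemma model_complement_iff:
  "F \<in> model_complement \<phi> \<psi> \<longleftrightarrow>
    (\<forall>f\<in>model_space \<phi>. \<forall>g\<in>model_space \<psi>. cinner (f \<otimes>\<^sub>h g) F = 0)"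
  unfolding model_complement_def hilbert_tensor_def orth_compl_closed_cspan
  by (auto simp: orth_compl_def intro: cinner_eq_zero_commute)

lemma model_complement_diff:
  "F \<in> model_complement \<phi> \<psi> \<Longrightarrow> G \<in> model_complement \<phi> \<psi> \<Longrightarrow> F - G \<in> model_complement \<phi> \<psi>"
  by (simp add: model_complement_iff cinner_diff_right)

context
  fixes \<phi> \<psi> assumes inner: "inner_function \<phi>" "inner_function \<psi>"
begin

lemma left_row_in_complement: "left_row \<phi> k \<in> model_complement \<phi> \<psi>"
  unfolding model_complement_iff
proof (intro ballI)
  fix f g assume "f \<in> model_space \<phi>"
  then have "cinner f (toeplitz_row \<phi> (fst k)) = 0"
    using toeplitz_row_mult_range[OF inner(1)] by (auto simp: model_space_def orth_compl_def)
  then show "cinner (f \<otimes>\<^sub>h g) (left_row \<phi> k) = 0"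
    by (simp add: left_row_def case_prod_unfold cinner_simple_tensor)
qed

lemma right_row_in_complement: "right_row \<psi> k \<in> model_complement \<phi> \<psi>"
  unfolding model_complement_iff
proof (intro ballI)
  fix f g assume "g \<in> model_space \<psi>"
  then have "cinner g (toeplitz_row \<psi> (snd k)) = 0"
    using toeplitz_row_mult_range[OF inner(2)] by (auto simp: model_space_def orth_compl_def)
  then show "cinner (f \<otimes>\<^sub>h g) (right_row \<psi> k) = 0"
    by (simp add: right_row_def case_prod_unfold cinner_simple_tensor)
qed

lemma mult_left_in_complement: "mult_left \<phi> F \<in> model_complement \<phi> \<psi>"
  using left_row_in_complement orthogonal_mult_left[OF inner(1)] unfolding model_complement_iff
  by (meson cinner_eq_zero_commute)

lemma mult_right_in_complement: "mult_right \<psi> F \<in> model_complement \<phi> \<psi>"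
  using right_row_in_complement orthogonal_mult_right[OF inner(2)] unfolding model_complement_iff
  by (meson cinner_eq_zero_commute)

text \<open>Fix \<open>g\<close> in the model space of \<open>\<psi>\<close> and let \<open>x\<close> represent the functional \<open>f \<mapsto> \<langle>f \<otimes> g, F\<rangle>\<close>. Orthogonality to the
  multiples of \<open>\<phi>(z)\<close> puts \<open>x\<close> in the model space of \<open>\<phi>\<close>, whereas \<open>F\<close> in the complement makes \<open>x\<close>
  orthogonal to that space; so \<open>x = 0\<close>. Now \<open>F\<close> is orthogonal to \<open>f \<otimes> g\<close> for arbitrary \<open>f\<close>, and the same argument
  in the other variable frees \<open>g\<close> as well.\<close>

lemma model_complement_eq_zeroI:
  assumes F: "F \<in> model_complement \<phi> \<psi>"
    and left: "\<And>k. cinner (left_row \<phi> k) F = 0" and right: "\<And>k. cinner (right_row \<psi> k) F = 0"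
  shows "F = 0"
proof -
  have null: "cinner s y = 0" if "(f has_sum s) UNIV" "\<And>i. cinner (f i) y = 0"
    for f s and y :: hardy_bidisc and i :: nat
    using has_sum_cinner_left[OF that(1), of y] has_sum_0[of UNIV "\<lambda>_. 0 :: complex"] that(2)
    by (auto intro: has_sum_unique)
  have mult_left_null: "cinner (h \<otimes>\<^sub>h g) F = 0" if h: "h \<in> mult_range \<phi>" for h g
  proof -
    obtain a where a: "((\<lambda>n. a n *\<^sub>C toeplitz_row \<phi> n) has_sum h) UNIV"
      using mult_range_expansion[OF inner(1) h] by blast
    have null_row: "cinner (toeplitz_row \<phi> n \<otimes>\<^sub>h g) F = cinner g 0" for n
    proof (rule basis_adjointI[OF orthonormal_basis_disc bounded_clinear_tensor_right])
      show "cinner (toeplitz_row \<phi> n \<otimes>\<^sub>h disc_basis i) F = cinner (disc_basis i) 0" for i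
        using left[of "(n, i)"] by (simp add: left_row_def)
    qed
    have sum: "((\<lambda>n. (a n *\<^sub>C toeplitz_row \<phi> n) \<otimes>\<^sub>h g) has_sum h \<otimes>\<^sub>h g) UNIV"
      using has_sum_bounded_linear[where h = "\<lambda>f. f \<otimes>\<^sub>h g", OF _ a] bounded_clinear_tensor_left[of g]
      unfolding bounded_clinear_def by blast
    show ?thesis
      by (rule null[OF sum])
        (simp add: bounded_clinear_scaleC[OF bounded_clinear_tensor_left] cinner_scaleC_left null_row)
  qed
  have mult_right_null: "cinner (f \<otimes>\<^sub>h h) F = 0" if h: "h \<in> mult_range \<psi>" for h f
  proof -
    obtain a where a: "((\<lambda>n. a n *\<^sub>C toeplitz_row \<psi> n) has_sum h) UNIV"
      using mult_range_expansion[OF inner(2) h] by blast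
    have null_row: "cinner (f \<otimes>\<^sub>h toeplitz_row \<psi> n) F = cinner f 0" for n
    proof (rule basis_adjointI[OF orthonormal_basis_disc bounded_clinear_tensor_left])
      show "cinner (disc_basis i \<otimes>\<^sub>h toeplitz_row \<psi> n) F = cinner (disc_basis i) 0" for i
        using right[of "(i, n)"] by (simp add: right_row_def)
    qed
    have sum: "((\<lambda>n. f \<otimes>\<^sub>h (a n *\<^sub>C toeplitz_row \<psi> n)) has_sum f \<otimes>\<^sub>h h) UNIV"
      using has_sum_bounded_linear[where h = "\<lambda>g. f \<otimes>\<^sub>h g", OF _ a] bounded_clinear_tensor_right[of f]
      unfolding bounded_clinear_def by blast
    show ?thesis
      by (rule null[OF sum])
        (simp add: bounded_clinear_scaleC[OF bounded_clinear_tensor_right] cinner_scaleC_left null_row)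
  qed
  have step: "cinner (f \<otimes>\<^sub>h g) F = 0" if g: "g \<in> model_space \<psi>" for f g
  proof -
    obtain x where x: "\<And>f. cinner (f \<otimes>\<^sub>h g) F = cinner f x"
      using adjoint_exists[OF orthonormal_basis_disc bounded_clinear_tensor_left] by blast
    have "x \<in> model_space \<phi>"
      using mult_left_null[of _ g] unfolding model_space_def orth_compl_def x
      by (auto intro: cinner_eq_zero_commute)
    then have "cinner x x = 0"
      using F g by (simp only: model_complement_iff x[symmetric])
    then show ?thesis by (simp add: x cinner_eq_zero_self)
  qed
  have "cinner (f \<otimes>\<^sub>h g) F = 0" for f g
  proof -
    obtain x where x: "\<And>g. cinner (f \<otimes>\<^sub>h g) F = cinner g x"
      using adjoint_exists[OF orthonormal_basis_disc bounded_clinear_tensor_right] by blast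
    have "x \<in> model_space \<psi>"
      using mult_right_null[of _ f] unfolding model_space_def orth_compl_def x
      by (auto intro: cinner_eq_zero_commute)
    then have "cinner x x = 0"
      using step[of x f] by (simp only: x)
    then show ?thesis by (simp add: x cinner_eq_zero_self)
  qed
  then have "cinner F (bidisc_basis k) = cinner 0 (bidisc_basis k)" for k
    by (cases k) (simp add: bidisc_basis_def cinner_eq_zero_commute)
  then show ?thesis by (rule basis_ext[OF orthonormal_basis_bidisc])
qed

text \<open>Subtract from \<open>F\<close> its projection \<open>A A\<^sup>* F\<close> onto the range of \<open>A\<close>, and from the rest its projection
  onto the range of \<open>B\<close>. As \<open>A\<close> and \<open>B\<close> doubly commute, the second step keeps the orthogonality to the
  range of \<open>A\<close>, so what remains is orthogonal to both ranges and lies in the complement.\<close>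

lemma model_complement_decomposition:
  assumes F: "F \<in> model_complement \<phi> \<psi>"
  obtains f g where "F = mult_left \<phi> f + mult_right \<psi> g"
proof -
  note bl = bounded_clinear_mult_left[OF inner(1)] bounded_clinear_mult_right[OF inner(2)]
  obtain f where f: "\<And>x. cinner (mult_left \<phi> x) F = cinner x f"
    using adjoint_exists[OF orthonormal_basis_bidisc bl(1)] by blast
  define R where "R = F - mult_left \<phi> f"
  have R: "cinner (mult_left \<phi> x) R = 0" for x
    by (simp add: R_def cinner_diff_right f cinner_mult_left[OF inner(1)])
  obtain g where g: "\<And>x. cinner (mult_right \<psi> x) R = cinner x g"
    using adjoint_exists[OF orthonormal_basis_bidisc bl(2)] by blast
  define T where "T = R - mult_right \<psi> g"
  have "T = 0"
  proof (rule model_complement_eq_zeroI)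
    show "T \<in> model_complement \<phi> \<psi>"
      unfolding T_def R_def
      by (intro model_complement_diff F mult_left_in_complement mult_right_in_complement)
    fix k
    have "cinner (mult_right \<psi> (bidisc_basis k)) T = 0"
      by (simp add: T_def cinner_diff_right g cinner_mult_right[OF inner(2)])
    then show "cinner (right_row \<psi> k) T = 0" by (simp add: mult_right_basis[OF inner(2)])
    have "cinner (left_row \<phi> k) g = 0" for k
      by (simp only: g[symmetric] mult_left_basis[OF inner(1), symmetric]
          mult_left_mult_right_commute[OF inner, symmetric] R)
    then have "cinner (left_row \<phi> k) (mult_right \<psi> g) = 0"
      by (rule mult_right_preserves_left_orthogonality[OF inner])
    then show "cinner (left_row \<phi> k) T = 0"
      using R[of "bidisc_basis k"] by (simp add: T_def cinner_diff_right mult_left_basis[OF inner(1)])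
  qed
  then have "F = mult_left \<phi> f + mult_right \<psi> g" by (simp add: T_def R_def algebra_simps)
  then show thesis by (rule that)
qed

end

section \<open>Two generators suffice\<close>

lemma monomial_op_eq: "monomial_op [M_z, M_w] [i, j] = monomial_mult i j"
  by (simp add: monomial_op_def monomial_mult_def fun_eq_iff)

lemma generated_subspace_eq:
  "generated_subspace [M_z, M_w] E = closed_cspan {monomial_mult i j F | i j F. F \<in> E}"
proof -
  have "{monomial_op [M_z, M_w] ks F | ks F. length ks = length [M_z, M_w] \<and> F \<in> E}
      = {monomial_mult i j F | i j F. F \<in> E}"
    by (force simp: length_Suc_conv numeral_2_eq_2 monomial_op_eq[symmetric])
  then show ?thesis by (simp add: generated_subspace_def)
qed

lemma closed_cspan_has_sum:
  assumes "\<And>i. f i \<in> cspan A" "((\<lambda>i. a i *\<^sub>C f i) has_sum s) UNIV"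
  shows "s \<in> closed_cspan A"
proof -
  interpret vector_space "scaleC :: complex \<Rightarrow> 'b \<Rightarrow> 'b" by (rule vector_space_scaleC)
  have "(\<Sum>i\<in>F. a i *\<^sub>C f i) \<in> cspan A" for F
    using assms(1) unfolding cspan_def by (intro span_sum span_scale)
  then show ?thesis
    using assms(2) unfolding has_sum_def closed_cspan_def closure_def
    by (intro Lim_in_closed_set[OF closed_closure, unfolded closure_def]) (auto simp: finite_subsets_at_top_neq_bot)
qed

lemma closed_cspan_add: "x \<in> closed_cspan A \<Longrightarrow> y \<in> closed_cspan A \<Longrightarrow> x + y \<in> closed_cspan A"
proof -
  interpret vector_space "scaleC :: complex \<Rightarrow> 'a \<Rightarrow> 'a" by (rule vector_space_scaleC)
  assume "x \<in> closed_cspan A" "y \<in> closed_cspan A"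
  then obtain u v where "\<And>n :: nat. u n \<in> cspan A" "u \<longlonglongrightarrow> x" "\<And>n :: nat. v n \<in> cspan A" "v \<longlonglongrightarrow> y"
    unfolding closed_cspan_def closure_sequential by blast
  then have "\<forall>n. u n + v n \<in> cspan A" "(\<lambda>n. u n + v n) \<longlonglongrightarrow> x + y"
    by (auto simp: cspan_def intro: span_add tendsto_add)
  then show ?thesis
    unfolding closed_cspan_def closure_sequential by (intro exI[of _ "\<lambda>n. u n + v n"] conjI)
qed

text \<open>The rows are the monomial multiples of the two generators, and \<open>A f + B g\<close> is a convergent
  combination of rows.\<close>

lemma model_complement_generated:
  assumes inner: "inner_function \<phi>" "inner_function \<psi>"
  shows "generated_subspace [M_z, M_w] {left_row \<phi> (0, 0), right_row \<psi> (0, 0)} = model_complement \<phi> \<psi>"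
    (is "generated_subspace _ ?E = ?S")
proof
  interpret vector_space "scaleC :: complex \<Rightarrow> hardy_bidisc \<Rightarrow> hardy_bidisc" by (rule vector_space_scaleC)
  let ?A = "{monomial_mult i j F | i j F. F \<in> ?E}"
  have S: "submodule ?S" unfolding model_complement_def by (rule submodule_orth_compl_model_tensor)
  have inv: "M_z F \<in> ?S" "M_w F \<in> ?S" if "F \<in> ?S" for F
    using S that by (auto simp: submodule_def)
  have pow: "(M_z ^^ i) F \<in> ?S" "(M_w ^^ i) F \<in> ?S" if "F \<in> ?S" for i F
    using that by (induction i) (simp_all add: inv)
  have "?A \<subseteq> ?S"
    using left_row_in_complement[OF inner, of "(0, 0)"] right_row_in_complement[OF inner, of "(0, 0)"]
    by (auto simp: monomial_mult_def pow)
  then have "span ?A \<subseteq> ?S" using S by (intro span_minimal) (auto simp: submodule_def)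
  then show "generated_subspace [M_z, M_w] ?E \<subseteq> ?S"
    using S unfolding generated_subspace_eq closed_cspan_def cspan_def
    by (intro closure_minimal) (auto simp: submodule_def)
  show "?S \<subseteq> generated_subspace [M_z, M_w] ?E"
  proof
    fix F assume "F \<in> ?S"
    then obtain f g where F: "F = mult_left \<phi> f + mult_right \<psi> g"
      by (rule model_complement_decomposition[OF inner])
    have row: "left_row \<phi> (m, n) = monomial_mult m n (left_row \<phi> (0, 0))"
      "right_row \<psi> (m, n) = monomial_mult m n (right_row \<psi> (0, 0))" for m n
      by (simp_all add: left_row_def right_row_def monomial_mult_tensor D_z_pow_basis
          D_z_pow_toeplitz_row inner)
    have "left_row \<phi> k \<in> ?A" "right_row \<psi> k \<in> ?A" for k
      by (cases k, use row in blast)+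
    then have mem: "left_row \<phi> k \<in> cspan ?A" "right_row \<psi> k \<in> cspan ?A" for k
      unfolding cspan_def using span_base by blast+
    have "mult_left \<phi> f \<in> closed_cspan ?A"
      unfolding mult_left_def
      by (rule closed_cspan_has_sum[OF mem(1) basis_map_has_sum[OF orthonormal_basis_bidisc
            orthonormal_imp_contractive[OF orthonormal_left_row[OF inner(1)]]]])
    moreover have "mult_right \<psi> g \<in> closed_cspan ?A"
      unfolding mult_right_def
      by (rule closed_cspan_has_sum[OF mem(2) basis_map_has_sum[OF orthonormal_basis_bidisc
            orthonormal_imp_contractive[OF orthonormal_right_row[OF inner(2)]]]])
    ultimately show "F \<in> generated_subspace [M_z, M_w] ?E"
      unfolding generated_subspace_eq F by (rule closed_cspan_add)
  qed
qed

section \<open>The Hankel form with symbol \<open>\<phi>(z) \<psi>(w)\<close>\<close>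

text \<open>The entries \<open>\<langle>bidisc_basis i, hankel_family \<phi> \<psi> j\<rangle>\<close> are the conjugates of the coefficients of
  \<open>\<phi>(z) \<psi>(w)\<close> at \<open>i + j + (1, 1)\<close>.\<close>

definition hankel_family :: "(complex \<Rightarrow> complex) \<Rightarrow> (complex \<Rightarrow> complex) \<Rightarrow> nat \<times> nat \<Rightarrow> hardy_bidisc"
  where "hankel_family \<phi> \<psi> = (\<lambda>(m, n). hankel_row \<phi> m \<otimes>\<^sub>h hankel_row \<psi> n)"

definition hankel_conj :: "(complex \<Rightarrow> complex) \<Rightarrow> (complex \<Rightarrow> complex) \<Rightarrow> hardy_bidisc \<Rightarrow> hardy_bidisc"
  where "hankel_conj \<phi> \<psi> = hankel_map bidisc_basis (hankel_family \<phi> \<psi>)"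

context
  fixes \<phi> \<psi> assumes inner: "inner_function \<phi>" "inner_function \<psi>"
begin

lemma cinner_disc_basis_hankel_row:
  assumes "inner_function \<theta>"
  shows "cinner (disc_basis i) (hankel_row \<theta> j) = cinner (disc_basis (Suc (i + j))) (toeplitz_row \<theta> 0)"
  unfolding cinner_hankel_row[OF assms] D_z_pow_basis by simp

lemma hankel_family_symmetric:
  "cinner (bidisc_basis i) (hankel_family \<phi> \<psi> j) = cinner (bidisc_basis j) (hankel_family \<phi> \<psi> i)"
  by (cases i; cases j) (simp add: bidisc_basis_def hankel_family_def cinner_simple_tensor
      cinner_disc_basis_hankel_row inner add.commute)

text \<open>Reversing the order of the indices up to \<open>N\<close> turns the Hankel matrix of a symbol into
  its Toeplitz matrix: backward shifting by \<open>c + 1\<close> is shifting forward by \<open>N - c\<close> and then backward by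
  \<open>N + 1\<close>.\<close>

lemma cinner_hankel_family:
  assumes "c \<le> N" "d \<le> N"
  shows "cinner F (hankel_family \<phi> \<psi> (c, d))
    = cinner (monomial_mult (Suc N) (Suc N) F) (toeplitz_row \<phi> (N - c) \<otimes>\<^sub>h toeplitz_row \<psi> (N - d))"
proof (rule sym, rule basis_adjointI[OF orthonormal_basis_bidisc bounded_clinear_monomial_mult])
  fix p
  have *: "cinner ((D_z ^^ Suc N) h) (toeplitz_row \<theta> (N - c)) = cinner h (hankel_row \<theta> c)"
    if "inner_function \<theta>" "c \<le> N" for h \<theta> c
  proof -
    have "(D_z ^^ Suc N) h = (D_z ^^ (N - c)) ((D_z ^^ Suc c) h)"
      using that(2) funpow_add[of "N - c" "Suc c" D_z] by simp
    moreover have "toeplitz_row \<theta> (N - c) = (D_z ^^ (N - c)) (toeplitz_row \<theta> 0)"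
      by (simp add: D_z_pow_toeplitz_row that)
    ultimately show ?thesis
      by (simp only: D_z_pow_isometry cinner_hankel_row[OF that(1)])
  qed
  show "cinner (monomial_mult (Suc N) (Suc N) (bidisc_basis p)) (toeplitz_row \<phi> (N - c) \<otimes>\<^sub>h toeplitz_row \<psi> (N - d))
      = cinner (bidisc_basis p) (hankel_family \<phi> \<psi> (c, d))"
    using assms by (cases p) (simp only: bidisc_basis_def hankel_family_def case_prod_conv
        monomial_mult_tensor cinner_simple_tensor *[OF inner(1)] *[OF inner(2)])
qed

text \<open>After the reversal of indices, a finite combination of Hankel rows is tested against a
  combination of the orthonormal functions \<open>\<phi>(z) \<psi>(w) z\<^sup>m w\<^sup>n\<close> with the same coefficients. This is the
  trivial half of Nehari's theorem for a unimodular symbol.\<close>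

lemma contractive_hankel_family: "contractive_family (hankel_family \<phi> \<psi>)"
  unfolding contractive_family_def
proof (intro allI impI)
  fix F :: "(nat \<times> nat) set" and a :: "nat \<times> nat \<Rightarrow> complex"
  assume F: "finite F"
  \<comment> \<open>any common bound for the indices in \<open>F\<close> serves\<close>
  define N where "N = Max (insert 0 (fst ` F \<union> snd ` F))"
  have N: "c \<le> N" "d \<le> N" if "(c, d) \<in> F" for c d
    using F that unfolding N_def by (auto intro!: Max_ge image_eqI[of _ _ "(c, d)"])
  let ?t = "\<lambda>(m, n). toeplitz_row \<phi> m \<otimes>\<^sub>h toeplitz_row \<psi> n"
  define \<rho> where "\<rho> = (\<lambda>(c, d). (N - c, N - d))"
  have \<rho>: "\<rho> (\<rho> j) = j" if "j \<in> F" for j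
    using N that by (cases j) (auto simp: \<rho>_def)
  have inj: "inj_on \<rho> F" by (rule inj_on_inverseI) (rule \<rho>)
  have t: "orthonormal_family ?t"
    by (intro orthonormal_tensor orthonormal_toeplitz_row inner)
  let ?x = "\<Sum>j\<in>F. a j *\<^sub>C hankel_family \<phi> \<psi> j" and ?y = "\<Sum>j\<in>F. a j *\<^sub>C ?t (\<rho> j)"
  let ?s = "\<Sum>j\<in>F. (cmod (a j))\<^sup>2"
  have "?y = (\<Sum>k\<in>\<rho> ` F. a (\<rho> k) *\<^sub>C ?t k)"
    by (subst sum.reindex[OF inj]) (simp add: \<rho>)
  then have "(norm ?y)\<^sup>2 = (\<Sum>k\<in>\<rho> ` F. (cmod (a (\<rho> k)))\<^sup>2)"
    using norm_orthonormal_sum[OF t, of "\<rho> ` F" "\<lambda>k. a (\<rho> k)"] F by simp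
  also have "\<dots> = ?s" by (subst sum.reindex[OF inj]) (simp add: \<rho>)
  finally have y: "(norm ?y)\<^sup>2 = ?s" .
  have "cinner ?x ?x = (\<Sum>j\<in>F. cnj (a j) * cinner ?x (hankel_family \<phi> \<psi> j))"
    by (simp only: cinner_sum_right cinner_scaleC_right)
  also have "\<dots> = (\<Sum>j\<in>F. cnj (a j) * cinner (monomial_mult (Suc N) (Suc N) ?x) (?t (\<rho> j)))"
  proof (rule sum.cong)
    fix j assume "j \<in> F"
    then show "cnj (a j) * cinner ?x (hankel_family \<phi> \<psi> j)
        = cnj (a j) * cinner (monomial_mult (Suc N) (Suc N) ?x) (?t (\<rho> j))"
      using cinner_hankel_family[of "fst j" N "snd j" ?x] N[of "fst j" "snd j"]
      by (simp add: \<rho>_def case_prod_unfold)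
  qed simp
  also have "\<dots> = cinner (monomial_mult (Suc N) (Suc N) ?x) ?y"
    by (simp only: cinner_sum_right cinner_scaleC_right)
  finally have "cmod (cinner ?x ?x) = cmod (cinner (monomial_mult (Suc N) (Suc N) ?x) ?y)"
    by (rule arg_cong)
  also have "\<dots> \<le> norm ?x * norm ?y"
    using cinner_bound[of "monomial_mult (Suc N) (Suc N) ?x" ?y] by (simp only: norm_monomial_mult)
  finally have le: "norm ?x * norm ?x \<le> norm ?x * norm ?y"
    by (simp only: cinner_self norm_of_real power2_eq_square abs_mult_self_eq)
  have "norm ?x \<le> norm ?y"
  proof (cases "norm ?x = 0")
    case True
    then show ?thesis by (metis norm_ge_zero)
  next
    case False
    then have "0 < norm ?x" by (simp only: zero_less_norm_iff norm_eq_zero not_False_eq_True)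
    with le show ?thesis by (rule mult_left_le_imp_le)
  qed
  then show "(norm ?x)\<^sup>2 \<le> ?s" unfolding y[symmetric] by (intro power_mono) simp_all
qed

lemma hankel_conj_symmetric: "cinner F (hankel_conj \<phi> \<psi> G) = cinner G (hankel_conj \<phi> \<psi> F)"
  unfolding hankel_conj_def
  by (rule hankel_map_symmetric[OF orthonormal_basis_bidisc contractive_hankel_family
        hankel_family_symmetric])

lemma hankel_conj_monomial_mult:
  "cinner (monomial_mult i j F) (hankel_conj \<phi> \<psi> G) = cinner F (hankel_conj \<phi> \<psi> (monomial_mult i j G))"
  unfolding hankel_conj_def
proof (rule hankel_map_intertwines_shift[OF orthonormal_basis_bidisc contractive_hankel_family
        hankel_family_symmetric bounded_clinear_monomial_mult, where \<sigma> = "\<lambda>(m, n). (m + i, n + j)"])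
  show "monomial_mult i j (bidisc_basis p) = bidisc_basis (case p of (m, n) \<Rightarrow> (m + i, n + j))" for p
    by (cases p) (simp add: monomial_mult_basis)
  show "cinner (bidisc_basis (case p of (m, n) \<Rightarrow> (m + i, n + j))) (hankel_family \<phi> \<psi> q)
      = cinner (bidisc_basis p) (hankel_family \<phi> \<psi> (case q of (m, n) \<Rightarrow> (m + i, n + j)))" for p q
    by (cases p; cases q) (simp add: bidisc_basis_def hankel_family_def cinner_simple_tensor
        cinner_disc_basis_hankel_row inner add_ac)
qed

text \<open>The form vanishes on the range of \<open>A\<close>: the factor \<open>\<phi>(z)\<close> cancels its conjugate in the symbol and
  leaves an analytic function that vanishes at \<open>z = 0\<close>.\<close>

lemma left_row_orthogonal_hankel_conj: "cinner (left_row \<phi> k) (hankel_conj \<phi> \<psi> G) = 0"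
  unfolding hankel_conj_def
  by (rule hankel_map_orthogonal[OF orthonormal_basis_bidisc contractive_hankel_family])
    (simp add: left_row_def hankel_family_def case_prod_unfold cinner_simple_tensor
      toeplitz_row_orthogonal_hankel_row inner)

lemma right_row_orthogonal_hankel_conj: "cinner (right_row \<psi> k) (hankel_conj \<phi> \<psi> G) = 0"
  unfolding hankel_conj_def
  by (rule hankel_map_orthogonal[OF orthonormal_basis_bidisc contractive_hankel_family])
    (simp add: right_row_def hankel_family_def case_prod_unfold cinner_simple_tensor
      toeplitz_row_orthogonal_hankel_row inner)

text \<open>These two relations separate the components of \<open>A f + B g\<close>: the functional \<open>\<langle>_, A J x\<rangle>\<close> sees only
  \<open>f\<close> and the functional \<open>\<langle>_, B J x\<rangle>\<close> sees only \<open>g\<close>, where \<open>J\<close> is the Hankel operator.\<close>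

lemma mult_right_mult_left_hankel_conj:
  "cinner (mult_right \<psi> F) (mult_left \<phi> (hankel_conj \<phi> \<psi> G)) = 0"
  by (intro orthogonal_mult_right[OF inner(2)] mult_left_preserves_right_orthogonality[OF inner]
      right_row_orthogonal_hankel_conj)

lemma mult_left_mult_right_hankel_conj:
  "cinner (mult_left \<phi> F) (mult_right \<psi> (hankel_conj \<phi> \<psi> G)) = 0"
  by (intro orthogonal_mult_left[OF inner(1)] mult_right_preserves_left_orthogonality[OF inner]
      left_row_orthogonal_hankel_conj)

section \<open>One generator does not suffice\<close>

lemma generated_subspace_orthogonal:
  assumes E: "E \<subseteq> {F}" and orth: "\<And>i j. cinner (monomial_mult i j F) X = 0"
    and G: "G \<in> generated_subspace [M_z, M_w] E"
  shows "cinner G X = 0"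
proof -
  interpret vector_space "scaleC :: complex \<Rightarrow> hardy_bidisc \<Rightarrow> hardy_bidisc" by (rule vector_space_scaleC)
  have "generated_subspace [M_z, M_w] E \<subseteq> orth_compl {X}"
    unfolding generated_subspace_eq closed_cspan_def cspan_def
    by (intro closure_minimal closed_orth_compl span_minimal subspace_orth_compl)
      (use E orth in \<open>auto simp: orth_compl_def\<close>)
  then show ?thesis using G by (auto simp: orth_compl_def)
qed

text \<open>Let \<open>F = A f + B g\<close> generate. The step \<open>first\<close> uses the determinant functional
  \<open>A x + B y \<mapsto> \<Gamma>(x, q g) - \<Gamma>(y, q f)\<close> for a monomial \<open>q\<close>. It vanishes at \<open>p F\<close> for every monomial \<open>p\<close> by the symmetry
  \<open>\<Gamma>(p f, q g) = \<Gamma>(p g, q f)\<close>, hence at \<open>A x\<close> for every \<open>x\<close>, and \<open>\<Gamma>(x, q g) = 0\<close>. Therefore the functional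
  \<open>A x' + B y \<mapsto> \<Gamma>(y, x)\<close> vanishes at all \<open>q F\<close> too, and the step \<open>second\<close> evaluates it at \<open>B y\<close>. So \<open>\<Gamma> = 0\<close>,
  which contradicts the nonconstancy of \<open>\<phi>\<close> and \<open>\<psi>\<close>.\<close>

lemma model_complement_not_singly_generated:
  assumes nonconst: "\<not> \<phi> constant_on \<D>" "\<not> \<psi> constant_on \<D>"
    and E: "E \<subseteq> {F}" and F: "F \<in> model_complement \<phi> \<psi>"
  shows "generated_subspace [M_z, M_w] E \<noteq> model_complement \<phi> \<psi>"
proof
  let ?J = "hankel_conj \<phi> \<psi>"
  assume gen: "generated_subspace [M_z, M_w] E = model_complement \<phi> \<psi>"
  obtain f g where fg: "F = mult_left \<phi> f + mult_right \<psi> g"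
    using F by (rule model_complement_decomposition[OF inner])
  have mF: "monomial_mult i j F = mult_left \<phi> (monomial_mult i j f) + mult_right \<psi> (monomial_mult i j g)" for i j
    by (simp add: fg bounded_clinear_add[OF bounded_clinear_monomial_mult]
        monomial_mult_mult_left monomial_mult_mult_right inner)
  have anti: "cinner (monomial_mult i j f) (?J (monomial_mult k l g))
      = cinner (monomial_mult i j g) (?J (monomial_mult k l f))" for i j k l
  proof -
    have "cinner (monomial_mult i j f) (?J (monomial_mult k l g))
        = cinner (monomial_mult k l g) (?J (monomial_mult i j f))"
      by (rule hankel_conj_symmetric)
    also have "\<dots> = cinner (monomial_mult i j (monomial_mult k l g)) (?J f)"
      by (rule hankel_conj_monomial_mult[symmetric])
    also have "\<dots> = cinner (monomial_mult k l (monomial_mult i j g)) (?J f)"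
      by (simp only: monomial_mult_commute)
    also have "\<dots> = cinner (monomial_mult i j g) (?J (monomial_mult k l f))"
      by (rule hankel_conj_monomial_mult)
    finally show ?thesis .
  qed
  have first: "cinner x (?J (monomial_mult k l g)) = 0" for x k l
  proof -
    let ?X = "mult_left \<phi> (?J (monomial_mult k l g)) - mult_right \<psi> (?J (monomial_mult k l f))"
    have "cinner (monomial_mult i j F) ?X = 0" for i j
      by (simp add: mF cinner_add_left cinner_diff_right cinner_mult_left cinner_mult_right inner
          mult_right_mult_left_hankel_conj mult_left_mult_right_hankel_conj anti)
    then have "cinner (mult_left \<phi> x) ?X = 0"
      using generated_subspace_orthogonal[OF E] gen mult_left_in_complement[OF inner] by blast
    then show ?thesis
      by (simp add: cinner_diff_right cinner_mult_left inner mult_left_mult_right_hankel_conj)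
  qed
  have second: "cinner y (?J x) = 0" for x y
  proof -
    let ?X = "mult_right \<psi> (?J x)"
    have "cinner (monomial_mult i j g) (?J x) = 0" for i j
      by (subst hankel_conj_symmetric) (rule first)
    then have "cinner (monomial_mult i j F) ?X = 0" for i j
      by (simp add: mF cinner_add_left cinner_mult_right inner mult_left_mult_right_hankel_conj)
    then have "cinner (mult_right \<psi> y) ?X = 0"
      using generated_subspace_orthogonal[OF E] gen mult_right_in_complement[OF inner] by blast
    then show ?thesis by (simp add: cinner_mult_right inner)
  qed
  obtain a b where "cinner (disc_basis 0) (hankel_row \<phi> a) \<noteq> 0" "cinner (disc_basis 0) (hankel_row \<psi> b) \<noteq> 0"
    using hankel_row_nonzero[OF inner(1) nonconst(1)] hankel_row_nonzero[OF inner(2) nonconst(2)] by blast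
  then have "cinner (bidisc_basis (0, 0)) (hankel_family \<phi> \<psi> (a, b)) \<noteq> 0"
    by (simp add: bidisc_basis_def hankel_family_def cinner_simple_tensor)
  moreover have "cinner (bidisc_basis (a, b)) (?J (bidisc_basis (0, 0)))
      = cinner (bidisc_basis (0, 0)) (hankel_family \<phi> \<psi> (a, b))"
    unfolding hankel_conj_def
    by (rule cinner_basis_hankel_map[OF orthonormal_basis_bidisc contractive_hankel_family
          hankel_family_symmetric])
  ultimately show False using second by metis
qed

end

theorem theorem2p1:
  fixes \<phi> \<psi> :: "complex \<Rightarrow> complex" and S :: "hardy_bidisc set"
  assumes "inner_function \<phi>" and "\<not> \<phi> constant_on \<D>"
    and "inner_function \<psi>" and "\<not> \<psi> constant_on \<D>"
    and "S = orth_compl (model_space \<phi> \<otimes>\<^sub>H model_space \<psi>)"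
  shows "submodule_rank S = 2"
proof (rule antisym)
  have S: "S = model_complement \<phi> \<psi>" using assms(5) by (simp add: model_complement_def)
  let ?E = "{left_row \<phi> (0, 0), right_row \<psi> (0, 0)}"
  have "?E \<subseteq> S"
    using left_row_in_complement[OF assms(1,3)] right_row_in_complement[OF assms(1,3)] by (simp add: S)
  moreover have "generated_subspace [M_z, M_w] ?E = S"
    unfolding S by (rule model_complement_generated[OF assms(1,3)])
  ultimately have "submodule_rank S \<le> ecard ?E"
    unfolding submodule_rank_def operator_rank_def by (intro Inf_lower) blast
  also have "\<dots> \<le> 2"
    by (auto simp: ecard_def numeral_eq_enat card_insert_if)
  finally show "submodule_rank S \<le> 2" .
  show "2 \<le> submodule_rank S"
    unfolding submodule_rank_def operator_rank_def
  proof (rule Inf_greatest)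
    fix n assume "n \<in> {ecard E | E. E \<subseteq> S \<and> generated_subspace [M_z, M_w] E = S}"
    then obtain E where n: "n = ecard E" and E: "E \<subseteq> S" "generated_subspace [M_z, M_w] E = S" by blast
    have "2 \<le> ecard E"
    proof (rule ccontr)
      assume "\<not> 2 \<le> ecard E"
      then have "finite E" "card E < 2"
        by (auto simp: ecard_def numeral_eq_enat split: if_splits)
      then have "E = {} \<or> (\<exists>F. E = {F})"
        by (auto simp: less_2_cases_iff card_1_singleton_iff)
      \<comment> \<open>an empty \<open>E\<close> is covered by the generator \<open>0\<close>\<close>
      moreover have "0 \<in> S" by (simp add: S model_complement_iff)
      ultimately obtain F where "F \<in> S" "E \<subseteq> {F}" using E(1) by blast
      then show False
        using model_complement_not_singly_generated[OF assms(1,3,2,4)] E(2) S by blast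
    qed
    then show "2 \<le> n" by (simp only: n)
  qed
qed

end
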